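(* Let $d\ge 1$, let $f$ be a bounded, almost everywhere continuous probability density on $\mathbb{R}^d$, let $\{t_n : n\ge 1\}$ be a strictly decreasing sequence of positive numbers with $t_n\to 0$, let $k\ge 2$, and let $\Gamma$ be a connected graph with $k$ vertices which is feasible for every $n\geq 1$. Let $G'_n(\Gamma)$ be the number of induced subgraphs isomorphic to $\Gamma$ in the Poissonized disk graph $G'(Y;t_n)$ (see context), let $$\tilde G'_n(\Gamma)=\frac{G'_n(\Gamma)-E[G'_n(\Gamma)]}{\mathrm{Var}(G'_n(\Gamma))^{1/2}},$$ and let $N\sim\mathscr N(0,1)$. Then there exists a constant $C>0$, independent of $n$, such that for every $n\ge 1$: (i) if $n t_n^d\to 0$ and $n^k (t_n^d)^{k-1}\to\infty$ as $n\to\infty$, then $d_W(\tilde G'_n(\Gamma),N)\le C\,(n^k(t_n^d)^{k-1})^{-1/2}$; (ii) if $n t_n^d\to\infty$, or if $n t_n^d\to c$ for some constant $c\in(0,\infty)$, then $d_W(\tilde G'_n(\Gamma),N)\le C\,n^{-1/2}$. In particular, in each of these three regimes $\tilde G'_n(\Gamma)$ converges in distribution to $N$ as $n\to\infty$.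
   Context: $Y=\{Y_i: i\ge1\}$ is a sequence of i.i.d. $\mathbb{R}^d$-valued random variables with density $f$, and for each $n\ge 1$, $N(n)$ is a Poisson random variable with mean $n$ independent of $Y$. The disk graph $G'(Y;t_n)$ has vertex set $\{Y_1,\dots,Y_{N(n)}\}$ and an edge between $Y_i$ and $Y_j$ if and only if $\|Y_i-Y_j\|_{\mathbb{R}^d}\in(0,t_n)$; it is empty if $N(n)=0$. $G'_n(\Gamma)$ is the number of subsets $\{i_1,\dots,i_k\}\subset\{1,\dots,N(n)\}$ of size $k$ such that the restriction (induced subgraph) of $G'(Y;t_n)$ to $\{Y_{i_1},\dots,Y_{i_k}\}$ is isomorphic to $\Gamma$. "$\Gamma$ is feasible for every $n$" means that, for every $n$, the probability that the disk graph with connection radius $t_n$ on the points $\{Y_1,\dots,Y_k\}$ is isomorphic to $\Gamma$ is strictly positive. The Wasserstein distance is $d_W(F,N)=\sup_{h}|E[h(F)]-E[h(N)]|$, the supremum being over all functions $h:\mathbb{R}\to\mathbb{R}$ with Lipschitz constant at most $1$. *)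

theory Defs
  imports "HOL-Probability.Probability" "Graph_Theory.Graph_Theory"
begin

text \<open>
  A graph is a \<^locale>\<open>pair_graph\<close>: finite, loop-free, with each undirected edge represented by
  both of its orientations. The condition \<open>0 < norm (x - y)\<close> is thus the absence of loops.
\<close>

definition disk_graph :: "real \<Rightarrow> 'b::real_normed_vector set \<Rightarrow> 'b pair_pre_digraph" where
  "disk_graph r V = \<lparr>pverts = V, parcs = {(x, y) \<in> V \<times> V. norm (x - y) \<in> {0<..<r}}\<rparr>"

text \<open>
  The points are indexed from 1. If two points of \<open>y\<close> with indices in \<open>I\<close> coincide, the restriction
  to \<open>y ` I\<close> has fewer vertices than \<open>\<Gamma>\<close>, so that \<open>I\<close> is not counted.
\<close>

definition induced_count ::
    "real \<Rightarrow> 'v pair_pre_digraph \<Rightarrow> (nat \<Rightarrow> 'b::real_normed_vector) \<Rightarrow> nat \<Rightarrow> nat" where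
  "induced_count r \<Gamma> y m =
     card {I. I \<subseteq> {1..m} \<and> card I = card (pverts \<Gamma>) \<and>
              digraph_iso (with_proj (disk_graph r (y ` {1..m})) \<restriction> (y ` I)) (with_proj \<Gamma>)}"

definition poissonized_count ::
    "(nat \<Rightarrow> real) \<Rightarrow> (nat \<Rightarrow> 'a \<Rightarrow> 'b::real_normed_vector) \<Rightarrow> (nat \<Rightarrow> 'a \<Rightarrow> nat) \<Rightarrow>
     'v pair_pre_digraph \<Rightarrow> nat \<Rightarrow> 'a \<Rightarrow> real" where
  "poissonized_count t Y N \<Gamma> n \<omega> = real (induced_count (t n) \<Gamma> (\<lambda>i. Y i \<omega>) (N n \<omega>))"

definition feasible ::
    "'a measure \<Rightarrow> (nat \<Rightarrow> 'a \<Rightarrow> 'b::real_normed_vector) \<Rightarrow> real \<Rightarrow> 'v pair_pre_digraph \<Rightarrow> bool" where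
  "feasible M Y r \<Gamma> \<longleftrightarrow>
     measure M {\<omega> \<in> space M.
       digraph_iso (with_proj (disk_graph r ((\<lambda>i. Y i \<omega>) ` {1..card (pverts \<Gamma>)}))) (with_proj \<Gamma>)} > 0"

definition standardized :: "'a measure \<Rightarrow> ('a \<Rightarrow> real) \<Rightarrow> 'a \<Rightarrow> real" where
  "standardized M X \<omega> =
     (X \<omega> - (\<integral>\<omega>'. X \<omega>' \<partial>M)) / sqrt (\<integral>\<omega>'. (X \<omega>' - (\<integral>\<omega>''. X \<omega>'' \<partial>M))\<^sup>2 \<partial>M)"

text \<open>
  The distance of two laws; \<open>d\<^sub>W(F, N)\<close> for random variables is the distance of their laws.
  Meaningful for laws with finite first moment, for which every Lipschitz function is integrable.
\<close>

definition wasserstein_distance :: "real measure \<Rightarrow> real measure \<Rightarrow> ereal" where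
  "wasserstein_distance \<mu> \<nu> =
     (SUP h \<in> {h :: real \<Rightarrow> real. 1-lipschitz_on UNIV h}.
        ereal \<bar>(\<integral>x. h x \<partial>\<mu>) - (\<integral>x. h x \<partial>\<nu>)\<bar>)"

text \<open>
  The sequence \<open>Y\<close> is a random variable in the product space over the indices \<open>i \<ge> 1\<close>; as it and \<open>K\<close>
  have different types, independence is that of the generated sigma-algebras.
\<close>

definition indep_of_sequence ::
    "'a measure \<Rightarrow> ('a \<Rightarrow> nat) \<Rightarrow> (nat \<Rightarrow> 'a \<Rightarrow> 'b::topological_space) \<Rightarrow> bool" where
  "indep_of_sequence M K Y \<longleftrightarrow>
     prob_space.indep_set M
       (sets (vimage_algebra (space M) K (count_space UNIV)))
       (sets (vimage_algebra (space M) (\<lambda>\<omega>. \<lambda>i\<in>{1..}. Y i \<omega>) (PiM {1..} (\<lambda>_. borel))))"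

end

theory Submission
  imports Defs "HOL-Real_Asymp.Real_Asymp"
begin

text \<open>
  Let \<open>F\<close> count the \<open>k\<close>-subsets of a Poisson process \<open>\<eta>\<close> of mean \<open>\<nu> * D\<close> that satisfy \<open>\<kappa>\<close>. For a functional \<open>G\<close>
  and \<open>k\<close> independent further points \<open>X\<close>, Mecke's formula gives
  \<open>Cov F G = \<nu>\<^sup>k / k! * E [\<kappa> X * (G (\<eta> \<union> X) - G \<eta>)]\<close>. With \<open>G = g \<circ> F\<close>, where \<open>g\<close> solves the Stein
  equation, a Taylor expansion bounds the Wasserstein distance by two error terms. The first is the
  variance of the conditional mean of \<open>\<kappa> X * (F (\<eta> \<union> X) - F \<eta>)\<close> given \<open>\<eta>\<close>, which is the covariance
  of this variable and its analogue for an independent copy \<open>X'\<close> of \<open>X\<close>; the second is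
  \<open>E [\<kappa> X * (F (\<eta> \<union> X) - F \<eta>)\<^sup>2]\<close>. As \<open>\<Gamma>\<close> is connected, only points at distance at most a multiple of \<open>t\<close>
  interact, so that after expanding the differences both terms are bounded by powers of \<open>\<nu> * t\<^sup>d\<close>. The
  variance of \<open>F\<close> is at least the mean of \<open>F\<close> and, by the Cauchy-Schwarz inequality, at least a multiple
  of \<open>(E F)\<^sup>2 / \<nu>\<close>. The probability that \<open>k\<close> points form \<open>\<Gamma>\<close> is at
  least a multiple of \<open>t\<close> to the power \<open>d * (k - 1)\<close>, by scaling around a continuity point of the density.
\<close>

section \<open>Stein's method for the Wasserstein distance\<close>

text \<open>Write \<open>l\<close> for \<open>\<nu> * \<beta>\<close>, where \<open>\<beta>\<close>,
  a multiple of \<open>t ^ d\<close>, bounds the mass of a ball. The two errors are at most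
  multiples of \<open>sqrt (\<nu> * (l ^ (2 * k) + l ^ (4 * k - 4))) / v\<close> and
  \<open>\<nu> * (l ^ (k - 1) + l ^ (3 * k - 3)) / (v * sqrt v)\<close>, while the variance
  \<open>v\<close> is at least a multiple of both \<open>\<nu> * l ^ (k - 1)\<close> and
  \<open>\<nu> * l ^ (2 * k - 2)\<close>. The first lower bound gives the rate for bounded
  \<open>l\<close>, the second the rate for \<open>l\<close> bounded away from 0. The expansion is
  made around the value without \<open>X\<close>, so that the first-order coefficient depends on
  \<open>\<eta>\<close> alone; this is what brings in a conditional mean. One constant must serve
  all \<open>n \<ge> 1\<close>, so the bounds hold for each fixed \<open>n\<close>; feasibility
  covers the finitely many \<open>n\<close> to which the scaling argument does not apply. No point
  process is formed: functionals take a finite index set and a sequence of points, adding points is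
  a union of index sets, independence is disjointness of index sets, and Mecke's formula follows
  from exchangeability and a shift of Poisson weights.\<close>

lemma exp_neg_half_square_tendsto_0:
  "((\<lambda>x. exp (- x\<^sup>2 / 2)) \<longlongrightarrow> (0::real)) at_top"
  "((\<lambda>x. x * exp (- x\<^sup>2 / 2)) \<longlongrightarrow> (0::real)) at_top"
  by real_asymp+

text \<open>The function \<open>(a + b / x) * exp (- x\<^sup>2 / 2)\<close> has the derivative
  \<open>- (a * x + b + b / x\<^sup>2) * exp (- x\<^sup>2 / 2)\<close>, which lies below that of
  \<open>u\<close>. Hence \<open>u\<close> minus this function is nondecreasing on the positive
  axis, and as it tends to 0 it is nonpositive.\<close>

lemma stein_decay_upper:
  fixes u r :: "real \<Rightarrow> real"
  assumes deriv: "\<And>x. (u has_real_derivative r x * exp (- x\<^sup>2 / 2)) (at x)"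
    and lim: "(u \<longlongrightarrow> 0) at_top"
    and r: "\<And>x. x > 0 \<Longrightarrow> - (a * x + b) \<le> r x" and "b \<ge> 0" and x: "x > 0"
  shows "u x \<le> (a + b / x) * exp (- x\<^sup>2 / 2)"
proof -
  define s where "s y = u y - (a + b / y) * exp (- y\<^sup>2 / 2)" for y
  have ds: "(s has_real_derivative (r y + a * y + b + b / y\<^sup>2) * exp (- y\<^sup>2 / 2)) (at y)" if "y > 0" for y
  proof -
    have "((\<lambda>y. (a + b / y) * exp (- y\<^sup>2 / 2)) has_real_derivative
        - (b / (y * y)) * exp (- y\<^sup>2 / 2) + (a + b / y) * (exp (- y\<^sup>2 / 2) * - y)) (at y)"
      using that by (auto intro!: derivative_eq_intros)
    from DERIV_diff[OF deriv this] show ?thesis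
      unfolding s_def[abs_def] using that by (simp add: algebra_simps power2_eq_square)
  qed
  have mono: "s x \<le> s y" if "x \<le> y" for y
  proof (rule DERIV_nonneg_imp_nondecreasing[OF that])
    fix z assume "x \<le> z" "z \<le> y"
    then have "z > 0" using x by simp
    then have "0 \<le> (r z + a * z + b + b / z\<^sup>2) * exp (- z\<^sup>2 / 2)"
      using r[of z] \<open>b \<ge> 0\<close> by (intro mult_nonneg_nonneg) (auto intro!: add_nonneg_nonneg)
    then show "\<exists>d. (s has_real_derivative d) (at z) \<and> 0 \<le> d" using ds[OF \<open>z > 0\<close>] by blast
  qed
  have "((\<lambda>y. (a + b / y) * exp (- y\<^sup>2 / 2)) \<longlongrightarrow> (a + 0) * 0) at_top"
    by (intro tendsto_intros exp_neg_half_square_tendsto_0 tendsto_divide_0[OF tendsto_const]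
        filterlim_at_top_imp_at_infinity filterlim_ident)
  from tendsto_diff[OF lim this] have "(s \<longlongrightarrow> 0) at_top"
    by (simp add: s_def[abs_def])
  moreover have "eventually (\<lambda>y. s x \<le> s y) at_top"
    using eventually_ge_at_top[of x] by eventually_elim (rule mono)
  ultimately have "s x \<le> 0"
    by (metis tendsto_lowerbound trivial_limit_at_top_linorder)
  then show ?thesis by (simp add: s_def)
qed

text \<open>Negating \<open>u\<close> makes the one-sided bound two-sided, and reflecting the
  argument carries it to the negative axis.\<close>

lemma stein_decay:
  fixes u r :: "real \<Rightarrow> real"
  assumes deriv: "\<And>x. (u has_real_derivative r x * exp (- x\<^sup>2 / 2)) (at x)"
    and top: "(u \<longlongrightarrow> 0) at_top" and bot: "(u \<longlongrightarrow> 0) at_bot"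
    and r: "\<And>x. \<bar>r x\<bar> \<le> a * \<bar>x\<bar> + b" and "b \<ge> 0" and x: "x \<noteq> 0"
  shows "\<bar>u x\<bar> \<le> (a + b / \<bar>x\<bar>) * exp (- x\<^sup>2 / 2)"
proof -
  have pos: "\<bar>v y\<bar> \<le> (a + b / y) * exp (- y\<^sup>2 / 2)"
    if "\<And>x. (v has_real_derivative q x * exp (- x\<^sup>2 / 2)) (at x)" "(v \<longlongrightarrow> 0) at_top"
      "\<And>x. \<bar>q x\<bar> \<le> a * \<bar>x\<bar> + b" "y > 0" for v q y
  proof -
    have "v y \<le> (a + b / y) * exp (- y\<^sup>2 / 2)"
    proof (rule stein_decay_upper[OF that(1,2) _ \<open>b \<ge> 0\<close> that(4)])
      fix x :: real assume "x > 0"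
      then show "- (a * x + b) \<le> q x" using that(3)[of x] by simp
    qed
    moreover have "- v y \<le> (a + b / y) * exp (- y\<^sup>2 / 2)"
    proof (rule stein_decay_upper[OF _ _ _ \<open>b \<ge> 0\<close> that(4)])
      fix x :: real
      show "((\<lambda>x. - v x) has_real_derivative (- q x) * exp (- x\<^sup>2 / 2)) (at x)"
        using DERIV_minus[OF that(1)[of x]] by simp
      show "((\<lambda>x. - v x) \<longlongrightarrow> 0) at_top" using tendsto_minus[OF that(2)] by simp
      assume "x > 0"
      then show "- (a * x + b) \<le> - q x" using that(3)[of x] by simp
    qed
    ultimately show ?thesis by simp
  qed
  show ?thesis
  proof (cases "x > 0")
    case True
    then show ?thesis using pos[OF deriv top r] by simp
  next
    case False
    have d: "((\<lambda>x. u (- x)) has_real_derivative (- r (- x)) * exp (- x\<^sup>2 / 2)) (at x)" for x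
    proof -
      have "((\<lambda>x. u (- x)) has_real_derivative r (- x) * exp (- (- x)\<^sup>2 / 2) * (-1)) (at x)"
        by (rule DERIV_chain2[OF deriv]) (auto intro!: derivative_eq_intros)
      then show ?thesis by simp
    qed
    have "((\<lambda>x. u (- x)) \<longlongrightarrow> 0) at_top"
      using bot by (simp add: filterlim_at_bot_mirror)
    moreover have "\<bar>- r (- x)\<bar> \<le> a * \<bar>x\<bar> + b" for x using r[of "-x"] by simp
    ultimately have "\<bar>u (- (- x))\<bar> \<le> (a + b / - x) * exp (- (- x)\<^sup>2 / 2)"
      using False x by (intro pos[OF d]) auto
    then show ?thesis using False by simp
  qed
qed

text \<open>Away from 0 this is the decay of \<open>p x * exp (- x\<^sup>2 / 2)\<close> divided by
  the Gaussian factor. The bound \<open>a + b / \<bar>x\<bar>\<close> explodes at 0, so for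
  \<open>\<bar>x\<bar> < 1\<close> the mean value inequality starting at 1 is used instead: it gives
  \<open>\<bar>u x\<bar> \<le> 3 * (a + b)\<close>, and \<open>exp (1 / 2) \<le> 2\<close> doubles
  the 3 to 6.\<close>

lemma stein_bound:
  fixes p r :: "real \<Rightarrow> real"
  assumes deriv: "\<And>x. ((\<lambda>x. p x * exp (- x\<^sup>2 / 2)) has_real_derivative r x * exp (- x\<^sup>2 / 2)) (at x)"
    and top: "((\<lambda>x. p x * exp (- x\<^sup>2 / 2)) \<longlongrightarrow> 0) at_top"
    and bot: "((\<lambda>x. p x * exp (- x\<^sup>2 / 2)) \<longlongrightarrow> 0) at_bot"
    and r: "\<And>x. \<bar>r x\<bar> \<le> a * \<bar>x\<bar> + b" and ab: "a \<ge> 0" "b \<ge> 0"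
  shows "\<bar>p x\<bar> \<le> 6 * (a + b)" and "a = 0 \<Longrightarrow> \<bar>x * p x\<bar> \<le> b"
proof -
  have decay: "\<bar>p x\<bar> \<le> a + b / \<bar>x\<bar>" if "x \<noteq> 0" for x
    using stein_decay[OF deriv top bot r ab(2) that] by (simp add: abs_mult)
  show "\<bar>x * p x\<bar> \<le> b" if "a = 0"
  proof (cases "x = 0")
    case False
    then show ?thesis using decay[OF False] that by (simp add: abs_mult field_simps)
  qed (use ab in simp)
  show "\<bar>p x\<bar> \<le> 6 * (a + b)"
  proof (cases "\<bar>x\<bar> \<ge> 1")
    case True
    then have "b / \<bar>x\<bar> \<le> b / 1" using ab by (intro divide_left_mono) auto
    then show ?thesis using decay[of x] True ab by (cases "x = 0") auto
  next
    case False
    define u where "u x = p x * exp (- x\<^sup>2 / 2)" for x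
    have "\<bar>u 1 - u x\<bar> \<le> (a + b) * \<bar>1 - x\<bar>"
    proof -
      have "norm (u 1 - u x) \<le> (a + b) * norm (1 - x)"
      proof (rule field_differentiable_bound[where S="{-1..1}" and f'="\<lambda>x. r x * exp (- x\<^sup>2 / 2)"])
        fix z :: real assume z: "z \<in> {-1..1}"
        show "(u has_field_derivative r z * exp (- z\<^sup>2 / 2)) (at z within {- 1..1})"
          unfolding u_def using deriv by (rule has_field_derivative_at_within)
        have "\<bar>r z\<bar> \<le> a + b" using r[of z] z ab mult_left_le[of "\<bar>z\<bar>" a] by (auto simp: abs_le_iff)
        moreover have "exp (- z\<^sup>2 / 2) \<le> 1" by simp
        ultimately have "\<bar>r z\<bar> * exp (- z\<^sup>2 / 2) \<le> (a + b) * 1" by (intro mult_mono) auto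
        then show "norm (r z * exp (- z\<^sup>2 / 2)) \<le> a + b" by (simp add: abs_mult)
      qed (use False in auto)
      then show ?thesis by simp
    qed
    moreover have "\<bar>1 - x\<bar> \<le> 2" using False by simp
    then have "(a + b) * \<bar>1 - x\<bar> \<le> (a + b) * 2" using ab by (intro mult_left_mono) auto
    moreover have "\<bar>u 1\<bar> \<le> a + b"
    proof -
      have "\<bar>p 1\<bar> * exp (- 1 / 2) \<le> (a + b) * 1" using decay[of 1] by (intro mult_mono) auto
      then show ?thesis by (simp add: u_def abs_mult)
    qed
    ultimately have u: "\<bar>u x\<bar> \<le> 3 * (a + b)" by simp
    have "exp (x\<^sup>2 / 2) \<le> exp (1 / 2)"
      using False abs_square_le_1[of x] by simp
    also have "exp (1 / 2 :: real) \<le> 2"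
      using exp_bound_half[of "1/2::real"] by simp
    finally have "\<bar>u x\<bar> * exp (x\<^sup>2 / 2) \<le> 3 * (a + b) * 2"
      using u ab by (intro mult_mono) auto
    moreover have "\<bar>u x\<bar> * exp (x\<^sup>2 / 2) = \<bar>p x\<bar>"
      by (simp add: u_def abs_mult exp_minus field_simps)
    ultimately show ?thesis by simp
  qed
qed

text \<open>On bounded intervals the indefinite integral has the same increments as an
  antiderivative of \<open>w\<close>, so the two differ by a constant.\<close>

lemma has_real_derivative_integral_atMost:
  fixes w :: "real \<Rightarrow> real"
  assumes cont: "\<And>x. isCont w x" and int: "integrable lborel w"
  shows "((\<lambda>x. \<integral>y. indicator {..x} y *\<^sub>R w y \<partial>lborel) has_real_derivative w x) (at x)"
proof -
  obtain F where "\<And>x. (F has_vector_derivative w x) (at x)"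
    using einterval_antiderivative[of "-\<infinity>" "\<infinity>" w] cont by auto
  then have F: "(F has_real_derivative w x) (at x)" for x
    by (simp add: has_real_derivative_iff_has_vector_derivative)
  define G where "G x = (\<integral>y. indicator {..x} y *\<^sub>R w y \<partial>lborel)" for x
  have ind: "integrable lborel (\<lambda>y. indicator S y *\<^sub>R w y)" if "S \<in> sets borel" for S
    using integrable_mult_indicator[of S lborel w] int that by simp
  have step: "G b - G a = F b - F a" if "a \<le> b" for a b
  proof -
    have "G b = (\<integral>y. indicator {..a} y *\<^sub>R w y + indicator {a<..b} y *\<^sub>R w y \<partial>lborel)"
      unfolding G_def using that by (intro Bochner_Integration.integral_cong) (auto simp: indicator_def)
    also have "\<dots> = G a + (\<integral>y. indicator {a<..b} y *\<^sub>R w y \<partial>lborel)"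
      unfolding G_def by (intro Bochner_Integration.integral_add ind) auto
    also have "(\<integral>y. indicator {a<..b} y *\<^sub>R w y \<partial>lborel) = (\<integral>y. indicator {a..b} y *\<^sub>R w y \<partial>lborel)"
    proof (rule integral_cong_AE)
      show "AE y in lborel. indicator {a<..b} y *\<^sub>R w y = indicator {a..b} y *\<^sub>R w y"
        using AE_lborel_singleton[of a] by eventually_elim (auto simp: indicator_def)
    qed (use ind int in auto)
    also have "\<dots> = F b - F a"
    proof (rule integral_FTC_Icc[OF that])
      show "(F has_vector_derivative w x) (at x within {a..b})" for x
        using F[of x] by (simp add: has_real_derivative_iff_has_vector_derivative has_vector_derivative_at_within)
      show "continuous_on {a..b} w"
        using cont by (simp add: continuous_at_imp_continuous_on)
    qed
    finally show ?thesis by simp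
  qed
  have "G y = F y + (G 0 - F 0)" for y
    using step[of 0 y] step[of y 0] by (cases "0 \<le> y") auto
  then have "G = (\<lambda>y. F y + (G 0 - F 0))" by (rule ext)
  moreover have "((\<lambda>y. F y + (G 0 - F 0)) has_real_derivative w x) (at x)"
    using F[of x] by (auto intro!: derivative_eq_intros)
  ultimately have "(G has_real_derivative w x) (at x)" by metis
  then show ?thesis unfolding G_def .
qed

text \<open>
  The Stein equation is solved twice: the derivative of the solution solves the Stein equation for
  a bounded right-hand side, which bounds the second derivative.
\<close>

lemma stein_solution:
  fixes h h' :: "real \<Rightarrow> real"
  assumes h: "\<And>x. (h has_real_derivative h' x) (at x)" and h': "\<And>x. \<bar>h' x\<bar> \<le> 1"
  defines "m \<equiv> \<integral>x. h x \<partial>std_normal_distribution"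
  obtains g where "\<And>x. (g has_real_derivative x * g x + h x - m) (at x)"
    and "\<And>x. \<bar>x * g x + h x - m\<bar> \<le> 78"
    and "\<And>x y. \<bar>(x * g x + h x - m) - (y * g y + h y - m)\<bar> \<le> 26 * \<bar>x - y\<bar>"
proof -
  define \<phi> where "\<phi> x = exp (- x\<^sup>2 / 2)" for x :: real
  have \<phi>_pos[simp]: "\<phi> x > 0" "\<phi> x \<noteq> 0" for x by (auto simp: \<phi>_def)
  have \<phi>_density: "\<phi> x = sqrt (2 * pi) * std_normal_density x" for x
    by (simp add: std_normal_density_def \<phi>_def)
  have \<phi>_deriv: "(\<phi> has_real_derivative - x * \<phi> x) (at x)" for x
    unfolding \<phi>_def[abs_def] by (auto intro!: derivative_eq_intros)
  have h_lip: "\<bar>h x - h y\<bar> \<le> \<bar>x - y\<bar>" for x y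
    using field_differentiable_bound[of UNIV h h' 1 x y] h h' by auto
  have h_cont: "isCont h x" for x using h DERIV_isCont by blast
  have [measurable]: "h \<in> borel_measurable borel"
    using h_cont by (intro borel_measurable_continuous_onI continuous_at_imp_continuous_on) auto
  define q where "q x = h x - m" for x
  have int_d: "integrable lborel std_normal_density"
    and int_xd: "integrable lborel (\<lambda>x. std_normal_density x * \<bar>x\<bar>)"
    and int_x2d: "integrable lborel (\<lambda>x. std_normal_density x * x\<^sup>2)"
    using integrable_std_normal_moment[of 0] integrable_std_normal_moment_abs[of 1]
      integrable_std_normal_moment[of 2] by auto
  have d1: "(\<integral>x. std_normal_density x \<partial>lborel) = 1"
    using integral_std_normal_moment_even[of 0] by simp
  have int_hd: "integrable lborel (\<lambda>x. std_normal_density x * h x)"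
  proof (rule Bochner_Integration.integrable_bound)
    show "integrable lborel (\<lambda>x. \<bar>h 0\<bar> * std_normal_density x + std_normal_density x * \<bar>x\<bar>)"
      using int_d int_xd by auto
    show "AE x in lborel. norm (std_normal_density x * h x)
        \<le> norm (\<bar>h 0\<bar> * std_normal_density x + std_normal_density x * \<bar>x\<bar>)"
    proof (rule AE_I2)
      fix x
      have "\<bar>h x\<bar> \<le> \<bar>h 0\<bar> + \<bar>x\<bar>" using h_lip[of x 0] by simp
      then have "std_normal_density x * \<bar>h x\<bar> \<le> std_normal_density x * (\<bar>h 0\<bar> + \<bar>x\<bar>)"
        by (intro mult_left_mono) auto
      then show "norm (std_normal_density x * h x)
        \<le> norm (\<bar>h 0\<bar> * std_normal_density x + std_normal_density x * \<bar>x\<bar>)"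
        by (simp add: abs_mult algebra_simps)
    qed
  qed simp
  have m: "m = (\<integral>x. std_normal_density x * h x \<partial>lborel)"
    unfolding m_def by (subst integral_density) auto
  have int_qd: "integrable lborel (\<lambda>x. std_normal_density x * q x)"
    using int_hd int_d by (simp add: q_def right_diff_distrib)
  have q0: "(\<integral>x. std_normal_density x * q x \<partial>lborel) = 0"
    using int_hd int_d d1 by (simp add: q_def right_diff_distrib m)
  \<comment> \<open>\<open>q x\<close> is the Gaussian average of \<open>h x - h y\<close>, so the
    Lipschitz bound applies; after \<open>\<bar>y\<bar> \<le> 1 / 2 + y\<^sup>2 / 2\<close> only the
    second moment, which is 1, enters.\<close>
  have q_bound: "\<bar>q x\<bar> \<le> 1 * \<bar>x\<bar> + 1" for x
  proof -
    have "q x = (\<integral>y. std_normal_density y * (h x - h y) \<partial>lborel)"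
      using int_hd int_d d1 by (simp add: q_def right_diff_distrib m)
    also have "\<bar>\<dots>\<bar> \<le> (\<integral>y. \<bar>std_normal_density y * (h x - h y)\<bar> \<partial>lborel)"
      by (rule integral_abs_bound)
    also have "\<dots> \<le> (\<integral>y. std_normal_density y * (\<bar>x\<bar> + 1 / 2) + std_normal_density y * y\<^sup>2 / 2 \<partial>lborel)"
    proof (rule integral_mono)
      show "integrable lborel (\<lambda>y. \<bar>std_normal_density y * (h x - h y)\<bar>)"
        using int_hd int_d by (auto simp: right_diff_distrib)
      show "integrable lborel (\<lambda>y. std_normal_density y * (\<bar>x\<bar> + 1 / 2) + std_normal_density y * y\<^sup>2 / 2)"
        using int_d int_x2d by auto
      fix y :: real
      have "\<bar>y\<bar> \<le> 1 / 2 + y\<^sup>2 / 2" using zero_le_power2[of "\<bar>y\<bar> - (1::real)"] by (simp add: power2_diff)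
      then have "\<bar>h x - h y\<bar> \<le> \<bar>x\<bar> + 1 / 2 + y\<^sup>2 / 2" using h_lip[of x y] by simp
      then have "std_normal_density y * \<bar>h x - h y\<bar> \<le> std_normal_density y * (\<bar>x\<bar> + 1 / 2 + y\<^sup>2 / 2)"
        by (intro mult_left_mono) auto
      then show "\<bar>std_normal_density y * (h x - h y)\<bar>
          \<le> std_normal_density y * (\<bar>x\<bar> + 1 / 2) + std_normal_density y * y\<^sup>2 / 2"
        by (simp add: abs_mult distrib_left)
    qed
    also have "\<dots> = \<bar>x\<bar> + 1"
      using int_d int_x2d d1 integral_std_normal_moment_even[of 1] by simp
    finally show ?thesis by simp
  qed
  define w where "w x = q x * \<phi> x" for x
  have w_int: "integrable lborel w"
  proof -
    have "w = (\<lambda>x. sqrt (2 * pi) * (std_normal_density x * q x))"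
      by (auto simp: w_def \<phi>_density)
    then show ?thesis using int_qd by simp
  qed
  have w0: "(\<integral>x. w x \<partial>lborel) = 0"
  proof -
    have "(\<integral>x. w x \<partial>lborel) = sqrt (2 * pi) * (\<integral>x. std_normal_density x * q x \<partial>lborel)"
      unfolding integral_mult_right_zero[symmetric]
      by (intro Bochner_Integration.integral_cong) (auto simp: w_def \<phi>_density)
    then show ?thesis using q0 by simp
  qed
  have w_cont: "isCont w x" for x
  proof (rule DERIV_isCont)
    show "(w has_real_derivative q x * (- x * \<phi> x) + h' x * \<phi> x) (at x)"
      unfolding w_def[abs_def] q_def by (rule derivative_eq_intros h \<phi>_deriv refl)+ simp
  qed
  \<comment> \<open>The Stein equation \<open>g' = x * g + q\<close> reads
    \<open>(g * \<phi>)' = q * \<phi> = w\<close>, so \<open>g\<close> is this integral divided by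
    \<open>\<phi>\<close>. Its limit at infinity is the integral of \<open>w\<close>, which is 0
    because \<open>m\<close> is the Gaussian mean of \<open>h\<close>.\<close>
  define G where "G x = (\<integral>y. indicator {..x} y *\<^sub>R w y \<partial>lborel)" for x
  have G: "(G has_real_derivative w x) (at x)" for x
    unfolding G_def by (rule has_real_derivative_integral_atMost[OF w_cont w_int])
  have G_top: "(G \<longlongrightarrow> 0) at_top"
    unfolding G_def using tendsto_integral_at_top[of lborel w] w_int w0 by simp
  \<comment> \<open>As \<open>w\<close> has integral 0, \<open>G (- x)\<close> is minus the integral
    beyond \<open>- x\<close>; reflected, this is an integral up to \<open>x\<close>, whose limit is
    again a total integral.\<close>
  have G_bot: "(G \<longlongrightarrow> 0) at_bot"
  proof -
    have refl_int: "integrable lborel (\<lambda>x. w (- x))"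
      using lborel_integrable_real_affine[OF w_int, of "-1" 0] by simp
    have refl0: "(\<integral>x. w (- x) \<partial>lborel) = 0"
      using lborel_integral_real_affine[of "-1" w 0] w0 by simp
    have "G (- x) = - (\<integral>y. indicator {..x} y *\<^sub>R w (- y) \<partial>lborel)" for x
    proof -
      have "G (- x) = (\<integral>y. indicator {..- x} (- y) *\<^sub>R w (- y) \<partial>lborel)"
        unfolding G_def using lborel_integral_real_affine[of "-1" "\<lambda>y. indicator {..- x} y *\<^sub>R w y" 0] by simp
      also have "\<dots> = (\<integral>y. w (- y) - indicator {..x} y *\<^sub>R w (- y) \<partial>lborel)"
      proof (rule integral_cong_AE)
        show "AE y in lborel. indicator {..- x} (- y) *\<^sub>R w (- y) = w (- y) - indicator {..x} y *\<^sub>R w (- y)"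
          using AE_lborel_singleton[of x] by eventually_elim (auto simp: indicator_def)
      qed (use refl_int w_int in auto)
      also have "\<dots> = - (\<integral>y. indicator {..x} y *\<^sub>R w (- y) \<partial>lborel)"
        using refl_int refl0 integrable_mult_indicator[of "{..x}" lborel "\<lambda>y. w (- y)"] by simp
      finally show ?thesis .
    qed
    moreover have "((\<lambda>x. - (\<integral>y. indicator {..x} y *\<^sub>R w (- y) \<partial>lborel)) \<longlongrightarrow> - 0) at_top"
      using tendsto_integral_at_top[OF _ refl_int] refl0 by (intro tendsto_minus) simp
    ultimately show ?thesis by (simp add: filterlim_at_bot_mirror)
  qed
  define g where "g x = G x / \<phi> x" for x
  have G_eq: "g x * \<phi> x = G x" for x by (simp add: g_def)
  have g: "(g has_real_derivative x * g x + q x) (at x)" for x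
  proof -
    have "(g has_real_derivative (w x * \<phi> x - G x * (- x * \<phi> x)) / (\<phi> x * \<phi> x)) (at x)"
      unfolding g_def[abs_def] by (rule DERIV_divide[OF G \<phi>_deriv]) simp
    moreover have "(w x * \<phi> x - G x * (- x * \<phi> x)) / (\<phi> x * \<phi> x) = x * g x + q x"
      by (simp add: g_def w_def add_divide_distrib diff_divide_distrib)
    ultimately show ?thesis by simp
  qed
  have g_bound: "\<bar>g x\<bar> \<le> 6 * (1 + 1)" for x
  proof (rule stein_bound(1)[where r=q and p=g])
    show "((\<lambda>x. g x * exp (- x\<^sup>2 / 2)) has_real_derivative q x * exp (- x\<^sup>2 / 2)) (at x)" for x
      using G G_eq unfolding w_def \<phi>_def by simp
    show "((\<lambda>x. g x * exp (- x\<^sup>2 / 2)) \<longlongrightarrow> 0) at_top" "((\<lambda>x. g x * exp (- x\<^sup>2 / 2)) \<longlongrightarrow> 0) at_bot"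
      using G_top G_bot G_eq unfolding \<phi>_def by simp_all
  qed (use q_bound in auto)
  \<comment> \<open>\<open>p = g'\<close> satisfies \<open>p' = x * p + (g + h')\<close>, a Stein
    equation whose right-hand side is at most 12 + 1 = 13. With \<open>a = 0\<close> and
    \<open>b = 13\<close> in \<open>stein_bound\<close>, \<open>p\<close> is at most 6 * 13 = 78 and
    \<open>x * p\<close> at most 13, so that \<open>p'\<close> is at most 26.\<close>
  define p where "p x = x * g x + q x" for x
  have p_deriv: "(p has_real_derivative x * p x + (g x + h' x)) (at x)" for x
    unfolding p_def[abs_def] q_def
    by (rule derivative_eq_intros g h refl)+ (simp add: p_def q_def algebra_simps)
  have p_growth: "\<bar>p x\<bar> \<le> 13 * \<bar>x\<bar> + 1" for x
  proof -
    have "\<bar>p x\<bar> \<le> \<bar>x\<bar> * \<bar>g x\<bar> + \<bar>q x\<bar>" unfolding p_def by (metis abs_mult abs_triangle_ineq)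
    also have "\<bar>x\<bar> * \<bar>g x\<bar> \<le> \<bar>x\<bar> * 12" using g_bound[of x] by (intro mult_left_mono) auto
    finally show ?thesis using q_bound[of x] by simp
  qed
  have r_bound: "\<bar>g x + h' x\<bar> \<le> 0 * \<bar>x\<bar> + 13" for x
    using g_bound[of x] h'[of x] by simp
  have d: "((\<lambda>x. p x * exp (- x\<^sup>2 / 2)) has_real_derivative (g x + h' x) * exp (- x\<^sup>2 / 2)) (at x)" for x
    using DERIV_mult[OF p_deriv[of x] \<phi>_deriv[of x]] by (simp add: \<phi>_def algebra_simps)
  have lim0: "((\<lambda>x. (13 * \<bar>x\<bar> + 1) * exp (- x\<^sup>2 / 2)) \<longlongrightarrow> (0::real)) at_top"
    by real_asymp
  have lim0': "((\<lambda>x. (13 * \<bar>x\<bar> + 1) * exp (- x\<^sup>2 / 2)) \<longlongrightarrow> (0::real)) at_bot"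
    by real_asymp
  have p_le: "norm (p x * exp (- x\<^sup>2 / 2)) \<le> (13 * \<bar>x\<bar> + 1) * exp (- x\<^sup>2 / 2)" for x
    using p_growth[of x] by (simp add: abs_mult)
  have t: "((\<lambda>x. p x * exp (- x\<^sup>2 / 2)) \<longlongrightarrow> 0) at_top"
    by (rule Lim_null_comparison[OF always_eventually lim0]) (use p_le in simp)
  have b: "((\<lambda>x. p x * exp (- x\<^sup>2 / 2)) \<longlongrightarrow> 0) at_bot"
    by (rule Lim_null_comparison[OF always_eventually lim0']) (use p_le in simp)
  have p_bound: "\<bar>p x\<bar> \<le> 78" and xp_bound: "\<bar>x * p x\<bar> \<le> 13" for x
    using stein_bound[OF d t b r_bound] by auto
  have "\<bar>p x - p y\<bar> \<le> 26 * \<bar>x - y\<bar>" for x y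
  proof -
    have "norm (x * p x + (g x + h' x)) \<le> 26" for x
      using xp_bound[of x] r_bound[of x] by simp
    then show ?thesis
      using field_differentiable_bound[of UNIV p "\<lambda>x. x * p x + (g x + h' x)" 26 x y] p_deriv by simp
  qed
  then show thesis
    using that[of g] g p_bound by (simp add: p_def q_def add_diff_eq)
qed

text \<open>The Stein solution needs a differentiable test function, but \<open>h\<close> is merely
  Lipschitz. Its average \<open>k\<close> over the interval from \<open>x\<close> to
  \<open>x + \<epsilon>\<close> has a derivative of size at most 1 and differs from \<open>h\<close>
  by at most \<open>\<epsilon>\<close>; replacing \<open>h\<close> by \<open>k\<close> under both
  laws costs \<open>2 * \<epsilon> = e\<close>. The numbers 78 and 26 are those of
  \<open>stein_solution\<close>.\<close>

lemma wasserstein_distance_le_stein: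
  assumes mu: "real_distribution \<mu>" and int: "integrable \<mu> (\<lambda>x. x)"
    and B: "\<And>g g'. (\<And>x. (g has_real_derivative g' x) (at x)) \<Longrightarrow> (\<And>x. \<bar>g' x\<bar> \<le> 78) \<Longrightarrow>
        (\<And>x y. \<bar>g' x - g' y\<bar> \<le> 26 * \<bar>x - y\<bar>) \<Longrightarrow> \<bar>\<integral>x. g' x - x * g x \<partial>\<mu>\<bar> \<le> B"
  shows "wasserstein_distance \<mu> std_normal_distribution \<le> ereal B"
  unfolding wasserstein_distance_def
proof (rule SUP_least, clarsimp)
  interpret \<mu>: real_distribution \<mu> by fact
  let ?\<nu> = std_normal_distribution
  interpret \<nu>: real_distribution ?\<nu> by (rule real_dist_normal_dist)
  have int_\<nu>: "integrable ?\<nu> (\<lambda>x. x)"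
    using integrable_std_normal_distribution_moment[of 1] by simp
  have int_lip: "integrable \<rho> h" if \<rho>: "real_distribution \<rho>" "integrable \<rho> (\<lambda>x. x)"
    and h: "\<And>x y. \<bar>h x - h y\<bar> \<le> \<bar>x - y\<bar>" "h \<in> borel_measurable borel" for \<rho> and h :: "real \<Rightarrow> real"
  proof -
    interpret \<rho>: real_distribution \<rho> by fact
    show ?thesis
    proof (rule Bochner_Integration.integrable_bound)
      show "integrable \<rho> (\<lambda>x. \<bar>h 0\<bar> + \<bar>x\<bar>)" using \<rho>(2) by auto
      show "h \<in> borel_measurable \<rho>" using h(2) by simp
      show "AE x in \<rho>. norm (h x) \<le> norm (\<bar>h 0\<bar> + \<bar>x\<bar>)"
      proof (rule AE_I2)
        fix x show "norm (h x) \<le> norm (\<bar>h 0\<bar> + \<bar>x\<bar>)" using h(1)[of x 0] by simp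
      qed
    qed
  qed
  fix h :: "real \<Rightarrow> real" assume h: "1-lipschitz_on UNIV h"
  have lip: "\<bar>h x - h y\<bar> \<le> \<bar>x - y\<bar>" for x y
    using lipschitz_onD[OF h, of x y] by (simp add: dist_real_def)
  have cont: "continuous_on UNIV h" using h by (rule lipschitz_on_continuous_on)
  have [measurable]: "h \<in> borel_measurable borel"
    using cont by (rule borel_measurable_continuous_onI)
  have int_h: "integrable \<mu> h" "integrable ?\<nu> h"
    by (rule int_lip[OF mu int], rule lip, measurable)
      (rule int_lip[OF real_dist_normal_dist int_\<nu>], rule lip, measurable)
  have "isCont h x" for x
    using cont by (simp add: continuous_on_eq_continuous_at)
  then obtain H where "\<And>x. (H has_vector_derivative h x) (at x)"
    using einterval_antiderivative[of "-\<infinity>" "\<infinity>" h] by auto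
  then have H: "(H has_real_derivative h x) (at x)" for x
    by (simp add: has_real_derivative_iff_has_vector_derivative)
  have "\<bar>(\<integral>x. h x \<partial>\<mu>) - (\<integral>x. h x \<partial>?\<nu>)\<bar> \<le> B + e" if "e > 0" for e
  proof -
    define \<epsilon> where "\<epsilon> = e / 2"
    have \<epsilon>: "\<epsilon> > 0" using that by (simp add: \<epsilon>_def)
    define k where "k x = (H (x + \<epsilon>) - H x) / \<epsilon>" for x
    have k: "(k has_real_derivative (h (x + \<epsilon>) - h x) / \<epsilon>) (at x)" for x
    proof -
      have "((\<lambda>x. H (x + \<epsilon>)) has_real_derivative h (x + \<epsilon>)) (at x)"
        using H[of "x + \<epsilon>"] by (simp only: DERIV_shift)
      from DERIV_cdivide[OF DERIV_diff[OF this H[of x]], of \<epsilon>]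
      show ?thesis by (simp add: k_def[abs_def])
    qed
    have k': "\<bar>(h (x + \<epsilon>) - h x) / \<epsilon>\<bar> \<le> 1" for x
      using lip[of "x + \<epsilon>" x] \<epsilon> by (simp add: divide_le_eq)
    have k_lip: "\<bar>k x - k y\<bar> \<le> \<bar>x - y\<bar>" for x y
      using field_differentiable_bound[of UNIV k "\<lambda>x. (h (x + \<epsilon>) - h x) / \<epsilon>" 1 x y] k k' by auto
    have [measurable]: "k \<in> borel_measurable borel"
      using k by (intro borel_measurable_continuous_onI continuous_at_imp_continuous_on)
        (auto intro: DERIV_isCont)
    have int_k: "integrable \<mu> k" "integrable ?\<nu> k"
      by (rule int_lip[OF mu int], rule k_lip, measurable)
      (rule int_lip[OF real_dist_normal_dist int_\<nu>], rule k_lip, measurable)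
    have kh: "\<bar>h x - k x\<bar> \<le> \<epsilon>" for x
    proof -
      obtain z where z: "x < z" "z < x + \<epsilon>" "H (x + \<epsilon>) - H x = (x + \<epsilon> - x) * h z"
        using MVT2[of x "x + \<epsilon>" H h] H \<epsilon> by auto
      then have "k x = h z" using \<epsilon> by (simp add: k_def)
      then show ?thesis using lip[of x z] z by simp
    qed
    have diff: "\<bar>(\<integral>x. h x \<partial>\<rho>) - (\<integral>x. k x \<partial>\<rho>)\<bar> \<le> \<epsilon>"
      if "real_distribution \<rho>" "integrable \<rho> h" "integrable \<rho> k" for \<rho>
    proof -
      interpret \<rho>: real_distribution \<rho> by fact
      have "\<bar>(\<integral>x. h x \<partial>\<rho>) - (\<integral>x. k x \<partial>\<rho>)\<bar> = \<bar>\<integral>x. h x - k x \<partial>\<rho>\<bar>" using that by simp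
      also have "\<dots> \<le> (\<integral>x. \<bar>h x - k x\<bar> \<partial>\<rho>)" by (rule integral_abs_bound)
      also have "\<dots> \<le> (\<integral>x. \<epsilon> \<partial>\<rho>)" using that kh by (intro integral_mono) auto
      finally show ?thesis using \<rho>.prob_space by simp
    qed
    define m where "m = (\<integral>x. k x \<partial>?\<nu>)"
    obtain g where g: "\<And>x. (g has_real_derivative x * g x + k x - m) (at x)"
      "\<And>x. \<bar>x * g x + k x - m\<bar> \<le> 78"
      "\<And>x y. \<bar>(x * g x + k x - m) - (y * g y + k y - m)\<bar> \<le> 26 * \<bar>x - y\<bar>"
      using stein_solution[OF k k'] unfolding m_def by metis
    have "\<bar>\<integral>x. (x * g x + k x - m) - x * g x \<partial>\<mu>\<bar> \<le> B"
      by (rule B[OF g])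
    moreover have "(\<integral>x. (x * g x + k x - m) - x * g x \<partial>\<mu>) = (\<integral>x. k x \<partial>\<mu>) - m"
      using int_k \<mu>.prob_space by simp
    ultimately have "\<bar>(\<integral>x. k x \<partial>\<mu>) - (\<integral>x. k x \<partial>?\<nu>)\<bar> \<le> B" by (simp add: m_def)
    moreover have "\<epsilon> + \<epsilon> = e" by (simp add: \<epsilon>_def)
    ultimately show ?thesis
      using diff[OF mu int_h(1) int_k(1)] diff[OF real_dist_normal_dist int_h(2) int_k(2)] by linarith
  qed
  then show "\<bar>(\<integral>x. h x \<partial>\<mu>) - (\<integral>x. h x \<partial>?\<nu>)\<bar> \<le> B" by (rule field_le_epsilon)
qed

text \<open>Rescaling by \<open>L + 1\<close> rather than \<open>L\<close> covers the case
  \<open>L = 0\<close>.\<close>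

lemma wasserstein_distance_lipschitz:
  assumes W: "wasserstein_distance \<mu> \<nu> \<le> ereal b"
    and h: "\<And>x y. \<bar>h x - h y\<bar> \<le> L * \<bar>x - y\<bar>" and "L \<ge> 0"
  shows "\<bar>(\<integral>x. h x \<partial>\<mu>) - (\<integral>x. h x \<partial>\<nu>)\<bar> \<le> (L + 1) * b"
proof -
  let ?h = "\<lambda>x. h x / (L + 1)"
  have "1-lipschitz_on UNIV ?h"
  proof (rule lipschitz_onI)
    fix x y
    have "\<bar>h x - h y\<bar> \<le> (L + 1) * \<bar>x - y\<bar>" using h[of x y] by (simp add: distrib_right)
    then show "dist (?h x) (?h y) \<le> 1 * dist x y"
      using \<open>L \<ge> 0\<close> by (simp add: dist_real_def diff_divide_distrib[symmetric] divide_le_eq mult.commute)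
  qed simp
  then have "ereal \<bar>(\<integral>x. ?h x \<partial>\<mu>) - (\<integral>x. ?h x \<partial>\<nu>)\<bar> \<le> wasserstein_distance \<mu> \<nu>"
    unfolding wasserstein_distance_def by (intro SUP_upper) simp
  also note W
  finally show ?thesis
    using \<open>L \<ge> 0\<close> by (simp add: diff_divide_distrib[symmetric] divide_le_eq mult.commute)
qed

text \<open>At each \<open>t\<close>, the real and imaginary parts of the characteristic function
  are expectations of \<open>\<bar>t\<bar>\<close>-Lipschitz functions, so they converge, and Levy's
  continuity theorem applies.\<close>

lemma weak_conv_m_wasserstein:
  assumes \<mu>: "\<And>n. real_distribution (\<mu> n)"
    and W: "\<And>n. wasserstein_distance (\<mu> n) std_normal_distribution \<le> ereal (b n)"
    and b: "b \<longlonglongrightarrow> 0"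
  shows "weak_conv_m \<mu> std_normal_distribution"
proof (rule levy_continuity[OF \<mu> real_dist_normal_dist])
  fix t :: real
  let ?\<nu> = std_normal_distribution
  have conv: "(\<lambda>n. \<integral>x. h x \<partial>\<mu> n) \<longlonglongrightarrow> (\<integral>x. h x \<partial>?\<nu>)"
    if "\<And>x y. \<bar>h x - h y\<bar> \<le> \<bar>t\<bar> * \<bar>x - y\<bar>" for h :: "real \<Rightarrow> real"
  proof (rule Lim_transform[OF tendsto_const])
    have "(\<lambda>n. (\<bar>t\<bar> + 1) * b n) \<longlonglongrightarrow> (\<bar>t\<bar> + 1) * 0" using b by (intro tendsto_intros)
    then have lim: "(\<lambda>n. (\<bar>t\<bar> + 1) * b n) \<longlonglongrightarrow> 0" by simp
    have "\<bar>(\<integral>x. h x \<partial>\<mu> n) - (\<integral>x. h x \<partial>?\<nu>)\<bar> \<le> (\<bar>t\<bar> + 1) * b n" for n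
      by (rule wasserstein_distance_lipschitz[where h=h, OF W that]) simp
    then show "(\<lambda>n. (\<integral>x. h x \<partial>\<mu> n) - (\<integral>x. h x \<partial>?\<nu>)) \<longlonglongrightarrow> 0"
      by (intro Lim_null_comparison[OF _ lim] always_eventually allI) simp
  qed
  have cos_lip: "\<bar>cos (t * x) - cos (t * y)\<bar> \<le> \<bar>t\<bar> * \<bar>x - y\<bar>" for x y
  proof -
    have "((\<lambda>x. cos (t * x)) has_field_derivative - (t * sin (t * z))) (at z)" for z
      by (auto intro!: derivative_eq_intros)
    moreover have "norm (- (t * sin (t * z))) \<le> \<bar>t\<bar>" for z
      using mult_left_le[of "\<bar>sin (t * z)\<bar>" "\<bar>t\<bar>"] by (simp add: abs_mult)
    ultimately have "norm (cos (t * x) - cos (t * y)) \<le> \<bar>t\<bar> * norm (x - y)"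
      by (intro field_differentiable_bound[of UNIV _ "\<lambda>z. - (t * sin (t * z))"]) auto
    then show ?thesis by simp
  qed
  have sin_lip: "\<bar>sin (t * x) - sin (t * y)\<bar> \<le> \<bar>t\<bar> * \<bar>x - y\<bar>" for x y
  proof -
    have "((\<lambda>x. sin (t * x)) has_field_derivative t * cos (t * z)) (at z)" for z
      by (auto intro!: derivative_eq_intros)
    moreover have "norm (t * cos (t * z)) \<le> \<bar>t\<bar>" for z
      using mult_left_le[of "\<bar>cos (t * z)\<bar>" "\<bar>t\<bar>"] by (simp add: abs_mult)
    ultimately have "norm (sin (t * x) - sin (t * y)) \<le> \<bar>t\<bar> * norm (x - y)"
      by (intro field_differentiable_bound[of UNIV _ "\<lambda>z. t * cos (t * z)"]) auto
    then show ?thesis by simp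
  qed
  have char: "char \<rho> t = complex_of_real (\<integral>x. cos (t * x) \<partial>\<rho>) + \<i> * complex_of_real (\<integral>x. sin (t * x) \<partial>\<rho>)"
    if "real_distribution \<rho>" for \<rho>
  proof -
    interpret \<rho>: real_distribution \<rho> by fact
    have "integrable \<rho> (\<lambda>x. cos (t * x))" "integrable \<rho> (\<lambda>x. sin (t * x))"
      by (auto intro!: \<rho>.integrable_const_bound[where B=1])
    then have "(\<integral>x. complex_of_real (cos (t * x)) + \<i> * complex_of_real (sin (t * x)) \<partial>\<rho>)
       = complex_of_real (\<integral>x. cos (t * x) \<partial>\<rho>) + \<i> * complex_of_real (\<integral>x. sin (t * x) \<partial>\<rho>)"
      by (subst Bochner_Integration.integral_add) auto
    moreover have "iexp (t * x) = complex_of_real (cos (t * x)) + \<i> * complex_of_real (sin (t * x))" for x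
      by (simp only: cis_conv_exp[symmetric]) (simp add: complex_eq_iff)
    ultimately show ?thesis unfolding char_def by simp
  qed
  show "(\<lambda>n. char (\<mu> n) t) \<longlonglongrightarrow> char ?\<nu> t"
    unfolding char[OF \<mu>] char[OF real_dist_normal_dist]
    by (intro tendsto_intros conv cos_lip sin_lip)
qed

section \<open>Functionals of a Poisson process\<close>

text \<open>A single term of the exponential series gives
  \<open>(1 + real m) ^ a \<le> fact a * exp (1 + real m)\<close>, so an exponential series with
  argument \<open>exp 1 * \<nu>\<close> dominates.\<close>

lemma summable_poisson_poly:
  fixes \<nu> :: real
  assumes "\<nu> \<ge> 0"
  shows "summable (\<lambda>m. (\<nu> ^ m / fact m * exp (- \<nu>)) * (1 + real m) ^ a)"
proof (rule summable_comparison_test'[where N=0])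
  let ?g = "\<lambda>m. (fact a * exp 1 * exp (- \<nu>)) * ((exp 1 * \<nu>) ^ m /\<^sub>R fact m)"
  show "summable ?g" by (intro summable_mult summable_exp_generic)
  fix m :: nat
  have "(1 + real m) ^ a / fact a \<le> exp (1 + real m)"
  proof -
    have s: "(\<lambda>i. (1 + real m) ^ i /\<^sub>R fact i) sums exp (1 + real m)" by (rule exp_converges)
    have "(\<Sum>i\<in>{a}. (1 + real m) ^ i /\<^sub>R fact i) \<le> (\<Sum>i. (1 + real m) ^ i /\<^sub>R fact i)"
      by (rule sum_le_suminf) (use s in \<open>auto simp: sums_iff\<close>)
    then show ?thesis using s by (simp add: sums_iff divide_inverse mult.commute)
  qed
  then have le: "(1 + real m) ^ a \<le> fact a * exp (1 + real m)"
    by (simp add: divide_le_eq mult.commute)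
  have "norm (\<nu> ^ m / fact m * exp (- \<nu>) * (1 + real m) ^ a)
      = \<nu> ^ m / fact m * exp (- \<nu>) * (1 + real m) ^ a"
    using assms by simp
  also have "\<dots> \<le> \<nu> ^ m / fact m * exp (- \<nu>) * (fact a * exp (1 + real m))"
    using assms le by (intro mult_left_mono) auto
  also have "\<dots> = ?g m"
    by (simp add: exp_add exp_of_nat_mult[of m 1, simplified] power_mult_distrib divide_inverse mult_ac)
  finally show "norm (\<nu> ^ m / fact m * exp (- \<nu>) * (1 + real m) ^ a) \<le> ?g m" .
qed

lemma poly_growth_bound:
  fixes c d :: real
  assumes "0 \<le> x"
  shows "c * (1 + x) ^ a \<le> (\<bar>c\<bar> + \<bar>d\<bar>) * (1 + x) ^ (a + b)"
proof -
  have "c * (1 + x) ^ a \<le> (\<bar>c\<bar> + \<bar>d\<bar>) * (1 + x) ^ a"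
    using assms by (intro mult_right_mono) auto
  also have "\<dots> \<le> (\<bar>c\<bar> + \<bar>d\<bar>) * (1 + x) ^ (a + b)"
    using assms by (intro mult_left_mono power_increasing) auto
  finally show ?thesis .
qed

lemma
  fixes \<nu> :: real and g :: "nat \<Rightarrow> real"
  assumes \<nu>: "\<nu> > 0" and g: "\<And>m. \<bar>g m\<bar> \<le> c * (1 + real m) ^ a"
  shows integrable_poisson_poly: "integrable (measure_pmf (poisson_pmf \<nu>)) g"
    and poisson_integral_sums: "(\<lambda>m. pmf (poisson_pmf \<nu>) m * g m) sums (\<integral>m. g m \<partial>measure_pmf (poisson_pmf \<nu>))"
proof -
  let ?p = "pmf (poisson_pmf \<nu>)"
  have "summable (\<lambda>m. norm (?p m * g m))"
  proof (rule summable_comparison_test'[where N=0])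
    show "summable (\<lambda>m. c * (?p m * (1 + real m) ^ a))"
      using summable_poisson_poly[of \<nu> a] \<nu> by (intro summable_mult) simp
    fix m
    show "norm (norm (?p m * g m)) \<le> c * (?p m * (1 + real m) ^ a)"
      using mult_left_mono[OF g[of m], of "?p m"] by (simp add: abs_mult mult_ac)
  qed
  then have int: "integrable (count_space UNIV) (\<lambda>m. ?p m *\<^sub>R g m)"
    by (subst integrable_count_space_nat_iff) simp
  then show "integrable (measure_pmf (poisson_pmf \<nu>)) g"
    unfolding measure_pmf_eq_density by (subst integrable_density) auto
  have "(\<integral>m. g m \<partial>measure_pmf (poisson_pmf \<nu>)) = (\<integral>m. ?p m *\<^sub>R g m \<partial>count_space UNIV)"
    unfolding measure_pmf_eq_density by (subst integral_density) auto
  then show "(\<lambda>m. ?p m * g m) sums (\<integral>m. g m \<partial>measure_pmf (poisson_pmf \<nu>))"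
    using sums_integral_count_space_nat[OF int] by simp
qed

text \<open>The scalar core of Mecke's formula: the Poisson weight at \<open>m + j\<close> times
  \<open>m + j choose j\<close> is \<open>\<nu> ^ j / fact j\<close> times the weight at
  \<open>m\<close>, and the terms below \<open>j\<close> vanish with the binomial
  coefficient.\<close>

lemma poisson_binomial_shift:
  fixes \<nu> :: real and g :: "nat \<Rightarrow> real"
  assumes \<nu>: "\<nu> > 0" and g: "\<And>m. \<bar>g m\<bar> \<le> c * (1 + real m) ^ a"
  shows "(\<integral>m. real (m choose j) * g m \<partial>measure_pmf (poisson_pmf \<nu>))
    = \<nu> ^ j / fact j * (\<integral>m. g (m + j) \<partial>measure_pmf (poisson_pmf \<nu>))"
proof -
  let ?p = "pmf (poisson_pmf \<nu>)"
  have c0: "c \<ge> 0" using g[of 0] by simp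
  have "\<bar>real (m choose j) * g m\<bar> \<le> c * (1 + real m) ^ (j + a)" for m
  proof -
    have "real (m choose j) \<le> (1 + real m) ^ j"
    proof (cases "j \<le> m")
      case True
      have "real (m choose j) \<le> real (m ^ j)"
        using binomial_le_pow[OF True] by (metis of_nat_le_iff)
      also have "\<dots> \<le> (1 + real m) ^ j" by (auto intro: power_mono)
      finally show ?thesis .
    qed (simp add: binomial_eq_0)
    then have "real (m choose j) * \<bar>g m\<bar> \<le> (1 + real m) ^ j * (c * (1 + real m) ^ a)"
      using g[of m] by (intro mult_mono) auto
    then show ?thesis by (simp add: abs_mult power_add mult_ac)
  qed
  from poisson_integral_sums[OF \<nu> this]
  have "(\<lambda>m. ?p m * (real (m choose j) * g m)) sums (\<integral>m. real (m choose j) * g m \<partial>measure_pmf (poisson_pmf \<nu>))" .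
  then have "(\<lambda>m. ?p (m + j) * (real (m + j choose j) * g (m + j))) sums
     ((\<integral>m. real (m choose j) * g m \<partial>measure_pmf (poisson_pmf \<nu>)) - (\<Sum>m<j. ?p m * (real (m choose j) * g m)))"
    by (subst sums_iff_shift')
  moreover have "(\<Sum>m<j. ?p m * (real (m choose j) * g m)) = 0"
    by (intro sum.neutral) (auto simp: binomial_eq_0)
  moreover have "?p (m + j) * (real (m + j choose j) * g (m + j)) = \<nu> ^ j / fact j * (?p m * g (m + j))" for m
  proof -
    have "real (m + j choose j) = fact (m + j) / (fact j * fact m)"
      using binomial_fact[of j "m + j", where 'a=real] by simp
    then show ?thesis using \<nu> by (simp add: power_add field_simps)
  qed
  ultimately have 1: "(\<lambda>m. \<nu> ^ j / fact j * (?p m * g (m + j))) sums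
      (\<integral>m. real (m choose j) * g m \<partial>measure_pmf (poisson_pmf \<nu>))" by simp
  have "\<bar>g (m + j)\<bar> \<le> (c * (1 + real j) ^ a) * (1 + real m) ^ a" for m
  proof -
    have "(1 + real (m + j)) \<le> (1 + real j) * (1 + real m)" by (simp add: algebra_simps)
    then have "(1 + real (m + j)) ^ a \<le> ((1 + real j) * (1 + real m)) ^ a" by (rule power_mono) simp
    then have "c * (1 + real (m + j)) ^ a \<le> c * ((1 + real j) * (1 + real m)) ^ a"
      using c0 by (rule mult_left_mono)
    then show ?thesis using g[of "m + j"] by (simp add: power_mult_distrib mult_ac)
  qed
  from poisson_integral_sums[OF \<nu> this, THEN sums_mult, of "\<nu> ^ j / fact j"] 1
  show ?thesis by (rule sums_unique2[symmetric])
qed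

text \<open>Exchangeability is applied through such permutations: all subsets of \<open>B\<close> of
  one size are alike, while the coordinates outside \<open>B\<close>, in particular those reserved
  for further points, stay fixed.\<close>

lemma ex_permutation_image:
  fixes J J' B :: "'i set"
  assumes "finite B" "J \<subseteq> B" "J' \<subseteq> B" "card J = card J'"
  obtains \<pi> where "bij \<pi>" "\<pi> ` J = J'" "\<pi> ` B = B" "\<And>i. i \<notin> B \<Longrightarrow> \<pi> i = i"
proof -
  have fin: "finite J" "finite J'" using assms finite_subset by auto
  obtain f where f: "bij_betw f J J'"
    using fin assms(4) finite_same_card_bij by blast
  have "card (B - J) = card (B - J')" using assms fin by (simp add: card_Diff_subset)
  then obtain g where g: "bij_betw g (B - J) (B - J')"
    using assms(1) finite_same_card_bij by (metis finite_Diff)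
  define \<pi> where "\<pi> i = (if i \<in> J then f i else if i \<in> B then g i else i)" for i
  have 1: "bij_betw \<pi> J J'" using f by (subst bij_betw_cong[of J \<pi> f]) (auto simp: \<pi>_def)
  have 2: "bij_betw \<pi> (B - J) (B - J')" using g by (subst bij_betw_cong[of _ \<pi> g]) (auto simp: \<pi>_def)
  have 3: "bij_betw \<pi> (- B) (- B)" using assms(2) by (subst bij_betw_cong[of _ \<pi> id]) (auto simp: \<pi>_def)
  have 4: "bij_betw \<pi> (J \<union> (B - J)) (J' \<union> (B - J'))"
    by (rule bij_betw_combine[OF 1 2]) auto
  have un: "J \<union> (B - J) = B" "J' \<union> (B - J') = B" using assms by auto
  have 5: "bij_betw \<pi> B B" using 4 unfolding un .
  have "bij_betw \<pi> (B \<union> - B) (B \<union> - B)"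
    by (rule bij_betw_combine[OF 5 3]) auto
  then have "bij \<pi>" by simp
  moreover have "\<pi> ` J = J'" "\<pi> ` B = B" using 1 5 by (auto simp: bij_betw_def)
  moreover have "\<pi> i = i" if "i \<notin> B" for i using that assms(2) by (auto simp: \<pi>_def)
  ultimately show thesis by (rule that)
qed

text \<open>For independent sequences \<open>x\<close> and \<open>y\<close> of the same i.i.d. law
  this again has that law. Integrating over \<open>x\<close> alone is thus a conditional expectation
  given the coordinates outside \<open>A\<close>, and \<open>f (mix A x y) = f y\<close> for all
  \<open>x\<close> and \<open>y\<close> says that \<open>f\<close> does not depend on the
  coordinates in \<open>A\<close>.\<close>

definition mix :: "'i set \<Rightarrow> ('i \<Rightarrow> 'b) \<Rightarrow> ('i \<Rightarrow> 'b) \<Rightarrow> 'i \<Rightarrow> 'b" where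
  "mix A x y i = (if i \<in> A then x i else y i)"

section \<open>Expectations over a Poisson number of independent points\<close>

locale poisson_iid = prob_space D for D :: "'b measure" +
  fixes \<nu> :: real
  assumes space_D: "space D = UNIV" and \<nu>_pos: "\<nu> > 0"
begin

definition Q :: "(nat \<Rightarrow> 'b) measure" where "Q = PiM UNIV (\<lambda>_. D)"

text \<open>
  For \<open>(m, y)\<close> distributed as \<open>R\<close> and any \<open>K\<close>, the points \<open>y i\<close> with \<open>K \<le> i < K + m\<close> form a Poisson process
  of mean \<open>\<nu> * D\<close>, and the coordinates below \<open>K\<close> provide independent further points.
\<close>

definition R :: "(nat \<times> (nat \<Rightarrow> 'b)) measure" where
  "R = measure_pmf (poisson_pmf \<nu>) \<Otimes>\<^sub>M Q"

lemma prob_space_D: "prob_space D"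
  by (rule prob_space_axioms)

sublocale P: product_prob_space "\<lambda>_. D" "UNIV :: nat set" by unfold_locales

sublocale Q: prob_space Q
  unfolding Q_def by (rule prob_space_PiM) (rule prob_space_D)

sublocale QQ: pair_prob_space Q Q ..

sublocale R: pair_prob_space "measure_pmf (poisson_pmf \<nu>)" Q ..

lemma space_Q[simp]: "space Q = UNIV"
  by (auto simp: Q_def space_PiM space_D PiE_def extensional_def)

lemma prob_Q_UNIV[simp]: "Q.prob UNIV = 1"
  using Q.prob_space by simp

lemma measurable_component_Q[measurable]: "(\<lambda>y. y i) \<in> measurable Q D"
  unfolding Q_def by measurable

lemma measurable_into_Q:
  assumes "\<And>i. (\<lambda>x. f x i) \<in> measurable M D" shows "f \<in> measurable M Q"
proof -
  have "(\<lambda>x. \<lambda>i\<in>UNIV. f x i) \<in> measurable M (PiM UNIV (\<lambda>_. D))"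
    using assms by (intro measurable_restrict)
  then show ?thesis by (simp add: Q_def restrict_def)
qed

lemma measurable_relabel[measurable]: "(\<lambda>y. y \<circ> \<pi>) \<in> measurable Q Q"
  by (rule measurable_into_Q) (simp add: measurable_component_Q)

lemma distr_relabel: "inj \<pi> \<Longrightarrow> distr Q Q (\<lambda>y. y \<circ> \<pi>) = Q"
  using distr_PiM_reindex[of UNIV "\<lambda>_. D" \<pi> UNIV] prob_space_D
  by (simp add: Q_def comp_def restrict_def)

lemma integral_relabel:
  fixes f :: "(nat \<Rightarrow> 'b) \<Rightarrow> real"
  assumes "inj \<pi>" "f \<in> borel_measurable Q"
  shows "(\<integral>y. f (y \<circ> \<pi>) \<partial>Q) = (\<integral>y. f y \<partial>Q)"
  using integral_distr[of "\<lambda>y. y \<circ> \<pi>" Q Q f] distr_relabel[OF assms(1)] assms(2) by simp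

lemma measurable_mix: "(\<lambda>(x, y). mix A x y) \<in> measurable (Q \<Otimes>\<^sub>M Q) Q"
proof (rule measurable_into_Q)
  fix i show "(\<lambda>x. (case x of (x, y) \<Rightarrow> mix A x y) i) \<in> measurable (Q \<Otimes>\<^sub>M Q) D"
    by (cases "i \<in> A") (simp_all add: mix_def case_prod_beta)
qed

lemma measurable_mix'[measurable (raw)]:
  assumes "f \<in> measurable M Q" "g \<in> measurable M Q"
  shows "(\<lambda>x. mix A (f x) (g x)) \<in> measurable M Q"
  using measurable_compose[OF measurable_Pair[OF assms] measurable_mix[of A]] by simp

text \<open>The preimage of a cylinder is a rectangle: \<open>x\<close> carries the conditions with
  index in \<open>A\<close> and \<open>y\<close> the others, so the two measures multiply to the
  full product.\<close>

lemma distr_mix: "distr (Q \<Otimes>\<^sub>M Q) Q (\<lambda>(x, y). mix A x y) = Q"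
proof -
  have "distr (Q \<Otimes>\<^sub>M Q) Q (\<lambda>(x, y). mix A x y) = PiM UNIV (\<lambda>_. D)"
  proof (rule P.PiM_eq)
    show "sets (distr (Q \<Otimes>\<^sub>M Q) Q (\<lambda>(x, y). mix A x y)) = sets (PiM UNIV (\<lambda>_. D))"
      by (simp add: Q_def)
    fix J :: "nat set" and F :: "nat \<Rightarrow> 'b set"
    assume J: "finite J" and F: "\<And>j. j \<in> J \<Longrightarrow> F j \<in> sets D"
    let ?e = "\<lambda>J. prod_emb UNIV (\<lambda>_. D) J (Pi\<^sub>E J F)"
    have e: "?e J = {y. \<forall>j\<in>J. y j \<in> F j}" for J :: "nat set"
      by (auto simp: prod_emb_def space_D)
    have sets: "?e J' \<in> sets Q" if "J' \<subseteq> J" for J'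
      unfolding Q_def using that J F by (intro sets_PiM_I) (auto intro: finite_subset)
    have "emeasure (distr (Q \<Otimes>\<^sub>M Q) Q (\<lambda>(x, y). mix A x y)) (?e J)
        = emeasure (Q \<Otimes>\<^sub>M Q) ((\<lambda>(x, y). mix A x y) -` ?e J \<inter> space (Q \<Otimes>\<^sub>M Q))"
      using sets[of J] by (intro emeasure_distr measurable_mix) auto
    also have "(\<lambda>(x, y). mix A x y) -` ?e J \<inter> space (Q \<Otimes>\<^sub>M Q) = ?e (J \<inter> A) \<times> ?e (J - A)"
      unfolding e by (auto simp: mix_def space_pair_measure split: if_splits)
    also have "emeasure (Q \<Otimes>\<^sub>M Q) \<dots> = emeasure Q (?e (J \<inter> A)) * emeasure Q (?e (J - A))"
      by (intro Q.emeasure_pair_measure_Times sets) auto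
    also have "\<dots> = (\<Prod>j\<in>J \<inter> A. emeasure D (F j)) * (\<Prod>j\<in>J - A. emeasure D (F j))"
      unfolding Q_def using J F by (subst (1 2) P.emeasure_PiM_emb) auto
    also have "\<dots> = (\<Prod>j\<in>J. emeasure D (F j))"
      using J by (subst prod.union_disjoint[symmetric]) (auto intro!: prod.cong)
    finally show "emeasure (distr (Q \<Otimes>\<^sub>M Q) Q (\<lambda>(x, y). mix A x y)) (?e J) = (\<Prod>j\<in>J. emeasure D (F j))" .
  qed
  then show ?thesis by (simp add: Q_def)
qed

lemma
  fixes f :: "(nat \<Rightarrow> 'b) \<Rightarrow> real"
  assumes f: "integrable Q f"
  shows integrable_mix: "integrable (Q \<Otimes>\<^sub>M Q) (\<lambda>(x, y). f (mix A x y))"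
    and integral_mix: "(\<integral>y. f y \<partial>Q) = (\<integral>x. (\<integral>y. f (mix A x y) \<partial>Q) \<partial>Q)"
    and integral_mix': "(\<integral>y. f y \<partial>Q) = (\<integral>y. (\<integral>x. f (mix A x y) \<partial>Q) \<partial>Q)"
proof -
  have "integrable (distr (Q \<Otimes>\<^sub>M Q) Q (\<lambda>(x, y). mix A x y)) f" using f by (simp add: distr_mix)
  then have int: "integrable (Q \<Otimes>\<^sub>M Q) (\<lambda>p. f (case p of (x, y) \<Rightarrow> mix A x y))"
    by (subst (asm) integrable_distr_eq) (use f in \<open>auto intro: measurable_mix\<close>)
  then show int': "integrable (Q \<Otimes>\<^sub>M Q) (\<lambda>(x, y). f (mix A x y))"
    by (simp add: case_prod_beta')
  have "(\<integral>y. f y \<partial>Q) = (\<integral>y. f y \<partial>distr (Q \<Otimes>\<^sub>M Q) Q (\<lambda>(x, y). mix A x y))" by (simp add: distr_mix)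
  also have "\<dots> = (\<integral>p. f (case p of (x, y) \<Rightarrow> mix A x y) \<partial>(Q \<Otimes>\<^sub>M Q))"
    by (rule integral_distr) (use f in \<open>auto intro: measurable_mix\<close>)
  also have "\<dots> = (\<integral>p. (case p of (x, y) \<Rightarrow> f (mix A x y)) \<partial>(Q \<Otimes>\<^sub>M Q))"
    by (simp add: case_prod_beta')
  finally have eq: "(\<integral>y. f y \<partial>Q) = (\<integral>p. (case p of (x, y) \<Rightarrow> f (mix A x y)) \<partial>(Q \<Otimes>\<^sub>M Q))" .
  then show "(\<integral>y. f y \<partial>Q) = (\<integral>x. (\<integral>y. f (mix A x y) \<partial>Q) \<partial>Q)"
    using QQ.integral_fst'[OF int'] by simp
  show "(\<integral>y. f y \<partial>Q) = (\<integral>y. (\<integral>x. f (mix A x y) \<partial>Q) \<partial>Q)"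
    using QQ.integral_snd[OF int'] eq by simp
qed

text \<open>Poisson variables have moments of all orders, so a bound that is polynomial in the
  number of points and uniform in their positions ensures integrability. Unlike integrability
  itself, it is preserved by products.\<close>

definition tame :: "(nat \<Rightarrow> (nat \<Rightarrow> 'b) \<Rightarrow> real) \<Rightarrow> bool" where
  "tame \<Phi> \<longleftrightarrow> (\<forall>m. \<Phi> m \<in> borel_measurable Q) \<and> (\<exists>c a. \<forall>m y. \<bar>\<Phi> m y\<bar> \<le> c * (1 + real m) ^ a)"

definition E :: "(nat \<Rightarrow> (nat \<Rightarrow> 'b) \<Rightarrow> real) \<Rightarrow> real" where
  "E \<Phi> = (\<integral>p. \<Phi> (fst p) (snd p) \<partial>R)"

lemma tameI:
  "(\<And>m. \<Phi> m \<in> borel_measurable Q) \<Longrightarrow> (\<And>m y. \<bar>\<Phi> m y\<bar> \<le> c * (1 + real m) ^ a) \<Longrightarrow> tame \<Phi>"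
  by (auto simp: tame_def)

lemma tame_measurable: "tame \<Phi> \<Longrightarrow> \<Phi> m \<in> borel_measurable Q"
  by (auto simp: tame_def)

lemma tame_bounded:
  assumes "tame \<Phi>" shows "\<exists>c a. c \<ge> 0 \<and> (\<forall>m y. \<bar>\<Phi> m y\<bar> \<le> c * (1 + real m) ^ a)"
proof -
  from assms obtain c a where *: "\<And>m y. \<bar>\<Phi> m y\<bar> \<le> c * (1 + real m) ^ a" by (auto simp: tame_def)
  from order_trans[OF abs_ge_zero *[of 0 undefined]] have "c \<ge> 0" by simp
  with * show ?thesis by blast
qed

lemma tame_integrable_Q: assumes "tame \<Phi>" shows "integrable Q (\<Phi> m)"
proof -
  obtain c a where "\<forall>m y. \<bar>\<Phi> m y\<bar> \<le> c * (1 + real m) ^ a" using assms by (auto simp: tame_def)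
  then show ?thesis
    using tame_measurable[OF assms]
    by (intro Q.integrable_const_bound[where B="c * (1 + real m) ^ a"]) auto
qed

lemma measurable_R: "(\<And>m. \<Phi> m \<in> borel_measurable Q) \<Longrightarrow> (\<lambda>p. \<Phi> (fst p) (snd p)) \<in> borel_measurable R"
  unfolding R_def
  by (subst measurable_cong_sets[OF sets_pair_measure_cong[of _ "count_space UNIV" Q Q] refl])
     (auto intro!: measurable_pair_measure_countable1)

lemma tame_integrable:
  assumes "tame \<Phi>" shows "integrable R (\<lambda>p. \<Phi> (fst p) (snd p))"
proof -
  obtain c a where c: "c \<ge> 0" and b: "\<And>m y. \<bar>\<Phi> m y\<bar> \<le> c * (1 + real m) ^ a" using tame_bounded[OF assms] by blast
  let ?P = "measure_pmf (poisson_pmf \<nu>)"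
  have int: "integrable ?P (\<lambda>m. c * (1 + real m) ^ a)"
    using b order_trans[OF abs_ge_zero b]
    by (intro integrable_poisson_poly[OF \<nu>_pos, of _ c a]) simp
  have "integrable R (\<lambda>p. (\<lambda>m y. c * (1 + real m) ^ a) (fst p) (snd p))"
    unfolding R_def
  proof (rule R.Fubini_integrable)
    show "(\<lambda>p. (\<lambda>m y. c * (1 + real m) ^ a) (fst p) (snd p)) \<in> borel_measurable (?P \<Otimes>\<^sub>M Q)"
      by measurable
    show "integrable ?P (\<lambda>x. \<integral>y. norm ((\<lambda>m y. c * (1 + real m) ^ a) (fst (x, y)) (snd (x, y))) \<partial>Q)"
      using int by (simp add: Q.prob_space)
  qed auto
  then show ?thesis
    by (rule Bochner_Integration.integrable_bound)
       (use b assms in \<open>auto intro!: measurable_R tame_measurable AE_I2 intro: order_trans[OF b abs_ge_self]\<close>)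
qed

lemma E_eq:
  assumes "tame \<Phi>" shows "E \<Phi> = (\<integral>m. (\<integral>y. \<Phi> m y \<partial>Q) \<partial>measure_pmf (poisson_pmf \<nu>))"
  using R.integral_fst'[OF tame_integrable[OF assms, unfolded R_def]] by (simp add: E_def R_def)

lemma tame_const[simp]: "tame (\<lambda>_ _. c)"
  by (rule tameI[where c="\<bar>c\<bar>" and a=0]) auto

lemma tame_add: assumes "tame \<Phi>" "tame \<Psi>" shows "tame (\<lambda>m y. \<Phi> m y + \<Psi> m y)"
proof -
  obtain c a where c: "c \<ge> 0" and b: "\<And>m y. \<bar>\<Phi> m y\<bar> \<le> c * (1 + real m) ^ a" using tame_bounded[OF assms(1)] by blast
  obtain c' a' where c': "c' \<ge> 0" and b': "\<And>m y. \<bar>\<Psi> m y\<bar> \<le> c' * (1 + real m) ^ a'" using tame_bounded[OF assms(2)] by blast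
  show ?thesis
  proof (rule tameI)
    show "(\<lambda>y. \<Phi> m y + \<Psi> m y) \<in> borel_measurable Q" for m
      using assms[THEN tame_measurable, of m] by measurable
    show "\<bar>\<Phi> m y + \<Psi> m y\<bar> \<le> ((\<bar>c\<bar> + \<bar>c'\<bar>) + (\<bar>c'\<bar> + \<bar>c\<bar>)) * (1 + real m) ^ (a + a')" for m y
      using b[of m y] b'[of m y] poly_growth_bound[of "real m" c a c' a']
        poly_growth_bound[of "real m" c' a' c a]
      by (simp add: distrib_right add.commute)
  qed
qed

lemma tame_mult: assumes "tame \<Phi>" "tame \<Psi>" shows "tame (\<lambda>m y. \<Phi> m y * \<Psi> m y)"
proof -
  obtain c a where c: "c \<ge> 0" and b: "\<And>m y. \<bar>\<Phi> m y\<bar> \<le> c * (1 + real m) ^ a" using tame_bounded[OF assms(1)] by blast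
  obtain c' a' where c': "c' \<ge> 0" and b': "\<And>m y. \<bar>\<Psi> m y\<bar> \<le> c' * (1 + real m) ^ a'" using tame_bounded[OF assms(2)] by blast
  show ?thesis
  proof (rule tameI)
    show "(\<lambda>y. \<Phi> m y * \<Psi> m y) \<in> borel_measurable Q" for m
      using assms[THEN tame_measurable, of m] by measurable
    fix m y
    have "\<bar>\<Phi> m y\<bar> * \<bar>\<Psi> m y\<bar> \<le> (c * (1 + real m) ^ a) * (c' * (1 + real m) ^ a')"
      by (intro mult_mono b b' order_trans[OF abs_ge_zero b]) auto
    then show "\<bar>\<Phi> m y * \<Psi> m y\<bar> \<le> (c * c') * (1 + real m) ^ (a + a')"
      by (simp add: abs_mult power_add mult_ac)
  qed
qed

lemma tame_cmult: "tame \<Phi> \<Longrightarrow> tame (\<lambda>m y. c * \<Phi> m y)"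
  using tame_mult[OF tame_const] .

lemma tame_diff: "tame \<Phi> \<Longrightarrow> tame \<Psi> \<Longrightarrow> tame (\<lambda>m y. \<Phi> m y - \<Psi> m y)"
  using tame_add[of \<Phi> "\<lambda>m y. (-1) * \<Psi> m y"] tame_cmult[of \<Psi> "-1"] by simp

lemma tame_power: "tame \<Phi> \<Longrightarrow> tame (\<lambda>m y. \<Phi> m y ^ n)"
  by (induction n) (auto intro: tame_mult)

lemma tame_sum: "(\<And>i. i \<in> I \<Longrightarrow> tame (\<Phi> i)) \<Longrightarrow> tame (\<lambda>m y. \<Sum>i\<in>I. \<Phi> i m y)"
  by (induction I rule: infinite_finite_induct) (auto intro: tame_add)

lemma tame_bound:
  assumes "tame \<Phi>" "\<And>m. \<Psi> m \<in> borel_measurable Q" "\<And>m y. \<bar>\<Psi> m y\<bar> \<le> \<bar>\<Phi> m y\<bar>"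
  shows "tame \<Psi>"
  using assms by (metis (no_types, lifting) order_trans tame_def)

lemma tame_relabel: "tame \<Phi> \<Longrightarrow> tame (\<lambda>m y. \<Phi> m (y \<circ> \<pi>))"
  unfolding tame_def by (fastforce intro: measurable_compose[OF measurable_relabel])

lemma E_add: "tame \<Phi> \<Longrightarrow> tame \<Psi> \<Longrightarrow> E (\<lambda>m y. \<Phi> m y + \<Psi> m y) = E \<Phi> + E \<Psi>"
  and E_diff: "tame \<Phi> \<Longrightarrow> tame \<Psi> \<Longrightarrow> E (\<lambda>m y. \<Phi> m y - \<Psi> m y) = E \<Phi> - E \<Psi>"
  and E_mono: "tame \<Phi> \<Longrightarrow> tame \<Psi> \<Longrightarrow> (\<And>m y. \<Phi> m y \<le> \<Psi> m y) \<Longrightarrow> E \<Phi> \<le> E \<Psi>"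
  unfolding E_def by (auto dest!: tame_integrable intro!: integral_mono)

lemma E_cmult: "E (\<lambda>m y. c * \<Phi> m y) = c * E \<Phi>"
  by (simp add: E_def)

lemma E_const: "E (\<lambda>m y. c) = c"
  unfolding E_def R_def using R.prob_space by simp

lemma E_nonneg: "(\<And>m y. 0 \<le> \<Phi> m y) \<Longrightarrow> 0 \<le> E \<Phi>"
  by (simp add: E_def)

lemma E_sum: "(\<And>i. i \<in> I \<Longrightarrow> tame (\<Phi> i)) \<Longrightarrow> E (\<lambda>m y. \<Sum>i\<in>I. \<Phi> i m y) = (\<Sum>i\<in>I. E (\<Phi> i))"
  unfolding E_def by (rule Bochner_Integration.integral_sum) (auto dest: tame_integrable)

lemma E_abs_le: "\<bar>E \<Phi>\<bar> \<le> E (\<lambda>m y. \<bar>\<Phi> m y\<bar>)"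
  by (simp add: E_def)

lemma E_relabel:
  assumes "inj \<pi>" "tame \<Phi>" shows "E (\<lambda>m y. \<Phi> m (y \<circ> \<pi>)) = E \<Phi>"
  using assms by (simp add: E_eq tame_relabel integral_relabel tame_measurable)

lemma E_square_le:
  assumes "tame \<Phi>" shows "(E \<Phi>)\<^sup>2 \<le> E (\<lambda>m y. (\<Phi> m y)\<^sup>2)"
proof -
  have "0 \<le> E (\<lambda>m y. (\<Phi> m y - E \<Phi>)\<^sup>2)" by (intro E_nonneg) simp
  also have "(\<lambda>m y. (\<Phi> m y - E \<Phi>)\<^sup>2) = (\<lambda>m y. ((\<Phi> m y)\<^sup>2 - (2 * E \<Phi>) * \<Phi> m y) + (E \<Phi>)\<^sup>2)"
    by (intro ext) (simp add: power2_diff algebra_simps)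
  also have "E \<dots> = E (\<lambda>m y. (\<Phi> m y)\<^sup>2) - 2 * E \<Phi> * E \<Phi> + (E \<Phi>)\<^sup>2"
    using assms by (simp add: E_add E_diff E_cmult E_const tame_diff tame_power tame_cmult)
  finally show ?thesis by (simp add: power2_eq_square)
qed

text \<open>The hypotheses \<open>A\<close> say that \<open>\<phi>\<close> reads only the
  coordinates in \<open>A\<close> and \<open>\<psi>\<close> only the others.\<close>

lemma E_indep:
  assumes \<phi>: "tame (\<lambda>_. \<phi>)" and \<psi>: "tame \<psi>"
    and A: "\<And>x y. \<phi> (mix A x y) = \<phi> x" "\<And>m x y. \<psi> m (mix A x y) = \<psi> m y"
  shows "E (\<lambda>m y. \<phi> y * \<psi> m y) = E (\<lambda>_. \<phi>) * E \<psi>"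
proof -
  have "(\<integral>y. \<phi> y * \<psi> m y \<partial>Q) = (\<integral>y. \<phi> y \<partial>Q) * (\<integral>y. \<psi> m y \<partial>Q)" for m
  proof -
    have "(\<integral>y. \<phi> y * \<psi> m y \<partial>Q) = (\<integral>x. (\<integral>y. \<phi> (mix A x y) * \<psi> m (mix A x y) \<partial>Q) \<partial>Q)"
      by (rule integral_mix) (rule tame_integrable_Q[OF tame_mult[OF \<phi> \<psi>]])
    then show ?thesis by (simp add: A)
  qed
  then show ?thesis by (simp add: E_eq tame_mult[OF \<phi> \<psi>] \<phi> \<psi>)
qed

text \<open>Mecke's formula for \<open>j\<close> points. For a fixed number \<open>m\<close> of
  points, exchangeability gives all \<open>j\<close>-subsets \<open>J\<close> the same integral, so
  that the sum integrates to \<open>m choose j\<close> times one of them, and the Poisson weights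
  absorb the binomial coefficient. Since \<open>equi\<close> concerns only permutations that fix the
  indices below \<open>K\<close>, \<open>\<Psi>\<close> may also read these further points. On the
  right the chosen points occupy \<open>{K..<K+j}\<close> and the process is stored from
  \<open>K + j\<close> on.\<close>

lemma
  fixes \<Psi> :: "nat set \<Rightarrow> nat set \<Rightarrow> (nat \<Rightarrow> 'b) \<Rightarrow> real"
  assumes meas: "\<And>J B. finite B \<Longrightarrow> J \<subseteq> B \<Longrightarrow> \<Psi> J B \<in> borel_measurable Q"
    and bound: "\<And>J B y. finite B \<Longrightarrow> J \<subseteq> B \<Longrightarrow> \<bar>\<Psi> J B y\<bar> \<le> c * (1 + real (card B)) ^ a"
    and equi: "\<And>\<pi> J B y. bij \<pi> \<Longrightarrow> (\<And>i. i < K \<Longrightarrow> \<pi> i = i) \<Longrightarrow> \<Psi> (\<pi> ` J) (\<pi> ` B) y = \<Psi> J B (y \<circ> \<pi>)"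
  shows mecke: "E (\<lambda>m y. \<Sum>J | J \<subseteq> {K..<K+m} \<and> card J = j. \<Psi> J {K..<K+m} y)
      = \<nu> ^ j / fact j * E (\<lambda>m y. \<Psi> {K..<K+j} {K..<K+j+m} y)"
    and tame_mecke: "tame (\<lambda>m y. \<Sum>J | J \<subseteq> {K..<K+m} \<and> card J = j. \<Psi> J {K..<K+m} y)"
proof -
  let ?B = "\<lambda>m. {K..<K+m}" and ?J = "{K..<K+j}"
  have c0: "c \<ge> 0" using bound[of "{}" "{}" undefined] order_trans[OF abs_ge_zero] by fastforce
  have int: "integrable Q (\<Psi> J (?B m))" if "J \<subseteq> ?B m" for J m
    using meas[OF _ that] bound[OF _ that] by (intro Q.integrable_const_bound[where B="c * (1 + real m) ^ a"]) auto
  \<comment> \<open>For \<open>m < j\<close> the block \<open>{K..<K+j}\<close> is not contained in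
    the index set, and the hypotheses say nothing about \<open>\<Psi>\<close> there; the last factor
    replaces such values by 0.\<close>
  define g where "g m = (\<integral>y. \<Psi> ?J (?B m) y \<partial>Q) * of_bool (j \<le> m)" for m
  have g: "\<bar>g m\<bar> \<le> c * (1 + real m) ^ a" for m
  proof (cases "j \<le> m")
    case True
    have "\<bar>\<integral>y. \<Psi> ?J (?B m) y \<partial>Q\<bar> \<le> (\<integral>y. \<bar>\<Psi> ?J (?B m) y\<bar> \<partial>Q)" by (rule integral_abs_bound)
    also have "\<dots> \<le> (\<integral>y. c * (1 + real m) ^ a \<partial>Q)"
      using int[of ?J m] bound[of "?B m" ?J] True by (intro integral_mono) auto
    finally show ?thesis using True by (simp add: g_def Q.prob_space)
  qed (use c0 in \<open>simp add: g_def\<close>)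
  have sum: "(\<integral>y. (\<Sum>J | J \<subseteq> ?B m \<and> card J = j. \<Psi> J (?B m) y) \<partial>Q) = real (m choose j) * g m" for m
  proof (cases "j \<le> m")
    case True
    have eq: "(\<integral>y. \<Psi> J (?B m) y \<partial>Q) = g m" if J: "J \<subseteq> ?B m" "card J = j" for J
    proof -
      obtain \<pi> where \<pi>: "bij \<pi>" "\<pi> ` ?J = J" "\<pi> ` ?B m = ?B m" "\<And>i. i \<notin> ?B m \<Longrightarrow> \<pi> i = i"
        using ex_permutation_image[of "?B m" ?J J] J True by auto
      have "\<Psi> J (?B m) y = \<Psi> ?J (?B m) (y \<circ> \<pi>)" for y
        using equi[OF \<pi>(1), of ?J "?B m" y] \<pi> by simp
      then have "(\<integral>y. \<Psi> J (?B m) y \<partial>Q) = (\<integral>y. \<Psi> ?J (?B m) (y \<circ> \<pi>) \<partial>Q)" by simp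
      also have "\<dots> = (\<integral>y. \<Psi> ?J (?B m) y \<partial>Q)"
        using \<pi>(1) True by (intro integral_relabel meas) (auto simp: bij_def)
      finally show ?thesis using True by (simp add: g_def)
    qed
    have "(\<integral>y. (\<Sum>J | J \<subseteq> ?B m \<and> card J = j. \<Psi> J (?B m) y) \<partial>Q)
        = (\<Sum>J | J \<subseteq> ?B m \<and> card J = j. (\<integral>y. \<Psi> J (?B m) y \<partial>Q))"
      using int by (intro Bochner_Integration.integral_sum) auto
    also have "\<dots> = (\<Sum>J | J \<subseteq> ?B m \<and> card J = j. g m)"
      using eq by (intro sum.cong) auto
    also have "\<dots> = real (m choose j) * g m"
      using n_subsets[of "?B m" j] by simp
    finally show ?thesis .
  next
    case False
    then have none: "{J. J \<subseteq> ?B m \<and> card J = j} = {}"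
      using card_mono[of "?B m"] by fastforce
    show ?thesis using False unfolding none by (simp add: g_def)
  qed
  show tame: "tame (\<lambda>m y. \<Sum>J | J \<subseteq> ?B m \<and> card J = j. \<Psi> J (?B m) y)"
  proof (rule tameI)
    show "(\<lambda>y. \<Sum>J | J \<subseteq> ?B m \<and> card J = j. \<Psi> J (?B m) y) \<in> borel_measurable Q" for m
      using meas by (intro borel_measurable_sum) auto
    fix m y
    have "\<bar>\<Sum>J | J \<subseteq> ?B m \<and> card J = j. \<Psi> J (?B m) y\<bar> \<le> (\<Sum>J | J \<subseteq> ?B m \<and> card J = j. c * (1 + real m) ^ a)"
    proof (rule order_trans[OF sum_abs], rule sum_mono)
      fix J assume "J \<in> {J. J \<subseteq> ?B m \<and> card J = j}"
      then show "\<bar>\<Psi> J (?B m) y\<bar> \<le> c * (1 + real m) ^ a" using bound[of "?B m" J y] by simp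
    qed
    also have "\<dots> = real (m choose j) * (c * (1 + real m) ^ a)"
      using n_subsets[of "?B m" j] by simp
    also have "\<dots> \<le> (1 + real m) ^ j * (c * (1 + real m) ^ a)"
    proof (rule mult_right_mono)
      have "m choose j \<le> m ^ j" by (cases "j \<le> m") (auto simp: binomial_le_pow binomial_eq_0)
      then have "real (m choose j) \<le> real m ^ j" by (metis of_nat_le_iff of_nat_power)
      also have "\<dots> \<le> (1 + real m) ^ j" by (rule power_mono) auto
      finally show "real (m choose j) \<le> (1 + real m) ^ j" .
    qed (use c0 in simp)
    finally show "\<bar>\<Sum>J | J \<subseteq> ?B m \<and> card J = j. \<Psi> J (?B m) y\<bar> \<le> c * (1 + real m) ^ (j + a)"
      by (simp add: power_add mult_ac)
  qed
  from tame have "E (\<lambda>m y. \<Sum>J | J \<subseteq> ?B m \<and> card J = j. \<Psi> J (?B m) y)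
      = (\<integral>m. real (m choose j) * g m \<partial>measure_pmf (poisson_pmf \<nu>))"
    by (simp add: E_eq sum)
  also have "\<dots> = \<nu> ^ j / fact j * (\<integral>m. g (m + j) \<partial>measure_pmf (poisson_pmf \<nu>))"
    by (rule poisson_binomial_shift[OF \<nu>_pos g])
  also have "(\<integral>m. g (m + j) \<partial>measure_pmf (poisson_pmf \<nu>)) = E (\<lambda>m y. \<Psi> ?J {K..<K+j+m} y)"
  proof (subst E_eq)
    show "tame (\<lambda>m. \<Psi> ?J {K..<K+j+m})"
    proof (rule tameI)
      fix m y
      have "\<bar>\<Psi> ?J {K..<K+j+m} y\<bar> \<le> c * (1 + real (j + m)) ^ a"
        using bound[of "{K..<K+j+m}" ?J y] by simp
      also have "\<dots> \<le> c * ((1 + real j) * (1 + real m)) ^ a"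
        using c0 by (intro mult_left_mono power_mono) (auto simp: algebra_simps)
      finally show "\<bar>\<Psi> ?J {K..<K+j+m} y\<bar> \<le> (c * (1 + real j) ^ a) * (1 + real m) ^ a"
        by (simp add: power_mult_distrib mult_ac)
    qed (intro meas, auto)
  qed (simp add: g_def ac_simps)
  finally show "E (\<lambda>m y. \<Sum>J | J \<subseteq> ?B m \<and> card J = j. \<Psi> J (?B m) y)
      = \<nu> ^ j / fact j * E (\<lambda>m y. \<Psi> ?J {K..<K+j+m} y)" .
qed

end

lemma mix_commute: "A \<inter> B = {} \<Longrightarrow> mix A x (mix B y z) = mix B y (mix A x z)"
  by (auto simp: mix_def fun_eq_iff)

section \<open>Conditional variances and functionals of finite configurations\<close>

context poisson_iid
begin

lemma tame_abs: assumes "tame \<Phi>" shows "tame (\<lambda>m y. \<bar>\<Phi> m y\<bar>)"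
proof (rule tame_bound[OF assms])
  show "(\<lambda>y. \<bar>\<Phi> m y\<bar>) \<in> borel_measurable Q" for m
    using tame_measurable[OF assms, of m] by measurable
qed simp

text \<open>
  Conditionally on the coordinates outside \<open>X\<close> and \<open>X'\<close>, the variables \<open>G\<close> and \<open>G'\<close> are independent
  with the same mean, so that the expectation of their product is the second moment of that mean.
\<close>

lemma cond_variance:
  assumes G: "tame G" and G': "tame G'" and \<phi>: "\<And>m. \<phi> m \<in> borel_measurable Q"
    and \<phi>_bound: "\<And>m y. \<bar>\<phi> m y\<bar> \<le> c" and disj: "X \<inter> X' = {}"
    and \<phi>_mix: "\<And>m x y. \<phi> m (mix X x y) = \<phi> m y"
    and G'_mix: "\<And>m x y. G' m (mix X x y) = G' m y"
    and G_mix: "\<And>m x y. G m (mix X' x y) = G m y"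
    and sym: "\<And>m y. (\<integral>x. G m (mix X x y) \<partial>Q) = (\<integral>x. G' m (mix X' x y) \<partial>Q)"
  shows "\<bar>E (\<lambda>m y. \<phi> m y * G m y)\<bar> \<le> c * sqrt (E (\<lambda>m y. G m y * G' m y))"
proof -
  \<comment> \<open>\<open>U m\<close> is the conditional expectation of \<open>G m\<close> given
    the coordinates outside \<open>X\<close>.\<close>
  define U where "U m y = (\<integral>x. G m (mix X x y) \<partial>Q)" for m y
  have c0: "c \<ge> 0" using order_trans[OF abs_ge_zero \<phi>_bound[of 0 undefined]] .
  have t\<phi>: "tame \<phi>" by (rule tameI[where c=c and a=0]) (use \<phi> \<phi>_bound in auto)
  have [measurable]: "G m \<in> borel_measurable Q" for m using G by (rule tame_measurable)
  have tU: "tame U"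
  proof -
    obtain b a where "b \<ge> 0" and b: "\<And>m y. \<bar>G m y\<bar> \<le> b * (1 + real m) ^ a"
      using tame_bounded[OF G] by blast
    show ?thesis
    proof (rule tameI)
      show "U m \<in> borel_measurable Q" for m
        unfolding U_def by measurable
      fix m y
      have "\<bar>U m y\<bar> \<le> (\<integral>x. \<bar>G m (mix X x y)\<bar> \<partial>Q)" unfolding U_def by (rule integral_abs_bound)
      also have "\<dots> \<le> (\<integral>x. b * (1 + real m) ^ a \<partial>Q)"
        using b \<open>b \<ge> 0\<close> by (intro integral_mono Q.integrable_const_bound[where B="b * (1 + real m) ^ a"]) auto
      finally show "\<bar>U m y\<bar> \<le> b * (1 + real m) ^ a" by simp
    qed
  qed
  have 1: "E (\<lambda>m y. \<phi> m y * G m y) = E (\<lambda>m y. \<phi> m y * U m y)"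
  proof -
    have "(\<integral>y. \<phi> m y * G m y \<partial>Q) = (\<integral>y. \<phi> m y * U m y \<partial>Q)" for m
      using integral_mix'[OF tame_integrable_Q[OF tame_mult[OF t\<phi> G]], of m X]
      by (simp add: \<phi>_mix U_def)
    then show ?thesis by (simp add: E_eq tame_mult t\<phi> G tU)
  qed
  have U_mix: "U m (mix X' x y) = U m y" for m x y
    unfolding U_def mix_commute[OF disj] G_mix ..
  have sym': "(\<integral>x. G' m (mix X' x y) \<partial>Q) = U m y" for m y
    unfolding U_def sym ..
  \<comment> \<open>\<open>G'\<close> does not read \<open>X\<close>, so integrating
    \<open>X\<close> out replaces \<open>G\<close> by \<open>U\<close>; \<open>U\<close> does not
    read \<open>X'\<close>, so integrating \<open>X'\<close> out replaces \<open>G'\<close> by its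
    conditional mean, which is again \<open>U\<close>.\<close>
  have 2: "E (\<lambda>m y. G m y * G' m y) = E (\<lambda>m y. (U m y)\<^sup>2)"
  proof -
    have "(\<integral>y. G m y * G' m y \<partial>Q) = (\<integral>y. (U m y)\<^sup>2 \<partial>Q)" for m
    proof -
      have "(\<integral>y. G m y * G' m y \<partial>Q) = (\<integral>y. U m y * G' m y \<partial>Q)"
        using integral_mix'[OF tame_integrable_Q[OF tame_mult[OF G G']], of m X]
        by (simp add: G'_mix U_def)
      also have "\<dots> = (\<integral>y. U m y * U m y \<partial>Q)"
        using integral_mix'[OF tame_integrable_Q[OF tame_mult[OF tU G']], of m X']
        by (simp add: U_mix sym')
      finally show ?thesis by (simp add: power2_eq_square)
    qed
    then show ?thesis by (simp add: E_eq tame_mult G G' tame_power tU)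
  qed
  have "\<bar>E (\<lambda>m y. \<phi> m y * U m y)\<bar> \<le> E (\<lambda>m y. \<bar>\<phi> m y * U m y\<bar>)" by (rule E_abs_le)
  also have "\<dots> \<le> E (\<lambda>m y. c * \<bar>U m y\<bar>)"
  proof (rule E_mono)
    show "tame (\<lambda>m y. \<bar>\<phi> m y * U m y\<bar>)" "tame (\<lambda>m y. c * \<bar>U m y\<bar>)"
      by (intro tame_abs tame_mult tame_cmult t\<phi> tU)+
    show "\<bar>\<phi> m y * U m y\<bar> \<le> c * \<bar>U m y\<bar>" for m y
      using \<phi>_bound by (auto simp: abs_mult intro: mult_right_mono)
  qed
  also have "\<dots> = c * E (\<lambda>m y. \<bar>U m y\<bar>)" by (rule E_cmult)
  also have "E (\<lambda>m y. \<bar>U m y\<bar>) \<le> sqrt (E (\<lambda>m y. (U m y)\<^sup>2))"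
  proof (rule real_le_rsqrt)
    from E_square_le[OF tame_abs[OF tU]] show "(E (\<lambda>m y. \<bar>U m y\<bar>))\<^sup>2 \<le> E (\<lambda>m y. (U m y)\<^sup>2)" by simp
  qed
  finally show ?thesis unfolding 1 2 using c0 by (simp add: mult_left_mono)
qed

text \<open>The index set \<open>B\<close> names the points that form the configuration. The third
  clause allows the configuration to be stored at any block of indices, the fourth makes functionals
  of disjoint blocks independent, and the polynomial bound makes them \<open>tame\<close>.\<close>

definition functional :: "(nat set \<Rightarrow> (nat \<Rightarrow> 'b) \<Rightarrow> real) \<Rightarrow> bool" where
  "functional G \<longleftrightarrow> (\<forall>B. finite B \<longrightarrow> G B \<in> borel_measurable Q) \<and>
     (\<exists>c a. \<forall>B y. finite B \<longrightarrow> \<bar>G B y\<bar> \<le> c * (1 + real (card B)) ^ a) \<and>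
     (\<forall>\<pi> B y. inj \<pi> \<longrightarrow> G (\<pi> ` B) y = G B (y \<circ> \<pi>)) \<and>
     (\<forall>B y y'. (\<forall>i\<in>B. y i = y' i) \<longrightarrow> G B y = G B y')"

lemma functional_measurable: "functional G \<Longrightarrow> finite B \<Longrightarrow> G B \<in> borel_measurable Q"
  and functional_equi: "functional G \<Longrightarrow> inj \<pi> \<Longrightarrow> G (\<pi> ` B) y = G B (y \<circ> \<pi>)"
  and functional_cong: "functional G \<Longrightarrow> (\<And>i. i \<in> B \<Longrightarrow> y i = y' i) \<Longrightarrow> G B y = G B y'"
  unfolding functional_def by blast+

lemma functional_mix:
  assumes "functional G"
  shows "B \<inter> A = {} \<Longrightarrow> G B (mix A x y) = G B y" and "B \<subseteq> A \<Longrightarrow> G B (mix A x y) = G B x"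
proof -
  show "G B (mix A x y) = G B y" if "B \<inter> A = {}"
    using that by (intro functional_cong[OF assms]) (auto simp: mix_def)
  show "G B (mix A x y) = G B x" if "B \<subseteq> A"
    using that by (intro functional_cong[OF assms]) (auto simp: mix_def)
qed

lemma functional_bounded:
  assumes "functional G" obtains c a where "c \<ge> 0" "\<And>B y. finite B \<Longrightarrow> \<bar>G B y\<bar> \<le> c * (1 + real (card B)) ^ a"
proof -
  from assms obtain c a where *: "\<And>B y. finite B \<Longrightarrow> \<bar>G B y\<bar> \<le> c * (1 + real (card B)) ^ a"
    unfolding functional_def by blast
  from order_trans[OF abs_ge_zero *[of "{}" undefined]] have "c \<ge> 0" by simp
  with * show thesis by (rule that[rotated])
qed

lemma tame_functional:
  assumes "functional G" and B: "\<And>m. finite (B m)" "\<And>m. card (B m) \<le> s + m"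
  shows "tame (\<lambda>m y. G (B m) y)"
proof -
  obtain c a where c: "c \<ge> 0" "\<And>B y. finite B \<Longrightarrow> \<bar>G B y\<bar> \<le> c * (1 + real (card B)) ^ a"
    using functional_bounded[OF assms(1)] by metis
  show ?thesis
  proof (rule tameI)
    fix m y
    have "1 + real (card (B m)) \<le> (1 + real s) * (1 + real m)"
      using B(2)[of m] by (simp add: algebra_simps) (simp flip: of_nat_mult of_nat_add of_nat_Suc add: trans_le_add1)
    then have "c * (1 + real (card (B m))) ^ a \<le> c * ((1 + real s) * (1 + real m)) ^ a"
      using c(1) by (intro mult_left_mono power_mono) auto
    then show "\<bar>G (B m) y\<bar> \<le> (c * (1 + real s) ^ a) * (1 + real m) ^ a"
      using c(2)[OF B(1)[of m], of y] by (simp add: power_mult_distrib mult_ac)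
  qed (use functional_measurable[OF assms(1) B(1)] in auto)
qed

lemma E_functional_shift:
  assumes "functional G" shows "E (\<lambda>m y. G {K..<K+m} y) = E (\<lambda>m y. G {..<m} y)"
proof -
  have "{K..<K+m} = (\<lambda>i. i + K) ` {..<m}" for m
    by (simp add: lessThan_atLeast0 add.commute)
  then have "(\<lambda>m y. G {K..<K+m} y) = (\<lambda>m y. G {..<m} (y \<circ> (\<lambda>i. i + K)))"
    using functional_equi[OF assms, of "\<lambda>i. i + K"] by (simp add: inj_def)
  then show ?thesis
    using E_relabel[of "\<lambda>i. i + K" "\<lambda>m. G {..<m}"] tame_functional[OF assms, of lessThan 0]
    by (simp add: inj_def)
qed

lemma functional_const: "functional (\<lambda>_ _. c)"
  unfolding functional_def by (intro conjI allI impI exI[of _ "\<bar>c\<bar>"] exI[of _ "0::nat"]) simp_all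

end

section \<open>Subset counts of a Poisson process\<close>

locale ustat = poisson_iid D \<nu> for D :: "'b measure" and \<nu> +
  fixes \<kappa> :: "'b set \<Rightarrow> bool" and k :: nat
  assumes k2: "k \<ge> 2"
    and \<kappa>_meas: "\<And>I. finite I \<Longrightarrow> card I = k \<Longrightarrow> {y. \<kappa> (y ` I)} \<in> sets Q"
begin

text \<open>An infinite set has cardinality 0, so with \<open>k \<ge> 2\<close> the condition on
  \<open>card I\<close> also enforces finiteness.\<close>

definition hit :: "nat set \<Rightarrow> (nat \<Rightarrow> 'b) \<Rightarrow> bool" where
  "hit I y \<longleftrightarrow> card I = k \<and> \<kappa> (y ` I)"

definition F :: "nat set \<Rightarrow> (nat \<Rightarrow> 'b) \<Rightarrow> real" where
  "F B y = real (card {I. I \<subseteq> B \<and> hit I y})"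

abbreviation ht :: "nat set \<Rightarrow> (nat \<Rightarrow> 'b) \<Rightarrow> real" where
  "ht I y \<equiv> of_bool (hit I y)"

lemma hit_finite: "hit I y \<Longrightarrow> finite I"
  using k2 card_ge_0_finite[of I] by (auto simp: hit_def)

lemma hit_equi: "inj \<pi> \<Longrightarrow> hit (\<pi> ` I) y \<longleftrightarrow> hit I (y \<circ> \<pi>)"
  using card_image[of \<pi> I] inj_on_subset[of \<pi> UNIV I] by (simp add: hit_def image_comp)

lemma hit_cong: "(\<And>i. i \<in> I \<Longrightarrow> y i = y' i) \<Longrightarrow> hit I y \<longleftrightarrow> hit I y'"
  using image_cong[of I I y y'] by (simp add: hit_def)

lemma measurable_ht[measurable]: "(\<lambda>y. ht I y) \<in> borel_measurable Q"
proof (cases "finite I \<and> card I = k")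
  case True
  have [measurable]: "Measurable.pred Q (\<lambda>y. \<kappa> (y ` I))"
    using \<kappa>_meas[of I] True by (simp add: pred_def)
  have "(\<lambda>y. ht I y) = (\<lambda>y. if \<kappa> (y ` I) then 1 else 0)"
    using True unfolding hit_def by (intro ext) simp
  also have "\<dots> \<in> borel_measurable Q" by measurable
  finally show ?thesis .
next
  case False
  then have "\<not> hit I y" for y using hit_finite[of I y] unfolding hit_def by blast
  then show ?thesis by simp
qed

lemma F_sum: assumes "finite B" shows "F B y = (\<Sum>I\<in>Pow B. ht I y)"
proof -
  have "(\<Sum>I\<in>Pow B. ht I y) = (\<Sum>I\<in>{I \<in> Pow B. hit I y}. 1)"
    using assms by (intro sum.mono_neutral_cong_right) auto
  also have "{I \<in> Pow B. hit I y} = {I. I \<subseteq> B \<and> hit I y}" by auto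
  finally show ?thesis unfolding F_def by simp
qed

lemma F_mono: "A \<subseteq> B \<Longrightarrow> finite B \<Longrightarrow> F A y \<le> F B y"
  unfolding F_def by (auto intro!: card_mono)

lemma F_nonneg[simp]: "0 \<le> F B y"
  by (simp add: F_def)

lemma functional_F: "functional F"
  unfolding functional_def
proof (intro conjI allI impI exI)
  fix B :: "nat set" assume B: "finite B"
  have "F B = (\<lambda>y. \<Sum>I\<in>Pow B. ht I y)" using F_sum[OF B] by (intro ext)
  also have "\<dots> \<in> borel_measurable Q" by (intro borel_measurable_sum measurable_ht)
  finally show "F B \<in> borel_measurable Q" .
next
  fix B :: "nat set" and y assume B: "finite B"
  have "card {I. I \<subseteq> B \<and> hit I y} \<le> card {I. I \<subseteq> B \<and> card I = k}"
    using B by (intro card_mono) (auto simp: hit_def)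
  also have "\<dots> = card B choose k" using B by (rule n_subsets)
  also have "\<dots> \<le> card B ^ k" by (cases "k \<le> card B") (auto simp: binomial_le_pow binomial_eq_0)
  finally have "F B y \<le> real (card B) ^ k" unfolding F_def by (metis of_nat_le_iff of_nat_power)
  also have "\<dots> \<le> (1 + real (card B)) ^ k" by (rule power_mono) auto
  finally show "\<bar>F B y\<bar> \<le> 1 * (1 + real (card B)) ^ k" by simp
next
  fix \<pi> :: "nat \<Rightarrow> nat" and B y assume \<pi>: "inj \<pi>"
  have "bij_betw (image \<pi>) {I. I \<subseteq> B \<and> hit I (y \<circ> \<pi>)} {I. I \<subseteq> \<pi> ` B \<and> hit I y}"
    unfolding bij_betw_def
  proof
    show "inj_on ((`) \<pi>) {I. I \<subseteq> B \<and> hit I (y \<circ> \<pi>)}"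
      using \<pi> by (auto simp: inj_on_def inj_image_eq_iff)
    show "(`) \<pi> ` {I. I \<subseteq> B \<and> hit I (y \<circ> \<pi>)} = {I. I \<subseteq> \<pi> ` B \<and> hit I y}"
      by (auto simp: hit_equi[OF \<pi>, symmetric] subset_image_iff)
  qed
  then show "F (\<pi> ` B) y = F B (y \<circ> \<pi>)"
    unfolding F_def by (simp add: bij_betw_same_card)
next
  fix B and y y' :: "nat \<Rightarrow> 'b" assume "\<forall>i\<in>B. y i = y' i"
  then have "hit I y \<longleftrightarrow> hit I y'" if "I \<subseteq> B" for I
    using that by (intro hit_cong) auto
  then show "F B y = F B y'"
    unfolding F_def by (metis (no_types, lifting) Collect_cong)
qed

definition c0 :: real where "c0 = \<nu> ^ k / fact k"

lemma c0_pos: "c0 > 0" using \<nu>_pos by (simp add: c0_def)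

lemma tame_ht[simp]: "tame (\<lambda>m y. ht I y)"
  by (rule tameI[where c=1 and a=0]) auto

text \<open>\<open>F * G\<close> is the sum of \<open>ht J * G\<close> over the
  \<open>k\<close>-subsets \<open>J\<close>, to which Mecke's formula with \<open>K = 0\<close>
  applies.\<close>

lemma size_bias:
  assumes G: "functional G"
  shows "E (\<lambda>m y. F {..<m} y * G {..<m} y) = c0 * E (\<lambda>m y. ht {..<k} y * G {..<k+m} y)"
proof -
  obtain c a where c: "c \<ge> 0" "\<And>B y. finite B \<Longrightarrow> \<bar>G B y\<bar> \<le> c * (1 + real (card B)) ^ a"
    using functional_bounded[OF G] by metis
  have "E (\<lambda>m y. \<Sum>J | J \<subseteq> {0..<0+m} \<and> card J = k. ht J y * G {0..<0+m} y)
      = \<nu> ^ k / fact k * E (\<lambda>m y. ht {0..<0+k} y * G {0..<0+k+m} y)"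
  proof (rule mecke)
    fix J B :: "nat set" assume "finite B" "J \<subseteq> B"
    then show "(\<lambda>y. ht J y * G B y) \<in> borel_measurable Q"
      using functional_measurable[OF G, of B] by measurable
    show "\<bar>ht J y * G B y\<bar> \<le> c * (1 + real (card B)) ^ a" for y
      using c(2)[OF \<open>finite B\<close>, of y] c(1) by (cases "hit J y") auto
  next
    fix \<pi> :: "nat \<Rightarrow> nat" and J B y assume "bij \<pi>"
    then show "ht (\<pi> ` J) y * G (\<pi> ` B) y = ht J (y \<circ> \<pi>) * G B (y \<circ> \<pi>)"
      by (simp add: hit_equi functional_equi[OF G] bij_is_inj)
  qed
  moreover have "(\<Sum>J | J \<subseteq> {..<m} \<and> card J = k. ht J y * G {..<m} y) = F {..<m} y * G {..<m} y" for m y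
  proof -
    have "F {..<m} y = (\<Sum>J | J \<subseteq> {..<m} \<and> card J = k. ht J y)"
      unfolding F_sum[OF finite_lessThan] by (rule sum.mono_neutral_right) (auto simp: hit_def)
    then show ?thesis by (simp add: sum_distrib_right)
  qed
  ultimately show ?thesis by (simp add: c0_def atLeast0LessThan)
qed

text \<open>The product of the means is written with the process stored from index \<open>k\<close>
  on, where it is independent of the \<open>k\<close> added points. Subtracting it from
  \<open>size_bias\<close> leaves the change that the added points cause in
  \<open>G\<close>.\<close>

lemma covariance:
  assumes G: "functional G"
  shows "E (\<lambda>m y. F {..<m} y * G {..<m} y) - E (\<lambda>m. F {..<m}) * E (\<lambda>m. G {..<m})
    = c0 * E (\<lambda>m y. ht {..<k} y * (G {..<k+m} y - G {k..<k+m} y))"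
proof -
  have tG: "tame (\<lambda>m. G {k..<k+m})" "tame (\<lambda>m. G {..<k+m})"
    using tame_functional[OF G, of "\<lambda>m. {k..<k+m}" 0] tame_functional[OF G, of "\<lambda>m. {..<k+m}" k] by auto
  have "E (\<lambda>m. F {..<m}) = c0 * E (\<lambda>m y. ht {..<k} y)"
    using size_bias[OF functional_const, of 1] by simp
  moreover have "E (\<lambda>m y. ht {..<k} y * G {k..<k+m} y) = E (\<lambda>m y. ht {..<k} y) * E (\<lambda>m. G {k..<k+m})"
  proof (rule E_indep[where A="{..<k}"])
    show "ht {..<k} (mix {..<k} x y) = ht {..<k} x" for x y
      using hit_cong[of "{..<k}" "mix {..<k} x y" x] by (simp add: mix_def)
    show "G {k..<k+m} (mix {..<k} x y) = G {k..<k+m} y" for m x y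
      by (rule functional_mix(1)[OF G]) auto
  qed (use tG in auto)
  ultimately show ?thesis
    using tG by (simp add: size_bias[OF G] right_diff_distrib E_diff tame_mult E_functional_shift[OF G])
qed

definition \<mu> :: real where "\<mu> = E (\<lambda>m. F {..<m})"

definition v :: real where "v = E (\<lambda>m y. (F {..<m} y - \<mu>)\<^sup>2)"

lemma tame_F[simp]: "tame (\<lambda>m. F {..<m})" "tame (\<lambda>m. F {K..<K+m})" "tame (\<lambda>m. F {..<K+m})"
proof -
  show "tame (\<lambda>m. F {..<m})"
    by (rule tame_functional[OF functional_F, where B="\<lambda>m. {..<m}" and s=0]) simp_all
  show "tame (\<lambda>m. F {K..<K+m})"
    by (rule tame_functional[OF functional_F, where B="\<lambda>m. {K..<K+m}" and s=0]) simp_all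
  show "tame (\<lambda>m. F {..<K+m})"
    by (rule tame_functional[OF functional_F, where B="\<lambda>m. {..<K+m}" and s=K]) simp_all
qed

lemma variance_eq: "v = c0 * E (\<lambda>m y. ht {..<k} y * (F {..<k+m} y - F {k..<k+m} y))"
proof -
  have "(\<lambda>m y. (F {..<m} y - \<mu>)\<^sup>2) = (\<lambda>m y. (F {..<m} y * F {..<m} y - (2 * \<mu>) * F {..<m} y) + \<mu>\<^sup>2)"
    by (intro ext) (simp add: power2_eq_square algebra_simps)
  then have "v = E (\<lambda>m y. F {..<m} y * F {..<m} y) - 2 * \<mu> * \<mu> + \<mu>\<^sup>2"
    by (simp add: v_def E_add E_diff E_cmult E_const tame_diff tame_mult tame_cmult flip: \<mu>_def)
  then show ?thesis using covariance[OF functional_F] by (simp add: \<mu>_def power2_eq_square)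
qed

end

text \<open>This makes room for the independent copy of the added points, which occupies
  \<open>{k..<2*k}\<close> once the process has moved to the indices from \<open>2 * k\<close>
  on.\<close>

lemma shift_block:
  fixes k m :: nat
  defines "\<pi> \<equiv> \<lambda>i. if i < k then i else i + k"
  shows "inj \<pi>" "\<pi> ` {..<k} = {..<k}" "\<pi> ` {k..<k+m} = {2*k..<2*k+m}"
proof -
  show "inj \<pi>" by (auto simp: \<pi>_def inj_def)
  show "\<pi> ` {..<k} = {..<k}" by (auto simp: \<pi>_def image_iff)
  have "\<pi> ` {k..<k+m} = (\<lambda>i. i + k) ` {k..<k+m}" by (intro image_cong) (auto simp: \<pi>_def)
  then show "\<pi> ` {k..<k+m} = {2*k..<2*k+m}" by (simp add: image_add_atLeastLessThan' mult_2 add.commute add.left_commute)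
qed

text \<open>Exchanging the added points with their copy shows that both have the same conditional
  mean given the process.\<close>

lemma swap_blocks:
  fixes k m :: nat
  defines "\<pi> \<equiv> \<lambda>i. if i < k then i + k else if i < 2 * k then i - k else i"
  shows "inj \<pi>" "\<pi> ` {..<k} = {k..<2*k}" "\<pi> ` {2*k..<2*k+m} = {2*k..<2*k+m}"
proof -
  show "inj \<pi>" by (auto simp: \<pi>_def inj_def split: if_splits)
  have "\<pi> ` {..<k} = (\<lambda>i. i + k) ` {0..<k}"
    unfolding lessThan_atLeast0 by (intro image_cong) (auto simp: \<pi>_def)
  then show "\<pi> ` {..<k} = {k..<2*k}" by (simp add: image_add_atLeastLessThan' mult_2)
  show "\<pi> ` {2*k..<2*k+m} = {2*k..<2*k+m}"
    by (subst image_cong[OF refl, of _ _ id]) (auto simp: \<pi>_def)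
qed

context poisson_iid
begin

lemma functional_comp:
  assumes G: "functional G" and h: "h \<in> borel_measurable borel" and b: "\<And>x. \<bar>h x\<bar> \<le> b * (1 + \<bar>x\<bar>)"
  shows "functional (\<lambda>B y. h (G B y))"
proof -
  obtain c a where c: "c \<ge> 0" "\<And>B y. finite B \<Longrightarrow> \<bar>G B y\<bar> \<le> c * (1 + real (card B)) ^ a"
    using functional_bounded[OF G] by metis
  have b0: "b \<ge> 0" using order_trans[OF abs_ge_zero b[of 0]] by simp
  have "\<bar>h (G B y)\<bar> \<le> (b * (1 + c)) * (1 + real (card B)) ^ a" if "finite B" for B y
  proof -
    have "1 \<le> (1 + real (card B)) ^ a" by (rule one_le_power) simp
    then have "1 + \<bar>G B y\<bar> \<le> 1 * (1 + real (card B)) ^ a + c * (1 + real (card B)) ^ a"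
      using c(2)[OF that, of y] by linarith
    then have "b * (1 + \<bar>G B y\<bar>) \<le> b * ((1 + c) * (1 + real (card B)) ^ a)"
      using b0 by (intro mult_left_mono) (auto simp: distrib_right)
    then show ?thesis using b[of "G B y"] by (simp add: mult_ac)
  qed
  moreover have "(\<lambda>y. h (G B y)) \<in> borel_measurable Q" if "finite B" for B
    using measurable_compose[OF functional_measurable[OF G that] h] .
  moreover have "h (G (\<pi> ` B) y) = h (G B (y \<circ> \<pi>))" if "inj \<pi>" for \<pi> B y
    using functional_equi[OF G that] by simp
  moreover have "h (G B y) = h (G B y')" if "\<forall>i\<in>B. y i = y' i" for B y y'
    using functional_cong[OF G, of B y y'] that by simp
  ultimately show ?thesis unfolding functional_def by blast
qed

end

section \<open>The Stein bound for subset counts\<close>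

context ustat
begin

text \<open>This is the variable \<open>\<kappa> X * (F (\<eta> \<union> X) - F \<eta>)\<close> of
  the covariance formula, with \<open>\<eta>\<close> stored at the indices \<open>B\<close>.\<close>

definition Dl :: "nat set \<Rightarrow> nat set \<Rightarrow> (nat \<Rightarrow> 'b) \<Rightarrow> real" where
  "Dl X B y = ht X y * (F (X \<union> B) y - F B y)"

lemma Dl_equi: "inj \<pi> \<Longrightarrow> Dl (\<pi> ` X) (\<pi> ` B) y = Dl X B (y \<circ> \<pi>)"
  by (simp add: Dl_def hit_equi functional_equi[OF functional_F] flip: image_Un)

lemma Dl_cong:
  assumes "\<And>i. i \<in> X \<union> B \<Longrightarrow> y i = y' i" shows "Dl X B y = Dl X B y'"
proof -
  have "hit X y = hit X y'" using assms by (intro hit_cong) auto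
  moreover have "F (X \<union> B) y = F (X \<union> B) y'" "F B y = F B y'"
    using assms by (auto intro!: functional_cong[OF functional_F])
  ultimately show ?thesis by (simp add: Dl_def)
qed

lemma tame_Dl:
  assumes "finite X" "\<And>m. finite (B m)" "\<And>m. card (B m) \<le> s + m"
  shows "tame (\<lambda>m. Dl X (B m))"
proof -
  have "tame (\<lambda>m. F (X \<union> B m))"
  proof (rule tame_functional[OF functional_F, where B="\<lambda>m. X \<union> B m" and s="card X + s"])
    show "card (X \<union> B m) \<le> card X + s + m" for m
      using card_Un_le[of X "B m"] assms(3)[of m] by linarith
  qed (use assms in auto)
  moreover have "tame (\<lambda>m. F (B m))"
    by (rule tame_functional[OF functional_F, where B=B and s=s]) (use assms in auto)
  ultimately show ?thesis unfolding Dl_def by (intro tame_mult tame_diff tame_ht)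
qed

lemma E_Dl_relabel:
  assumes "inj \<pi>" and B: "\<And>m. \<pi> ` B m = B' m" "\<pi> ` X = X'"
    and "finite X" "\<And>m. finite (B m)" "\<And>m. card (B m) \<le> s + m"
  shows "E (\<lambda>m. Dl X' (B' m)) = E (\<lambda>m. Dl X (B m))"
  using E_relabel[OF assms(1) tame_Dl[OF assms(4-6)]]
  by (simp add: Dl_equi[OF assms(1), symmetric] B)

text \<open>By \<open>covariance\<close>, the mean of \<open>f * g f\<close> is a multiple of the
  mean increment of \<open>g f\<close> caused by \<open>k\<close> added points that form a hit.
  Expanding this increment to first order leaves the mean of \<open>g' f * (1 - a * H)\<close>,
  where \<open>a = c0 / v\<close> makes \<open>1 - a * H\<close> centred, by
  \<open>variance_eq\<close>. As \<open>g' f\<close> reads the process only,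
  \<open>cond_variance\<close> bounds this by \<open>L\<close> times the square root of a
  covariance; the Taylor remainder gives the term with \<open>L'\<close>.\<close>

lemma stein_error:
  fixes g g' :: "real \<Rightarrow> real"
  defines "f \<equiv> \<lambda>B y. (F B y - \<mu>) / sqrt v"
  defines "H \<equiv> \<lambda>m. Dl {..<k} {2*k..<2*k+m}" and "H' \<equiv> \<lambda>m. Dl {k..<2*k} {2*k..<2*k+m}"
  assumes v: "v > 0" and g: "\<And>x. (g has_real_derivative g' x) (at x)"
    and g'_bound: "\<And>x. \<bar>g' x\<bar> \<le> L" and g'_lip: "\<And>x y. \<bar>g' x - g' y\<bar> \<le> L' * \<bar>x - y\<bar>"
  shows "\<bar>E (\<lambda>m y. g' (f {..<m} y) - f {..<m} y * g (f {..<m} y))\<bar>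
    \<le> L * (c0 / v * sqrt (E (\<lambda>m y. H m y * H' m y) - E H * E H'))
      + L' * (c0 / (v * sqrt v) * E (\<lambda>m y. ht {..<k} y * (F {..<k+m} y - F {k..<k+m} y)\<^sup>2))"
proof -
  define s where "s = sqrt v"
  have s: "s > 0" "s * s = v" using v by (auto simp: s_def)
  define a where "a = c0 / v"
  have a: "a > 0" using c0_pos v by (simp add: a_def)
  let ?X = "{..<k}" and ?X' = "{k..<2*k}"
  have g'_cont: "continuous_on UNIV g'"
    by (rule lipschitz_on_continuous_on[of "\<bar>L'\<bar>"], rule lipschitz_onI)
       (use g'_lip in \<open>auto simp: dist_real_def intro: order_trans[OF g'_lip mult_right_mono]\<close>)
  have g_cont: "continuous_on UNIV g"
    using g by (intro continuous_at_imp_continuous_on ballI DERIV_isCont)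
  have mg: "g \<in> borel_measurable borel" "g' \<in> borel_measurable borel"
    using g_cont g'_cont by (auto intro: borel_measurable_continuous_onI)
  have L0: "L \<ge> 0" using order_trans[OF abs_ge_zero g'_bound[of 0]] .
  have L'0: "L' \<ge> 0" using order_trans[OF abs_ge_zero g'_lip[of 1 0]] by simp
  have fun_f: "functional f"
    unfolding f_def
  proof (rule functional_comp[OF functional_F, where h="\<lambda>x. (x - \<mu>) / sqrt v" and b="(1 + \<bar>\<mu>\<bar>) / s"])
    fix x
    have "\<bar>x - \<mu>\<bar> \<le> \<bar>x\<bar> + \<bar>\<mu>\<bar>" by simp
    also have "\<dots> \<le> (1 + \<bar>\<mu>\<bar>) * (1 + \<bar>x\<bar>)" by (simp add: algebra_simps)
    finally show "\<bar>(x - \<mu>) / sqrt v\<bar> \<le> (1 + \<bar>\<mu>\<bar>) / s * (1 + \<bar>x\<bar>)"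
      using s(1) by (simp add: s_def[symmetric] field_simps)
  qed measurable
  have fun_gf: "functional (\<lambda>B y. g (f B y))"
  proof (rule functional_comp[OF fun_f mg(1), where b="\<bar>g 0\<bar> + L"])
    fix x
    have "\<bar>g x - g 0\<bar> \<le> L * \<bar>x\<bar>"
      using field_differentiable_bound[of UNIV g g' L x 0] g g'_bound by auto
    moreover have "0 \<le> \<bar>g 0\<bar> * \<bar>x\<bar>" by simp
    moreover have "(\<bar>g 0\<bar> + L) * (1 + \<bar>x\<bar>) = \<bar>g 0\<bar> + \<bar>g 0\<bar> * \<bar>x\<bar> + L + L * \<bar>x\<bar>"
      by (simp add: algebra_simps)
    ultimately show "\<bar>g x\<bar> \<le> (\<bar>g 0\<bar> + L) * (1 + \<bar>x\<bar>)"
      using L0 by linarith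
  qed
  have fun_g'f: "functional (\<lambda>B y. g' (f B y))"
  proof (rule functional_comp[OF fun_f mg(2), where b=L])
    show "\<bar>g' x\<bar> \<le> L * (1 + \<bar>x\<bar>)" for x
      using g'_bound[of x] L0 by (simp add: algebra_simps add_increasing2)
  qed
  have t: "tame (\<lambda>m. G {K..<K+m})" "tame (\<lambda>m. G {..<m})" "tame (\<lambda>m. G {..<K+m})" if "functional G" for G K
  proof -
    show "tame (\<lambda>m. G {..<m})"
      by (rule tame_functional[OF that, where B="\<lambda>m. {..<m}" and s=0]) simp_all
    show "tame (\<lambda>m. G {K..<K+m})"
      by (rule tame_functional[OF that, where B="\<lambda>m. {K..<K+m}" and s=0]) simp_all
    show "tame (\<lambda>m. G {..<K+m})"
      by (rule tame_functional[OF that, where B="\<lambda>m. {..<K+m}" and s=K]) simp_all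
  qed
  note tf = t[OF fun_f] and tgf = t[OF fun_gf] and tg'f = t[OF fun_g'f]
  define \<Delta> where "\<Delta> m y = F {..<k+m} y - F {k..<k+m} y" for m y
  have t\<Delta>: "tame \<Delta>" unfolding \<Delta>_def[abs_def] by (intro tame_diff tame_F)
  have f\<Delta>: "f {..<k+m} y - f {k..<k+m} y = \<Delta> m y / s" for m y
    by (simp add: f_def \<Delta>_def s_def diff_divide_distrib)
  have EfG: "E (\<lambda>m y. f {..<m} y * g (f {..<m} y))
      = c0 / s * E (\<lambda>m y. ht ?X y * (g (f {..<k+m} y) - g (f {k..<k+m} y)))"
  proof -
    have "(\<lambda>m y. f {..<m} y * g (f {..<m} y))
        = (\<lambda>m y. (1 / s) * (F {..<m} y * g (f {..<m} y) - \<mu> * g (f {..<m} y)))"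
      by (intro ext) (simp add: f_def s_def diff_divide_distrib algebra_simps)
    then have "E (\<lambda>m y. f {..<m} y * g (f {..<m} y))
        = 1 / s * (E (\<lambda>m y. F {..<m} y * g (f {..<m} y)) - \<mu> * E (\<lambda>m y. g (f {..<m} y)))"
      by (simp only: E_cmult E_diff[OF tame_mult[OF tame_F(1) tgf(2)] tame_cmult[OF tgf(2)]])
    then show ?thesis using covariance[OF fun_gf] by (simp add: \<mu>_def)
  qed
  \<comment> \<open>The derivative is taken at the value without the added points, so that it
    depends on the process alone.\<close>
  define T where "T m y = g' (f {k..<k+m} y) * (\<Delta> m y / s)" for m y
  have tT: "tame T"
    unfolding T_def[abs_def] using tame_mult[OF tg'f(1) tame_cmult[OF t\<Delta>, of "1/s"]] by simp
  \<comment> \<open>This is the mean value inequality for \<open>g z - g' ?a * z\<close>, whose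
    derivative is at most \<open>L' * \<bar>z - ?a\<bar>\<close>; the division by \<open>v\<close>
    comes from two factors \<open>\<Delta> m y / s\<close>.\<close>
  have taylor: "\<bar>(g (f {..<k+m} y) - g (f {k..<k+m} y)) - T m y\<bar> \<le> L' / v * (\<Delta> m y)\<^sup>2" for m y
  proof -
    let ?a = "f {k..<k+m} y" and ?b = "f {..<k+m} y"
    have "\<bar>(g ?b - g' ?a * ?b) - (g ?a - g' ?a * ?a)\<bar> \<le> (L' * \<bar>?b - ?a\<bar>) * \<bar>?b - ?a\<bar>"
    proof -
      have "norm ((g ?b - g' ?a * ?b) - (g ?a - g' ?a * ?a)) \<le> (L' * \<bar>?b - ?a\<bar>) * norm (?b - ?a)"
      proof (rule field_differentiable_bound[where S="closed_segment ?a ?b" and f'="\<lambda>x. g' x - g' ?a"])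
        fix z assume z: "z \<in> closed_segment ?a ?b"
        show "((\<lambda>x. g x - g' ?a * x) has_field_derivative g' z - g' ?a) (at z within closed_segment ?a ?b)"
          by (rule has_field_derivative_at_within) (auto intro!: derivative_eq_intros g)
        have "\<bar>z - ?a\<bar> \<le> \<bar>?b - ?a\<bar>" using z by (auto simp: closed_segment_eq_real_ivl split: if_splits)
        then show "norm (g' z - g' ?a) \<le> L' * \<bar>?b - ?a\<bar>"
          using g'_lip[of z ?a] mult_left_mono[OF _ L'0, of "\<bar>z - ?a\<bar>" "\<bar>?b - ?a\<bar>"] by simp
      qed auto
      then show ?thesis by simp
    qed
    moreover have "(g ?b - g' ?a * ?b) - (g ?a - g' ?a * ?a) = (g ?b - g ?a) - T m y"
      by (simp add: T_def f\<Delta>[symmetric] algebra_simps)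
    moreover have "(L' * \<bar>?b - ?a\<bar>) * \<bar>?b - ?a\<bar> = L' / v * (\<Delta> m y)\<^sup>2"
      using s by (simp add: f\<Delta> abs_mult power2_eq_square)
    ultimately show ?thesis by simp
  qed
  have t1: "tame (\<lambda>m y. ht ?X y * (g (f {..<k+m} y) - g (f {k..<k+m} y)))"
    by (intro tame_mult tame_ht tame_diff tgf)
  have t2: "tame (\<lambda>m y. ht ?X y * T m y)" by (intro tame_mult tame_ht tT)
  have t3: "tame (\<lambda>m y. ht ?X y * (\<Delta> m y)\<^sup>2)" by (intro tame_mult tame_ht tame_power t\<Delta>)
  have err: "\<bar>E (\<lambda>m y. ht ?X y * (g (f {..<k+m} y) - g (f {k..<k+m} y))) - E (\<lambda>m y. ht ?X y * T m y)\<bar>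
      \<le> L' / v * E (\<lambda>m y. ht ?X y * (\<Delta> m y)\<^sup>2)"
  proof -
    have "\<bar>E (\<lambda>m y. ht ?X y * (g (f {..<k+m} y) - g (f {k..<k+m} y)) - ht ?X y * T m y)\<bar>
      \<le> E (\<lambda>m y. \<bar>ht ?X y * (g (f {..<k+m} y) - g (f {k..<k+m} y)) - ht ?X y * T m y\<bar>)"
      by (rule E_abs_le)
    also have "\<dots> \<le> E (\<lambda>m y. L' / v * (ht ?X y * (\<Delta> m y)\<^sup>2))"
    proof (rule E_mono)
      fix m y
      show "\<bar>ht ?X y * (g (f {..<k+m} y) - g (f {k..<k+m} y)) - ht ?X y * T m y\<bar>
          \<le> L' / v * (ht ?X y * (\<Delta> m y)\<^sup>2)"
        using taylor[of m y] by (cases "hit ?X y") auto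
    qed (intro tame_abs tame_diff tame_cmult t1 t2 t3)+
    finally show ?thesis by (simp only: E_diff[OF t1 t2] E_cmult)
  qed
  have HX: "ht ?X y * \<Delta> m y = Dl ?X {k..<k+m} y" for m y
    by (simp add: Dl_def \<Delta>_def ivl_disj_un_one(2))
  have cX: "finite {K..<K+m}" "card {K..<K+m} \<le> 0 + m" for K m :: nat by auto
  have tH: "tame H" "tame H'"
    unfolding H_def H'_def by (rule tame_Dl[OF _ cX]; simp)+
  \<comment> \<open>Moving the process back to the indices from \<open>k\<close> on turns
    \<open>E H\<close> into the factor of \<open>c0\<close> in \<open>variance_eq\<close>.\<close>
  have EH: "a * E H = 1"
  proof -
    have "E H = E (\<lambda>m. Dl ?X {k..<k+m})"
      unfolding H_def by (rule E_Dl_relabel[OF shift_block(1) shift_block(3) shift_block(2) _ cX]) simp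
    also have "(\<lambda>m. Dl ?X {k..<k+m}) = (\<lambda>m y. ht ?X y * \<Delta> m y)"
      by (intro ext) (simp only: HX)
    also have "E \<dots> = v / c0" using c0_pos by (simp only: variance_eq \<Delta>_def) simp
    finally show ?thesis using c0_pos v by (simp add: a_def)
  qed
  have EH': "a * E H' = 1"
  proof -
    have "E H' = E H"
      unfolding H_def H'_def
      by (rule E_Dl_relabel[OF swap_blocks(1) swap_blocks(3) swap_blocks(2) _ cX]) simp
    then show ?thesis using EH by simp
  qed
  define G where "G m y = 1 - a * H m y" for m y
  define G' where "G' m y = 1 - a * H' m y" for m y
  have tG: "tame G" "tame G'"
    unfolding G_def[abs_def] G'_def[abs_def] by (intro tame_diff tame_const tame_cmult tH)+
  define \<phi> where "\<phi> m y = g' (f {2*k..<2*k+m} y)" for m y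
  have t\<phi>: "tame \<phi>" unfolding \<phi>_def[abs_def] by (rule tg'f)
  have main: "\<bar>E (\<lambda>m y. \<phi> m y * G m y)\<bar> \<le> L * sqrt (E (\<lambda>m y. G m y * G' m y))"
  proof (rule cond_variance[OF tG, where X="?X" and X'="?X'"])
    show "\<phi> m \<in> borel_measurable Q" for m using t\<phi> by (rule tame_measurable)
    show "\<bar>\<phi> m y\<bar> \<le> L" for m y by (simp add: \<phi>_def g'_bound)
    show "?X \<inter> ?X' = {}" by auto
    show "\<phi> m (mix ?X x y) = \<phi> m y" for m x y
      unfolding \<phi>_def by (rule functional_mix(1)[OF fun_g'f]) auto
    show "G' m (mix ?X x y) = G' m y" for m x y
    proof -
      have "H' m (mix ?X x y) = H' m y"
        unfolding H'_def by (rule Dl_cong) (auto simp: mix_def)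
      then show ?thesis by (simp add: G'_def)
    qed
    show "G m (mix ?X' x y) = G m y" for m x y
    proof -
      have "H m (mix ?X' x y) = H m y"
        unfolding H_def by (rule Dl_cong) (auto simp: mix_def)
      then show ?thesis by (simp add: G_def)
    qed
    show "(\<integral>x. G m (mix ?X x y) \<partial>Q) = (\<integral>x. G' m (mix ?X' x y) \<partial>Q)" for m y
    proof -
      define \<pi> where "\<pi> i = (if i < k then i + k else if i < 2 * k then i - k else i)" for i :: nat
      have \<pi>: "inj \<pi>" "\<pi> ` ?X = ?X'" "\<pi> ` {2*k..<2*k+m} = {2*k..<2*k+m}"
        using swap_blocks(1)[of k] swap_blocks(2)[of k] swap_blocks(3)[of k m] unfolding \<pi>_def[abs_def] by auto
      have "H' m (mix ?X' x y) = H m (mix ?X (x \<circ> \<pi>) y)" for x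
      proof -
        have "H' m (mix ?X' x y) = H m (mix ?X' x y \<circ> \<pi>)"
          unfolding H_def H'_def using Dl_equi[OF \<pi>(1), of ?X "{2*k..<2*k+m}"] by (simp add: \<pi>(2,3))
        also have "\<dots> = H m (mix ?X (x \<circ> \<pi>) y)"
          unfolding H_def by (rule Dl_cong) (auto simp: mix_def \<pi>_def)
        finally show ?thesis .
      qed
      then have "(\<integral>x. G' m (mix ?X' x y) \<partial>Q) = (\<integral>x. G m (mix ?X (x \<circ> \<pi>) y) \<partial>Q)"
        by (simp add: G_def G'_def)
      also have "\<dots> = (\<integral>x. G m (mix ?X x y) \<partial>Q)"
      proof (rule integral_relabel[OF \<pi>(1)])
        have "G m \<in> borel_measurable Q" using tG(1) by (rule tame_measurable)
        then show "(\<lambda>x. G m (mix ?X x y)) \<in> borel_measurable Q" by measurable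
      qed
      finally show ?thesis ..
    qed
  qed
  \<comment> \<open>Since \<open>a * E H\<close> and \<open>a * E H'\<close> are both 1, the linear
    terms leave exactly minus the product of these two means.\<close>
  have GG': "E (\<lambda>m y. G m y * G' m y) = a\<^sup>2 * (E (\<lambda>m y. H m y * H' m y) - E H * E H')"
  proof -
    have "(\<lambda>m y. G m y * G' m y) = (\<lambda>m y. ((1 - a * H m y) - a * H' m y) + a\<^sup>2 * (H m y * H' m y))"
      by (intro ext) (simp add: G_def G'_def power2_eq_square algebra_simps)
    then have "E (\<lambda>m y. G m y * G' m y) = ((1 - a * E H) - a * E H') + a\<^sup>2 * E (\<lambda>m y. H m y * H' m y)"
      by (simp add: E_add E_diff E_cmult E_const tame_diff tame_cmult tame_mult tH)
    also have "\<dots> = a\<^sup>2 * E (\<lambda>m y. H m y * H' m y) - (a * E H) * (a * E H')"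
      using EH EH' by simp
    finally show ?thesis by (simp add: power2_eq_square algebra_simps)
  qed
  \<comment> \<open>After the process has returned to the indices from \<open>k\<close> on,
    \<open>a * g' f * H\<close> is \<open>c0 / s\<close> times the first-order term, because
    \<open>s * s = v\<close>.\<close>
  have shift: "E (\<lambda>m y. \<phi> m y * G m y) = E (\<lambda>m y. g' (f {..<m} y)) - c0 / s * E (\<lambda>m y. ht ?X y * T m y)"
  proof -
    define \<pi> where "\<pi> i = (if i < k then i else i + k)" for i :: nat
    have \<pi>: "inj \<pi>" "\<pi> ` ?X = ?X" "\<pi> ` {k..<k+m} = {2*k..<2*k+m}" for m
      using shift_block(1)[of k] shift_block(2)[of k] shift_block(3)[of k m] unfolding \<pi>_def[abs_def] by auto
    let ?\<Phi> = "\<lambda>m y. g' (f {k..<k+m} y) * (1 - a * Dl ?X {k..<k+m} y)"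
    have tD: "tame (\<lambda>m. Dl ?X {k..<k+m})" by (rule tame_Dl[OF _ cX]) simp
    have "\<phi> m y * G m y = ?\<Phi> m (y \<circ> \<pi>)" for m y
      using functional_equi[OF fun_g'f \<pi>(1), of "{k..<k+m}" y] Dl_equi[OF \<pi>(1), of ?X "{k..<k+m}" y]
      by (simp add: \<phi>_def G_def H_def \<pi>(2,3))
    then have "E (\<lambda>m y. \<phi> m y * G m y) = E ?\<Phi>"
      using E_relabel[OF \<pi>(1), of ?\<Phi>] by (simp add: tame_mult tame_diff tame_cmult tD tg'f)
    also have "?\<Phi> = (\<lambda>m y. g' (f {k..<k+m} y) - c0 / s * (ht ?X y * T m y))"
    proof (intro ext)
      fix m y
      show "?\<Phi> m y = g' (f {k..<k+m} y) - c0 / s * (ht ?X y * T m y)"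
        using s(1) unfolding HX[symmetric] T_def a_def s(2)[symmetric] by (simp add: right_diff_distrib)
    qed
    also have "E \<dots> = E (\<lambda>m y. g' (f {k..<k+m} y)) - c0 / s * E (\<lambda>m y. ht ?X y * T m y)"
      by (simp only: E_diff[OF tg'f(1) tame_cmult[OF t2]] E_cmult)
    finally show ?thesis by (simp add: E_functional_shift[OF fun_g'f])
  qed
  let ?e = "E (\<lambda>m y. ht ?X y * (g (f {..<k+m} y) - g (f {k..<k+m} y)))"
  let ?t = "E (\<lambda>m y. ht ?X y * T m y)"
  have decomp: "E (\<lambda>m y. g' (f {..<m} y) - f {..<m} y * g (f {..<m} y))
      = E (\<lambda>m y. \<phi> m y * G m y) - c0 / s * (?e - ?t)"
    by (simp add: E_diff[OF tg'f(2) tame_mult[OF tf(2) tgf(2)]] EfG shift right_diff_distrib)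
  have "\<bar>E (\<lambda>m y. g' (f {..<m} y) - f {..<m} y * g (f {..<m} y))\<bar>
      \<le> \<bar>E (\<lambda>m y. \<phi> m y * G m y)\<bar> + \<bar>c0 / s * (?e - ?t)\<bar>"
    unfolding decomp by (rule abs_triangle_ineq4)
  also have "\<dots> \<le> L * sqrt (E (\<lambda>m y. G m y * G' m y)) + c0 / s * (L' / v * E (\<lambda>m y. ht ?X y * (\<Delta> m y)\<^sup>2))"
  proof (rule add_mono[OF main])
    have cs: "0 \<le> c0 / s" using s(1) c0_pos by simp
    then have "\<bar>c0 / s * x\<bar> = c0 / s * \<bar>x\<bar>" for x by (simp only: abs_mult abs_of_nonneg)
    then show "\<bar>c0 / s * (?e - ?t)\<bar> \<le> c0 / s * (L' / v * E (\<lambda>m y. ht ?X y * (\<Delta> m y)\<^sup>2))"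
      using mult_left_mono[OF err cs] by (simp only:)
  qed
  also have "sqrt (E (\<lambda>m y. G m y * G' m y)) = c0 / v * sqrt (E (\<lambda>m y. H m y * H' m y) - E H * E H')"
    unfolding GG' real_sqrt_mult real_sqrt_abs using a by (simp only: a_def abs_of_pos)
  also have "c0 / s * (L' / v * x) = L' * (c0 / (v * sqrt v) * x)" for x
    by (simp add: s_def mult_ac)
  finally show ?thesis unfolding \<Delta>_def .
qed

end

section \<open>Local counts\<close>

lemma sum_Pow_Un:
  fixes \<phi> :: "'i set \<Rightarrow> real"
  assumes "finite X" "finite B" "X \<inter> B = {}"
  shows "(\<Sum>I\<in>Pow (X \<union> B). \<phi> I) = (\<Sum>A\<in>Pow X. \<Sum>J\<in>Pow B. \<phi> (A \<union> J))"
proof -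
  have "bij_betw (\<lambda>(A, J). A \<union> J) (Pow X \<times> Pow B) (Pow (X \<union> B))"
  proof (rule bij_betw_byWitness[where f'="\<lambda>I. (I \<inter> X, I \<inter> B)"])
    show "\<forall>p\<in>Pow X \<times> Pow B. (\<lambda>I. (I \<inter> X, I \<inter> B)) (case p of (A, J) \<Rightarrow> A \<union> J) = p"
      using assms(3) by auto
  qed auto
  from sum.reindex_bij_betw[OF this, of \<phi>]
  show ?thesis by (simp add: sum.cartesian_product case_prod_beta')
qed

text \<open>It is not known whether \<open>x\<close> is below or above 1, so an intermediate power
  is bounded by the two extreme ones together.\<close>

lemma power_le_add_power:
  fixes x :: real
  assumes "0 \<le> x" "a \<le> e" "e \<le> b" shows "x ^ e \<le> x ^ a + x ^ b"
proof (cases "x \<le> 1")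
  case True
  then have "x ^ e \<le> x ^ a" using assms by (intro power_decreasing) auto
  then show ?thesis using assms(1) by (simp add: add_increasing2)
next
  case False
  then have "x ^ e \<le> x ^ b" using assms by (intro power_increasing) auto
  then show ?thesis using assms(1) by (simp add: add_increasing)
qed

text \<open>The square of a count of small sets becomes a count of larger sets, to which Mecke's
  formula applies: \<open>(U, V)\<close> is sent to \<open>U \<union> V\<close>, and a set of at
  most \<open>2 * a\<close> elements has at most \<open>4 ^ (2 * a)\<close> pairs of
  subsets.\<close>

lemma card_pairs_le:
  assumes "finite B" and P: "\<And>U V. P U \<Longrightarrow> P V \<Longrightarrow> P (U \<union> V)"
  shows "card {U. U \<subseteq> B \<and> card U \<le> a \<and> P U} ^ 2 \<le> 4 ^ (2 * a) * card {U. U \<subseteq> B \<and> card U \<le> 2 * a \<and> P U}"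
proof -
  let ?S = "\<lambda>a. {U. U \<subseteq> B \<and> card U \<le> a \<and> P U}"
  have fin: "finite (?S a)" for a using assms(1) by (auto intro: finite_subset[of _ "Pow B"])
  have "card (?S a) ^ 2 = card (?S a \<times> ?S a)" by (simp add: card_cartesian_product power2_eq_square)
  also have "\<dots> \<le> card (SIGMA U:?S (2 * a). Pow U \<times> Pow U)"
  proof (rule card_inj_on_le)
    show "inj_on (\<lambda>(U, V). (U \<union> V, U, V)) (?S a \<times> ?S a)" by (auto simp: inj_on_def)
    show "(\<lambda>(U, V). (U \<union> V, U, V)) ` (?S a \<times> ?S a) \<subseteq> (SIGMA U:?S (2 * a). Pow U \<times> Pow U)"
    proof clarsimp
      fix U V assume "U \<subseteq> B" "V \<subseteq> B" "card U \<le> a" "card V \<le> a" "P U" "P V"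
      then show "card (U \<union> V) \<le> 2 * a \<and> P (U \<union> V)"
        using card_Un_le[of U V] P[of U V] by simp
    qed
    show "finite (SIGMA U:?S (2 * a). Pow U \<times> Pow U)"
      using fin assms(1) by (intro finite_SigmaI) (auto intro: finite_subset)
  qed
  also have "\<dots> = (\<Sum>U\<in>?S (2 * a). card (Pow U \<times> Pow U))"
    using fin assms(1) by (intro card_SigmaI) (auto intro: finite_subset)
  also have "\<dots> \<le> (\<Sum>U\<in>?S (2 * a). 4 ^ (2 * a))"
  proof (rule sum_mono)
    fix U assume "U \<in> ?S (2 * a)"
    then have U: "finite U" "card U \<le> 2 * a" using assms(1) finite_subset by auto
    have "card (Pow U \<times> Pow U) = 4 ^ card U"
      using U(1) by (simp add: card_cartesian_product card_Pow flip: power_mult_distrib)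
    also have "\<dots> \<le> 4 ^ (2 * a)" using U(2) by (intro power_increasing) auto
    finally show "card (Pow U \<times> Pow U) \<le> 4 ^ (2 * a)" .
  qed
  finally show ?thesis by (simp add: mult.commute)
qed

text \<open>The radius \<open>4 * \<rho>\<close> comes from the covariance estimate, in which a
  point is joined to point 0 by a chain of up to four overlapping hits, each of diameter at most
  \<open>\<rho>\<close>.\<close>

locale local_ustat = ustat D \<nu> \<kappa> k
  for D :: "('b :: {metric_space, second_countable_topology}) measure" and \<nu> \<kappa> k +
  fixes \<rho> \<beta> :: real
  assumes sets_D[measurable_cong]: "sets D = sets borel"
    and \<kappa>_local: "\<And>V x y. \<kappa> V \<Longrightarrow> x \<in> V \<Longrightarrow> y \<in> V \<Longrightarrow> dist x y \<le> \<rho>"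
    and ball_D: "\<And>x. measure D (cball x (4 * \<rho>)) \<le> \<beta>"
begin

lemma hit_local: "hit I y \<Longrightarrow> i \<in> I \<Longrightarrow> j \<in> I \<Longrightarrow> dist (y i) (y j) \<le> \<rho>"
  using \<kappa>_local[of "y ` I" "y i" "y j"] by (simp add: hit_def)

lemma \<beta>_nonneg: "0 \<le> \<beta>"
  using order_trans[OF measure_nonneg ball_D] .

text \<open>All points are compared with point 0 only, so that given its position the conditions on
  the other points are independent, each of probability at most \<open>\<beta>\<close>.\<close>

definition loc :: "nat set \<Rightarrow> (nat \<Rightarrow> 'b) \<Rightarrow> bool" where
  "loc T y \<longleftrightarrow> (\<forall>i\<in>T. dist (y i) (y 0) \<le> 4 * \<rho>)"

lemma measurable_coord: "(\<lambda>y. y i) \<in> measurable Q borel"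
  using measurable_component_Q[of i] by (simp add: measurable_cong_sets[OF refl sets_D])

lemma measurable_loc[measurable]: "finite T \<Longrightarrow> Measurable.pred Q (loc T)"
proof -
  assume "finite T"
  have "(\<lambda>y. dist (y i) (y 0)) \<in> borel_measurable Q" for i
    by (intro borel_measurable_dist measurable_coord)
  then have "Measurable.pred Q (\<lambda>y. dist (y i) (y 0) \<le> 4 * \<rho>)" for i
    by measurable
  then show "Measurable.pred Q (loc T)"
    unfolding loc_def[abs_def] using \<open>finite T\<close> by (intro pred_intros_finite) auto
qed

lemma measurable_of_bool_loc:
  "finite T \<Longrightarrow> (\<lambda>y. of_bool (loc T y) :: real) \<in> borel_measurable Q"
proof -
  assume "finite T"
  then have [measurable]: "Measurable.pred Q (loc T)" by (rule measurable_loc)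
  have "(\<lambda>y. of_bool (loc T y) :: real) = (\<lambda>y. if loc T y then 1 else 0)" by auto
  also have "\<dots> \<in> borel_measurable Q" by measurable
  finally show "(\<lambda>y. of_bool (loc T y) :: real) \<in> borel_measurable Q" .
qed

lemma prob_loc:
  assumes S: "finite S" "0 \<in> S"
  shows "(\<integral>y. of_bool (loc S y) \<partial>Q) \<le> \<beta> ^ (card S - 1)"
proof -
  let ?f = "\<lambda>y. of_bool (loc S y) :: real"
  have int: "integrable Q ?f"
    using measurable_of_bool_loc[OF S(1)] by (intro Q.integrable_const_bound[where B=1]) auto
  have inner: "(\<integral>y. ?f (mix {0} x y) \<partial>Q) \<le> \<beta> ^ (card S - 1)" for x
  proof -
    let ?C = "cball (x 0) (4 * \<rho>)"
    let ?e = "prod_emb UNIV (\<lambda>_. D) (S - {0}) (Pi\<^sub>E (S - {0}) (\<lambda>_. ?C))"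
    have C: "?C \<in> sets D" by (simp add: sets_D)
    have e: "?e \<in> sets Q"
      unfolding Q_def using S C by (intro sets_PiM_I) auto
    have "(\<integral>y. ?f (mix {0} x y) \<partial>Q) \<le> (\<integral>y. indicator ?e y \<partial>Q)"
    proof (rule integral_mono)
      show "integrable Q (\<lambda>y. ?f (mix {0} x y))"
      proof (intro Q.integrable_const_bound[where B=1])
        have "(\<lambda>y. mix {0} x y) \<in> measurable Q Q" by (rule measurable_mix'[of "\<lambda>_. x"]) auto
        from measurable_compose[OF this measurable_of_bool_loc[OF S(1)]]
        show "(\<lambda>y. ?f (mix {0} x y)) \<in> borel_measurable Q" .
      qed simp
      show "integrable Q (indicator ?e :: _ \<Rightarrow> real)"
        by (intro Q.integrable_const_bound[where B=1] borel_measurable_indicator e) auto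
      show "?f (mix {0} x y) \<le> indicator ?e y" for y
        using S by (auto simp: loc_def mix_def prod_emb_def space_D indicator_def dist_commute)
    qed
    also have "\<dots> = measure Q ?e" using e by simp
    also have "\<dots> = (\<Prod>i\<in>S - {0}. measure D ?C)"
      unfolding Q_def using S C by (intro P.measure_PiM_emb) auto
    also have "\<dots> \<le> (\<Prod>i\<in>S - {0}. \<beta>)"
      using ball_D by (intro prod_mono) auto
    finally show ?thesis using S by simp
  qed
  have "(\<integral>y. ?f y \<partial>Q) = (\<integral>x. (\<integral>y. ?f (mix {0} x y) \<partial>Q) \<partial>Q)" by (rule integral_mix[OF int])
  also have "\<dots> \<le> (\<integral>x. \<beta> ^ (card S - 1) \<partial>Q)"
    using QQ.integrable_fst'[OF integrable_mix[OF int, of "{0}"]] inner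
    by (intro integral_mono) auto
  finally show ?thesis by simp
qed

definition nl :: "nat \<Rightarrow> nat set \<Rightarrow> (nat \<Rightarrow> 'b) \<Rightarrow> real" where
  "nl i B y = (\<Sum>J | J \<subseteq> B \<and> card J = i. of_bool (loc J y))"

lemma nl_nonneg: "0 \<le> nl i B y"
  unfolding nl_def by (intro sum_nonneg) auto

lemma tame_nl: "tame (\<lambda>m. nl i {K..<K+m})"
proof (rule tameI)
  fix m
  show "nl i {K..<K+m} \<in> borel_measurable Q"
    unfolding nl_def[abs_def]
    by (intro borel_measurable_sum measurable_of_bool_loc) (auto intro: finite_subset)
  fix y
  have "nl i {K..<K+m} y \<le> (\<Sum>J | J \<subseteq> {K..<K+m} \<and> card J = i. 1)"
    unfolding nl_def by (intro sum_mono) auto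
  also have "\<dots> = real (m choose i)" using n_subsets[of "{K..<K+m}" i] by simp
  also have "\<dots> \<le> (1 + real m) ^ i"
  proof -
    have "m choose i \<le> m ^ i" by (cases "i \<le> m") (auto simp: binomial_le_pow binomial_eq_0)
    then have "real (m choose i) \<le> real m ^ i" by (metis of_nat_le_iff of_nat_power)
    also have "\<dots> \<le> (1 + real m) ^ i" by (rule power_mono) auto
    finally show ?thesis .
  qed
  finally show "\<bar>nl i {K..<K+m} y\<bar> \<le> 1 * (1 + real m) ^ i" using nl_nonneg[of i "{K..<K+m}" y] by simp
qed

lemma tame_of_bool_loc: "finite T \<Longrightarrow> tame (\<lambda>m y. of_bool (loc T y))"
  by (rule tameI[where c=1 and a=0]) (auto intro: measurable_of_bool_loc)

text \<open>Mecke's formula with the first \<open>s\<close> points as further points turns the sum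
  into the event that \<open>s + i\<close> points are local, hence the exponent
  \<open>s + i - 1\<close>. The assumption \<open>s \<ge> 1\<close> keeps index 0, the centre of
  \<open>loc\<close>, fixed by the permutations in \<open>equi\<close>.\<close>

lemma E_loc_count:
  assumes s: "s \<ge> 1"
  shows "E (\<lambda>m y. of_bool (loc {..<s} y) * nl i {s..<s+m} y) \<le> \<nu> ^ i * \<beta> ^ (s + i - 1)"
proof -
  have "E (\<lambda>m y. \<Sum>J | J \<subseteq> {s..<s+m} \<and> card J = i. of_bool (loc {..<s} y) * of_bool (loc J y))
    = \<nu> ^ i / fact i * E (\<lambda>m y. of_bool (loc {..<s} y) * of_bool (loc {s..<s+i} y))"
  proof (rule mecke[where c=1 and a=0])
    fix J B :: "nat set" assume "finite B" "J \<subseteq> B"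
    then have "finite J" by (rule finite_subset[rotated])
    then show "(\<lambda>y. of_bool (loc {..<s} y) * of_bool (loc J y) :: real) \<in> borel_measurable Q"
      by (intro borel_measurable_times measurable_of_bool_loc) auto
    show "\<bar>of_bool (loc {..<s} y) * of_bool (loc J y) :: real\<bar> \<le> 1 * (1 + real (card B)) ^ 0" for y
      by simp
  next
    fix \<pi> :: "nat \<Rightarrow> nat" and J B :: "nat set" and y assume \<pi>: "\<And>i. i < s \<Longrightarrow> \<pi> i = i"
    have "loc {..<s} y = loc {..<s} (y \<circ> \<pi>)" "loc (\<pi> ` J) y = loc J (y \<circ> \<pi>)"
      using \<pi> s by (auto simp: loc_def)
    then show "of_bool (loc {..<s} y) * of_bool (loc (\<pi> ` J) y)
        = (of_bool (loc {..<s} (y \<circ> \<pi>)) * of_bool (loc J (y \<circ> \<pi>)) :: real)" by simp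
  qed
  also have "(\<lambda>m y. of_bool (loc {..<s} y) * of_bool (loc {s..<s+i} y) :: real)
      = (\<lambda>m y. of_bool (loc {..<s+i} y))"
  proof (intro ext)
    fix m :: nat and y
    have "{..<s+i} = {..<s} \<union> {s..<s+i}" by auto
    then have "loc {..<s+i} y \<longleftrightarrow> loc {..<s} y \<and> loc {s..<s+i} y" by (auto simp: loc_def)
    then show "of_bool (loc {..<s} y) * of_bool (loc {s..<s+i} y) = (of_bool (loc {..<s+i} y) :: real)" by simp
  qed
  finally have eq: "E (\<lambda>m y. of_bool (loc {..<s} y) * nl i {s..<s+m} y)
      = \<nu> ^ i / fact i * E (\<lambda>m y. of_bool (loc {..<s+i} y))"
    by (simp only: nl_def sum_distrib_left)
  have "E (\<lambda>m y. of_bool (loc {..<s+i} y)) \<le> \<beta> ^ (s + i - 1)"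
    using prob_loc[of "{..<s+i}"] s by (subst E_eq[OF tame_of_bool_loc]) auto
  then have "E (\<lambda>m y. of_bool (loc {..<s} y) * nl i {s..<s+m} y) \<le> \<nu> ^ i / fact i * \<beta> ^ (s + i - 1)"
    unfolding eq using \<nu>_pos by (intro mult_left_mono) auto
  also have "\<dots> \<le> \<nu> ^ i * \<beta> ^ (s + i - 1)"
  proof -
    have "\<nu> ^ i / fact i \<le> \<nu> ^ i / 1" using \<nu>_pos by (intro divide_left_mono) (auto simp: fact_ge_1)
    then show ?thesis using \<beta>_nonneg by (intro mult_right_mono) auto
  qed
  finally show ?thesis .
qed

definition cl :: "nat \<Rightarrow> nat set \<Rightarrow> (nat \<Rightarrow> 'b) \<Rightarrow> nat" where
  "cl a B y = card {U. U \<subseteq> B \<and> card U \<le> a \<and> loc U y}"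

lemma cl_sum:
  assumes "finite B" shows "real (cl a B y) = (\<Sum>i\<le>a. nl i B y)"
proof -
  have fin: "finite {U. U \<subseteq> B \<and> P U}" for P using assms by (auto intro: finite_subset[of _ "Pow B"])
  have "{U. U \<subseteq> B \<and> card U \<le> a \<and> loc U y} = (\<Union>i\<in>{..a}. {U. U \<subseteq> B \<and> card U = i \<and> loc U y})" by auto
  then have "cl a B y = (\<Sum>i\<le>a. card {U. U \<subseteq> B \<and> card U = i \<and> loc U y})"
    unfolding cl_def by (simp only:) (rule card_UN_disjoint, use fin in auto)
  moreover have "real (card {U. U \<subseteq> B \<and> card U = i \<and> loc U y}) = nl i B y" for i
  proof -
    have "nl i B y = (\<Sum>J | J \<subseteq> B \<and> card J = i \<and> loc J y. 1)"
      unfolding nl_def using fin[of "\<lambda>U. card U = i"] by (intro sum.mono_neutral_cong_right) auto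
    then show ?thesis by simp
  qed
  ultimately show ?thesis by simp
qed

text \<open>A set in \<open>S\<close> is determined by its traces on \<open>X\<close> and on
  \<open>B\<close>, and the former takes at most \<open>2 ^ card X\<close> values.\<close>

lemma card_le_cl:
  assumes "finite X" "finite B" "\<And>I. I \<in> S \<Longrightarrow> I \<subseteq> X \<union> B \<and> card (I \<inter> B) \<le> a \<and> loc (I \<inter> B) y"
  shows "card S \<le> 2 ^ card X * cl a B y"
proof -
  let ?V = "{U. U \<subseteq> B \<and> card U \<le> a \<and> loc U y}"
  have fin: "finite ?V" using assms(2) by (auto intro: finite_subset[of _ "Pow B"])
  have "card S \<le> card (Pow X \<times> ?V)"
  proof (rule card_inj_on_le)
    show "inj_on (\<lambda>I. (I \<inter> X, I \<inter> B)) S"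
    proof (rule inj_onI)
      fix I I' assume "I \<in> S" "I' \<in> S" "(I \<inter> X, I \<inter> B) = (I' \<inter> X, I' \<inter> B)"
      then show "I = I'" using assms(3)[of I] assms(3)[of I'] by blast
    qed
    show "(\<lambda>I. (I \<inter> X, I \<inter> B)) ` S \<subseteq> Pow X \<times> ?V" using assms(3) by auto
    show "finite (Pow X \<times> ?V)" using fin assms(1) by simp
  qed
  then show ?thesis using assms(1) by (simp add: card_cartesian_product card_Pow cl_def)
qed

lemma F_diff:
  assumes "finite X" "finite B"
  shows "F (X \<union> B) y - F B y = real (card {I. I \<subseteq> X \<union> B \<and> hit I y \<and> \<not> I \<subseteq> B})"
proof -
  have fin: "finite {I. I \<subseteq> X \<union> B \<and> P I}" for P using assms by (auto intro: finite_subset[of _ "Pow (X \<union> B)"])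
  have "{I. I \<subseteq> X \<union> B \<and> hit I y} = {I. I \<subseteq> B \<and> hit I y} \<union> {I. I \<subseteq> X \<union> B \<and> hit I y \<and> \<not> I \<subseteq> B}" by auto
  then have "card {I. I \<subseteq> X \<union> B \<and> hit I y}
      = card {I. I \<subseteq> B \<and> hit I y} + card {I. I \<subseteq> X \<union> B \<and> hit I y \<and> \<not> I \<subseteq> B}"
    using fin assms by (simp only:) (rule card_Un_disjoint, auto)
  then show ?thesis by (simp add: F_def)
qed

lemma dist_chain: "dist a b \<le> r \<Longrightarrow> dist b c \<le> s \<Longrightarrow> dist a c \<le> r + s" for a b c :: 'b
  using dist_triangle[of a c b] by linarith

text \<open>If \<open>X\<close> is a hit, any hit that meets \<open>X\<close> has at most
  \<open>k - 1\<close> points outside it, all within \<open>2 * \<rho>\<close> of point 0, so the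
  difference of the counts is at most \<open>2 ^ k * cl (k - 1)\<close>. By
  \<open>card_pairs_le\<close> its square is bounded by a count of local sets of up to
  \<open>2 * k - 2\<close> points, and those of \<open>l\<close> points contribute at most
  \<open>\<beta> ^ (k - 1) * (\<nu> * \<beta>) ^ l\<close>.\<close>

lemma second_bound:
  "E (\<lambda>m y. ht {..<k} y * (F {..<k+m} y - F {k..<k+m} y)\<^sup>2)
    \<le> 4 ^ (3 * k) * (2 * real k) * (\<beta> ^ (k - 1) * (1 + (\<nu> * \<beta>) ^ (2 * k - 2)))"
proof -
  let ?X = "{..<k}" and ?B = "\<lambda>m. {k..<k+m}"
  have k0: "0 \<in> ?X" using k2 by auto
  have pt: "ht ?X y * (F {..<k+m} y - F (?B m) y)\<^sup>2
      \<le> 4 ^ (3 * k) * (\<Sum>l\<le>2*(k-1). of_bool (loc ?X y) * nl l (?B m) y)" for m y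
  proof (cases "hit ?X y")
    case True
    have d: "dist (y i) (y 0) \<le> \<rho>" if "i \<in> ?X" for i using hit_local[OF True that k0] .
    have \<rho>0: "0 \<le> \<rho>" using d[OF k0] by simp
    have locX: "loc ?X y" using d \<rho>0 by (force simp: loc_def)
    let ?S = "{I. I \<subseteq> ?X \<union> ?B m \<and> hit I y \<and> \<not> I \<subseteq> ?B m}"
    have "card ?S \<le> 2 ^ card ?X * cl (k - 1) (?B m) y"
    proof (rule card_le_cl)
      fix I assume "I \<in> ?S"
      then have I: "I \<subseteq> ?X \<union> ?B m" "hit I y" "\<not> I \<subseteq> ?B m" by auto
      then obtain x where x: "x \<in> I" "x \<in> ?X" by auto
      have "I \<inter> ?B m \<subset> I" using I by auto
      then have "card (I \<inter> ?B m) < k" using psubset_card_mono[OF hit_finite[OF I(2)]] I(2) by (simp add: hit_def)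
      moreover have "dist (y i) (y 0) \<le> 4 * \<rho>" if "i \<in> I" for i
        using dist_chain[OF hit_local[OF I(2) that x(1)] d[OF x(2)]] \<rho>0 by simp
      ultimately show "I \<subseteq> ?X \<union> ?B m \<and> card (I \<inter> ?B m) \<le> k - 1 \<and> loc (I \<inter> ?B m) y"
        using I by (auto simp: loc_def)
    qed auto
    then have "card ?S ^ 2 \<le> (2 ^ k * cl (k - 1) (?B m) y) ^ 2" by (intro power_mono) auto
    also have "\<dots> = (2 * 2) ^ k * cl (k - 1) (?B m) y ^ 2"
      unfolding power_mult_distrib power2_eq_square by simp
    also have "\<dots> \<le> (2 * 2) ^ k * (4 ^ (2 * (k - 1)) * cl (2 * (k - 1)) (?B m) y)"
      unfolding cl_def by (intro mult_left_mono card_pairs_le) (auto simp: loc_def)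
    also have "\<dots> = 4 ^ (k + 2 * (k - 1)) * cl (2 * (k - 1)) (?B m) y"
      by (simp only: power_add mult.assoc) simp
    also have "\<dots> \<le> 4 ^ (3 * k) * cl (2 * (k - 1)) (?B m) y"
      by (intro mult_right_mono power_increasing) auto
    finally have "real (card ?S ^ 2) \<le> real (4 ^ (3 * k) * cl (2 * (k - 1)) (?B m) y)"
      by (simp only: of_nat_le_iff)
    then have "(real (card ?S))\<^sup>2 \<le> 4 ^ (3 * k) * (\<Sum>l\<le>2*(k-1). nl l (?B m) y)"
      by (simp add: cl_sum)
    moreover have "F {..<k+m} y - F (?B m) y = real (card ?S)"
      using F_diff[of ?X "?B m" y] by (simp add: ivl_disj_un_one(2))
    ultimately show ?thesis using True locX by simp
  next
    case False
    then show ?thesis by (auto intro!: mult_nonneg_nonneg sum_nonneg nl_nonneg)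
  qed
  have tl: "tame (\<lambda>m y. of_bool (loc ?X y) * nl l (?B m) y)" for l
    by (intro tame_mult tame_of_bool_loc tame_nl) simp
  have "E (\<lambda>m y. ht ?X y * (F {..<k+m} y - F (?B m) y)\<^sup>2)
      \<le> E (\<lambda>m y. 4 ^ (3 * k) * (\<Sum>l\<le>2*(k-1). of_bool (loc ?X y) * nl l (?B m) y))"
    by (intro E_mono pt tame_mult tame_ht tame_power tame_diff tame_F tame_cmult tame_sum tl)
  also have "\<dots> = 4 ^ (3 * k) * (\<Sum>l\<le>2*(k-1). E (\<lambda>m y. of_bool (loc ?X y) * nl l (?B m) y))"
    by (simp only: E_cmult E_sum[OF tl])
  also have "\<dots> \<le> 4 ^ (3 * k) * (\<Sum>l\<le>2*(k-1). \<beta> ^ (k - 1) * (1 + (\<nu> * \<beta>) ^ (2 * k - 2)))"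
  proof (intro mult_left_mono sum_mono)
    fix l assume l: "l \<in> {..2*(k-1)}"
    have "E (\<lambda>m y. of_bool (loc ?X y) * nl l (?B m) y) \<le> \<nu> ^ l * \<beta> ^ (k + l - 1)"
      using k2 by (intro E_loc_count) auto
    also have "k + l - 1 = (k - 1) + l" using k2 by simp
    also have "\<nu> ^ l * \<beta> ^ ((k - 1) + l) = \<beta> ^ (k - 1) * (\<nu> * \<beta>) ^ l"
      by (simp add: power_add power_mult_distrib)
    also have "\<dots> \<le> \<beta> ^ (k - 1) * (1 + (\<nu> * \<beta>) ^ (2 * k - 2))"
      using power_le_add_power[of "\<nu> * \<beta>" 0 l "2 * k - 2"] l \<nu>_pos \<beta>_nonneg
      by (intro mult_left_mono) (auto simp: diff_mult_distrib2)
    finally show "E (\<lambda>m y. of_bool (loc ?X y) * nl l (?B m) y) \<le> \<beta> ^ (k - 1) * (1 + (\<nu> * \<beta>) ^ (2 * k - 2))" .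
  qed simp
  also have "\<dots> = 4 ^ (3 * k) * (real (2 * (k - 1) + 1) * (\<beta> ^ (k - 1) * (1 + (\<nu> * \<beta>) ^ (2 * k - 2))))"
    by simp
  also have "\<dots> \<le> 4 ^ (3 * k) * ((2 * real k) * (\<beta> ^ (k - 1) * (1 + (\<nu> * \<beta>) ^ (2 * k - 2))))"
  proof (intro mult_left_mono mult_right_mono)
    show "real (2 * (k - 1) + 1) \<le> 2 * real k" using k2 by (simp add: of_nat_diff)
  qed (use \<nu>_pos \<beta>_nonneg in auto)
  finally show ?thesis by (simp only: mult.assoc)
qed

text \<open>The hits in \<open>X \<union> B\<close> are sorted by their trace \<open>A\<close> on
  \<open>X\<close>; those with empty trace make up \<open>F B\<close>, which cancels.\<close>

lemma Dl_expand:
  assumes B: "finite B" "{..<k} \<inter> B = {}"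
  shows "Dl {..<k} B y = (\<Sum>A\<in>Pow {..<k} - {{}}. \<Sum>J | J \<subseteq> B \<and> card J = k - card A.
    ht {..<k} y * ht (A \<union> J) y)"
proof -
  let ?X = "{..<k}"
  have inner: "(\<Sum>J\<in>Pow B. ht (A \<union> J) y) = (\<Sum>J | J \<subseteq> B \<and> card J = k - card A. ht (A \<union> J) y)"
    if A: "A \<subseteq> ?X" for A
  proof (rule sum.mono_neutral_right)
    show "\<forall>J\<in>Pow B - {J. J \<subseteq> B \<and> card J = k - card A}. ht (A \<union> J) y = 0"
    proof
      fix J assume J: "J \<in> Pow B - {J. J \<subseteq> B \<and> card J = k - card A}"
      then have "card (A \<union> J) = card A + card J"
        using A B finite_subset[OF A] finite_subset[of J B] by (intro card_Un_disjoint) auto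
      then have "card (A \<union> J) \<noteq> k" using J by auto
      then show "ht (A \<union> J) y = 0" by (simp add: hit_def)
    qed
  qed (use B in auto)
  have "F (?X \<union> B) y = (\<Sum>A\<in>Pow ?X. \<Sum>J\<in>Pow B. ht (A \<union> J) y)"
    using B by (simp only: F_sum[of "?X \<union> B"] finite_Un finite_lessThan) (rule sum_Pow_Un, auto)
  also have "\<dots> = F B y + (\<Sum>A\<in>Pow ?X - {{}}. \<Sum>J\<in>Pow B. ht (A \<union> J) y)"
    using B(1) by (subst sum.remove[of _ "{}"]) (auto simp only: F_sum finite_Pow_iff finite_lessThan Pow_bottom Un_empty_left)
  also have "(\<Sum>A\<in>Pow ?X - {{}}. \<Sum>J\<in>Pow B. ht (A \<union> J) y)
      = (\<Sum>A\<in>Pow ?X - {{}}. \<Sum>J | J \<subseteq> B \<and> card J = k - card A. ht (A \<union> J) y)"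
    by (intro sum.cong inner) auto
  finally show ?thesis unfolding Dl_def by (simp only: add_diff_cancel_left' sum_distrib_left)
qed

text \<open>Adding the block \<open>J\<close> to the process changes \<open>Dl X'\<close> only
  through hits that meet both \<open>X'\<close> and \<open>J\<close>. One such hit, together with
  the hits \<open>X\<close>, \<open>A \<union> J\<close> and \<open>X'\<close>, ties all
  \<open>2 * k + j\<close> points to point 0; and each such hit has at least two points in
  \<open>X'\<close> and \<open>J\<close>, hence at most \<open>k - 2\<close> in the rest of the
  process.\<close>

lemma Dl_cross:
  assumes A: "A \<subseteq> {..<k}" "A \<noteq> {}"
  shows "ht {..<k} y * ht (A \<union> {2*k..<2*k+j}) y *
      (Dl {k..<2*k} {2*k..<2*k+j+m} y - Dl {k..<2*k} {2*k+j..<2*k+j+m} y)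
    \<le> 2 ^ (k + j) * (\<Sum>i\<le>k-2. of_bool (loc {..<2*k+j} y) * nl i {2*k+j..<2*k+j+m} y)"
proof -
  let ?X = "{..<k}" and ?X' = "{k..<2*k}" and ?J = "{2*k..<2*k+j}" and ?B = "{2*k+j..<2*k+j+m}"
  have k0: "0 \<in> ?X" using k2 by auto
  define S where "S = {I. I \<subseteq> ?X' \<union> (?J \<union> ?B) \<and> hit I y \<and> I \<inter> ?X' \<noteq> {} \<and> I \<inter> ?J \<noteq> {}}"
  have JB: "{2*k..<2*k+j+m} = ?J \<union> ?B" by auto
  have diff: "Dl ?X' {2*k..<2*k+j+m} y - Dl ?X' ?B y = ht ?X' y * real (card S)"
  proof -
    let ?S1 = "{I. I \<subseteq> ?X' \<union> (?J \<union> ?B) \<and> hit I y \<and> \<not> I \<subseteq> ?J \<union> ?B}"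
    let ?S2 = "{I. I \<subseteq> ?X' \<union> ?B \<and> hit I y \<and> \<not> I \<subseteq> ?B}"
    have fin: "finite ?S2" "finite S"
      unfolding S_def by (auto intro: finite_subset[of _ "Pow (?X' \<union> (?J \<union> ?B))"] finite_subset[of _ "Pow (?X' \<union> ?B)"])
    have S1: "?S1 = ?S2 \<union> S" unfolding S_def by (safe; fastforce)
    have "?S2 \<inter> S = {}" unfolding S_def by (safe; fastforce)
    then have "card ?S1 = card ?S2 + card S"
      unfolding S1 using fin by (intro card_Un_disjoint)
    then show ?thesis
      unfolding Dl_def JB right_diff_distrib[symmetric] using F_diff[of ?X' "?J \<union> ?B" y] F_diff[of ?X' ?B y]
      by (simp add: right_diff_distrib[symmetric])
  qed
  have rhs: "0 \<le> 2 ^ (k + j) * (\<Sum>i\<le>k-2. of_bool (loc {..<2*k+j} y) * nl i ?B y)"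
    by (auto intro!: mult_nonneg_nonneg sum_nonneg nl_nonneg)
  show ?thesis
  proof (cases "hit ?X y \<and> hit (A \<union> ?J) y \<and> hit ?X' y \<and> S \<noteq> {}")
    case False
    then have "ht ?X y * ht (A \<union> ?J) y * (ht ?X' y * real (card S)) = 0" by auto
    then show ?thesis using rhs unfolding diff by linarith
  next
    case True
    then have hX: "hit ?X y" and hJ: "hit (A \<union> ?J) y" and hX': "hit ?X' y" and "S \<noteq> {}" by auto
    \<comment> \<open>The chain of hits: \<open>X\<close> lies within \<open>\<rho>\<close> of point
      0, \<open>J\<close> within \<open>2 * \<rho>\<close> through a point of \<open>A\<close>, the
      sets in \<open>S\<close> within \<open>3 * \<rho>\<close>, and \<open>X'\<close> within
      \<open>4 * \<rho>\<close>.\<close>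
    have d: "dist (y i) (y 0) \<le> \<rho>" if "i \<in> ?X" for i using hit_local[OF hX that k0] .
    have \<rho>0: "0 \<le> \<rho>" using d[OF k0] by simp
    obtain a where a: "a \<in> A" using A by auto
    have dJ: "dist (y i) (y 0) \<le> 2 * \<rho>" if "i \<in> ?J" for i
    proof -
      have "a \<in> ?X" using a A by auto
      then show ?thesis using dist_chain[OF hit_local[OF hJ _ _] d, of i a] that a by auto
    qed
    have dI: "dist (y i) (y 0) \<le> 3 * \<rho>" if I: "I \<in> S" "i \<in> I" for I i
    proof -
      have hI: "hit I y" using I by (auto simp: S_def)
      obtain x where x: "x \<in> I" "x \<in> ?J" using I unfolding S_def by blast
      show ?thesis using dist_chain[OF hit_local[OF hI I(2) x(1)] dJ[OF x(2)]] by simp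
    qed
    obtain I0 where I0: "I0 \<in> S" using \<open>S \<noteq> {}\<close> by auto
    then obtain x' where x': "x' \<in> I0" "x' \<in> ?X'" unfolding S_def by blast
    have dX': "dist (y i) (y 0) \<le> 4 * \<rho>" if "i \<in> ?X'" for i
      using dist_chain[OF hit_local[OF hX' that x'(2)] dI[OF I0 x'(1)]] by simp
    have l: "loc {..<2*k+j} y"
      unfolding loc_def
    proof
      fix i assume "i \<in> {..<2*k+j}"
      then consider "i \<in> ?X" | "i \<in> ?X'" | "i \<in> ?J" by force
      then show "dist (y i) (y 0) \<le> 4 * \<rho>"
        using d[of i] dX'[of i] dJ[of i] \<rho>0 by cases linarith+
    qed
    have "card S \<le> 2 ^ card (?X' \<union> ?J) * cl (k - 2) ?B y"
    proof (rule card_le_cl)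
      fix I assume I: "I \<in> S"
      then obtain u w where uw: "u \<in> I" "u \<in> ?X'" "w \<in> I" "w \<in> ?J" and hI: "hit I y"
        unfolding S_def by blast
      have "card (I \<inter> ?B) + card {u, w} = card ((I \<inter> ?B) \<union> {u, w})"
        using uw by (intro card_Un_disjoint[symmetric]) auto
      also have "\<dots> \<le> card I" using uw hit_finite[OF hI] by (intro card_mono) auto
      also have "card {u, w} = 2" using uw by auto
      finally have "card (I \<inter> ?B) \<le> k - 2" using hI by (simp add: hit_def)
      moreover have "loc (I \<inter> ?B) y" using dI[OF I] \<rho>0 by (force simp: loc_def)
      ultimately show "I \<subseteq> (?X' \<union> ?J) \<union> ?B \<and> card (I \<inter> ?B) \<le> k - 2 \<and> loc (I \<inter> ?B) y"
        using I by (auto simp: S_def)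
    qed auto
    also have "card (?X' \<union> ?J) = k + j" by (subst card_Un_disjoint) auto
    finally have "real (card S) \<le> real (2 ^ (k + j) * cl (k - 2) ?B y)" by (simp only: of_nat_le_iff)
    then have "real (card S) \<le> 2 ^ (k + j) * (\<Sum>i\<le>k-2. nl i ?B y)" by (simp add: cl_sum)
    then show ?thesis unfolding diff using True l by simp
  qed
qed

text \<open>Only \<open>H\<close> is expanded, by the traces \<open>A\<close> on \<open>X\<close>;
  Mecke's formula then takes the other points \<open>J\<close> of the hit out of the process. In the
  mean of \<open>H * H'\<close> they still belong to the configuration that \<open>H'\<close> sees,
  whereas \<open>E H * E H'\<close> is the same expression with \<open>H'\<close> blind to them, so
  that \<open>Dl_cross\<close> bounds the difference. With \<open>card J\<close> between 1 and
  \<open>k - 1\<close> and at most \<open>k - 2\<close> further points, the exponent of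
  \<open>\<nu> * \<beta>\<close> lies between 1 and \<open>2 * k - 3\<close>.\<close>

lemma cov_bound:
  defines "H \<equiv> \<lambda>m. Dl {..<k} {2*k..<2*k+m}" and "H' \<equiv> \<lambda>m. Dl {k..<2*k} {2*k..<2*k+m}"
  shows "E (\<lambda>m y. H m y * H' m y) - E H * E H'
    \<le> 2 ^ (3 * k) * real k * (\<beta> ^ (2 * k - 1) * (\<nu> * \<beta> + (\<nu> * \<beta>) ^ (2 * k - 3)))"
proof -
  let ?X = "{..<k}" and ?X' = "{k..<2*k}" and ?\<A> = "Pow {..<k} - {{}}"
  let ?j = "\<lambda>A. k - card A"
  let ?J = "\<lambda>A. {2*k..<2*k+?j A}"
  let ?w = "\<lambda>A y. ht ?X y * ht (A \<union> ?J A) y"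
  define L where "L = \<beta> ^ (2 * k - 1) * (\<nu> * \<beta> + (\<nu> * \<beta>) ^ (2 * k - 3))"
  have L0: "0 \<le> L" using \<nu>_pos \<beta>_nonneg by (auto simp: L_def intro!: mult_nonneg_nonneg add_nonneg_nonneg)
  have cX: "finite {K..<K+m}" "card {K..<K+m} \<le> 0 + m" for K m :: nat by auto
  have tH': "tame (\<lambda>m. Dl ?X' {K..<K+m})" for K by (rule tame_Dl[OF _ cX]) simp
  have tH'J: "tame (\<lambda>m. Dl ?X' {2*k..<2*k+?j A+m})" for A
  proof (rule tame_Dl)
    show "card {2*k..<2*k+?j A+m} \<le> ?j A + m" for m by simp
  qed auto
  have tw: "tame (\<lambda>m y. ?w A y)" for A by (intro tame_mult tame_ht)
  have Dl_meas: "Dl ?X' B \<in> borel_measurable Q" if "finite B" for B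
  proof -
    have "tame (\<lambda>m. Dl ?X' B)"
      by (rule tame_Dl[where B="\<lambda>_. B" and s="card B"]) (use that in auto)
    then show ?thesis by (rule tame_measurable)
  qed
  obtain c a where c: "c \<ge> 0" "\<And>B y. finite B \<Longrightarrow> \<bar>F B y\<bar> \<le> c * (1 + real (card B)) ^ a"
    using functional_bounded[OF functional_F] by metis
  have Dl_bound: "\<bar>Dl ?X' B y\<bar> \<le> (c * (1 + real k) ^ a) * (1 + real (card B)) ^ a" if B: "finite B" for B y
  proof -
    have "card (?X' \<union> B) \<le> k + card B" using card_Un_le[of ?X' B] by simp
    then have "real (card (?X' \<union> B)) \<le> real k + real (card B)" by (metis of_nat_add of_nat_le_iff)
    moreover have "0 \<le> real k * real (card B)" by simp
    moreover have "(1 + real k) * (1 + real (card B)) = 1 + real k + real (card B) + real k * real (card B)"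
      by (simp add: algebra_simps)
    ultimately have "1 + real (card (?X' \<union> B)) \<le> (1 + real k) * (1 + real (card B))"
      by linarith
    then have "c * (1 + real (card (?X' \<union> B))) ^ a \<le> c * ((1 + real k) * (1 + real (card B))) ^ a"
      using c(1) by (intro mult_left_mono power_mono) auto
    moreover have "\<bar>Dl ?X' B y\<bar> \<le> \<bar>F (?X' \<union> B) y\<bar>"
      using F_mono[of B "?X' \<union> B" y] B F_nonneg[of B y] by (auto simp: Dl_def)
    ultimately show ?thesis using c(2)[of "?X' \<union> B" y] B by (simp add: power_mult_distrib mult_ac)
  qed
  \<comment> \<open>Mecke's formula is used with \<open>K = 2 * k\<close>: the reserved coordinates
    hold \<open>X\<close> and \<open>X'\<close>, so the permutations fix both blocks and also
    \<open>A\<close>.\<close>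
  have fix2k: "ht ?X y = ht ?X (y \<circ> \<pi>)" "ht (A \<union> \<pi> ` J) y = ht (A \<union> J) (y \<circ> \<pi>)"
      "Dl ?X' (\<pi> ` B) y = Dl ?X' B (y \<circ> \<pi>)"
    if \<pi>: "bij \<pi>" "\<And>i. i < 2 * k \<Longrightarrow> \<pi> i = i" and A: "A \<subseteq> ?X" for \<pi> A J B y
  proof -
    have id: "\<pi> ` U = U" if "U \<subseteq> {..<2*k}" for U
    proof -
      have "\<pi> ` U = id ` U" using \<pi>(2) that by (intro image_cong) auto
      then show ?thesis by simp
    qed
    have i: "inj \<pi>" using \<pi>(1) by (rule bij_is_inj)
    have U: "?X \<subseteq> {..<2*k}" "?X' \<subseteq> {..<2*k}" "A \<subseteq> {..<2*k}" using A by auto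
    show "ht ?X y = ht ?X (y \<circ> \<pi>)" using hit_equi[OF i, of ?X y] by (simp only: id[OF U(1)])
    show "ht (A \<union> \<pi> ` J) y = ht (A \<union> J) (y \<circ> \<pi>)"
      using hit_equi[OF i, of "A \<union> J" y] by (simp only: image_Un id[OF U(3)])
    show "Dl ?X' (\<pi> ` B) y = Dl ?X' B (y \<circ> \<pi>)"
      using Dl_equi[OF i, of ?X' B y] by (simp only: id[OF U(2)])
  qed
  have expand: "H m y = (\<Sum>A\<in>?\<A>. \<Sum>J | J \<subseteq> {2*k..<2*k+m} \<and> card J = ?j A. ht ?X y * ht (A \<union> J) y)" for m y
    unfolding H_def by (rule Dl_expand) auto
  have mecke_product: "E (\<lambda>m y. \<Sum>J | J \<subseteq> {2*k..<2*k+m} \<and> card J = ?j A.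
        ht ?X y * ht (A \<union> J) y * Dl ?X' {2*k..<2*k+m} y)
      = \<nu> ^ ?j A / fact (?j A) * E (\<lambda>m y. ?w A y * Dl ?X' {2*k..<2*k+?j A+m} y)" (is ?P1)
    "tame (\<lambda>m y. \<Sum>J | J \<subseteq> {2*k..<2*k+m} \<and> card J = ?j A.
        ht ?X y * ht (A \<union> J) y * Dl ?X' {2*k..<2*k+m} y)" (is ?P2)
    if A: "A \<subseteq> ?X" for A
  proof -
    let ?\<Psi> = "\<lambda>J B y. ht ?X y * ht (A \<union> J) y * Dl ?X' B y"
    have 1: "?\<Psi> J B \<in> borel_measurable Q" if "finite B" for J B
      using Dl_meas[OF that] by (intro borel_measurable_times measurable_ht)
    have 2: "\<bar>?\<Psi> J B y\<bar> \<le> (c * (1 + real k) ^ a) * (1 + real (card B)) ^ a" if "finite B" for J B y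
    proof -
      have "\<bar>?\<Psi> J B y\<bar> \<le> \<bar>Dl ?X' B y\<bar>" by auto
      then show ?thesis using Dl_bound[OF that, of y] by (rule order_trans)
    qed
    have 3: "?\<Psi> (\<pi> ` J) (\<pi> ` B) y = ?\<Psi> J B (y \<circ> \<pi>)" if "bij \<pi>" "\<And>i. i < 2 * k \<Longrightarrow> \<pi> i = i" for \<pi> J B y
      using fix2k[OF that A] by simp
    show ?P1 ?P2
      using mecke[where K="2 * k" and j="?j A" and \<Psi>="?\<Psi>", OF 1 2 3]
        tame_mecke[where K="2 * k" and j="?j A" and \<Psi>="?\<Psi>", OF 1 2 3] by blast+
  qed
  have mecke_single: "E (\<lambda>m y. \<Sum>J | J \<subseteq> {2*k..<2*k+m} \<and> card J = ?j A. ht ?X y * ht (A \<union> J) y)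
      = \<nu> ^ ?j A / fact (?j A) * E (\<lambda>m y. ?w A y)" (is ?P1)
    "tame (\<lambda>m y. \<Sum>J | J \<subseteq> {2*k..<2*k+m} \<and> card J = ?j A. ht ?X y * ht (A \<union> J) y)" (is ?P2)
    if A: "A \<subseteq> ?X" for A
  proof -
    let ?\<Psi> = "\<lambda>J B y. ht ?X y * ht (A \<union> J) y"
    have 1: "?\<Psi> J B \<in> borel_measurable Q" for J B
      by (intro borel_measurable_times measurable_ht)
    have 2: "\<bar>?\<Psi> J B y\<bar> \<le> 1 * (1 + real (card B)) ^ 0" for J B :: "nat set" and y
      by simp
    have 3: "?\<Psi> (\<pi> ` J) (\<pi> ` B) y = ?\<Psi> J B (y \<circ> \<pi>)" if "bij \<pi>" "\<And>i. i < 2 * k \<Longrightarrow> \<pi> i = i" for \<pi> J B y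
      using fix2k(1,2)[OF that A] by simp
    show ?P1 ?P2
      using mecke[where K="2 * k" and j="?j A" and \<Psi>="?\<Psi>", OF 1 2 3]
        tame_mecke[where K="2 * k" and j="?j A" and \<Psi>="?\<Psi>", OF 1 2 3] by blast+
  qed
  define cf where "cf A = \<nu> ^ ?j A / fact (?j A)" for A :: "nat set"
  define S where "S A m y = (\<Sum>J | J \<subseteq> {2*k..<2*k+m} \<and> card J = ?j A. ht ?X y * ht (A \<union> J) y)" for A m y
  define S' where "S' A m y = (\<Sum>J | J \<subseteq> {2*k..<2*k+m} \<and> card J = ?j A.
    ht ?X y * ht (A \<union> J) y * Dl ?X' {2*k..<2*k+m} y)" for A m y
  define w where "w A m y = ?w A y" for A and m :: nat and y
  \<comment> \<open>\<open>p\<close> and \<open>q\<close> differ only in whether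
    \<open>Dl X'\<close> sees the block that Mecke's formula has taken out.\<close>
  define p where "p A m y = ?w A y * Dl ?X' {2*k..<2*k+?j A+m} y" for A m y
  define q where "q A m y = ?w A y * Dl ?X' {2*k+?j A..<2*k+?j A+m} y" for A m y
  have S: "E (S A) = cf A * E (w A)" "tame (S A)" if "A \<in> ?\<A>" for A
    using mecke_single[of A] that unfolding S_def[abs_def] w_def[abs_def] cf_def by blast+
  have S': "E (S' A) = cf A * E (p A)" "tame (S' A)" if "A \<in> ?\<A>" for A
    using mecke_product[of A] that unfolding S'_def[abs_def] p_def[abs_def] cf_def by blast+
  have HS: "H = (\<lambda>m y. \<Sum>A\<in>?\<A>. S A m y)"
    by (intro ext) (simp only: expand S_def)
  have HS': "(\<lambda>m y. H m y * H' m y) = (\<lambda>m y. \<Sum>A\<in>?\<A>. S' A m y)"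
    by (intro ext) (simp only: expand S'_def H'_def sum_distrib_right)
  have EHH': "E (\<lambda>m y. H m y * H' m y) = (\<Sum>A\<in>?\<A>. cf A * E (p A))"
    unfolding HS' using S' by (subst E_sum) (auto intro!: sum.cong)
  have EH: "E H = (\<Sum>A\<in>?\<A>. cf A * E (w A))"
    unfolding HS using S by (subst E_sum) (auto intro!: sum.cong)
  \<comment> \<open>\<open>w\<close> reads only \<open>X\<close> and the block, while
    \<open>Dl X'\<close> with the process stored past the block reads neither.\<close>
  have indep: "E (w A) * E H' = E (q A)" if A: "A \<subseteq> ?X" for A
  proof -
    define \<pi> where "\<pi> i = (if i < 2 * k then i else i + ?j A)" for i :: nat
    have \<pi>: "inj \<pi>" by (auto simp: \<pi>_def inj_def split: if_splits)
    have \<pi>X: "\<pi> ` ?X' = ?X'" by (auto simp: \<pi>_def image_iff)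
    have "\<pi> ` {2*k..<2*k+m} = (\<lambda>i. i + ?j A) ` {2*k..<2*k+m}" for m
      by (intro image_cong) (auto simp: \<pi>_def)
    then have \<pi>B: "\<pi> ` {2*k..<2*k+m} = {2*k+?j A..<2*k+?j A+m}" for m
      unfolding image_add_atLeastLessThan' by (simp only: add.assoc add.commute[of m])
    have 1: "E H' = E (\<lambda>m. Dl ?X' {2*k+?j A..<2*k+?j A+m})"
      unfolding H'_def by (rule E_Dl_relabel[OF \<pi> \<pi>B \<pi>X _ cX, symmetric]) simp
    have 2: "E (q A) = E (w A) * E (\<lambda>m. Dl ?X' {2*k+?j A..<2*k+?j A+m})"
      unfolding q_def[abs_def] w_def[abs_def]
    proof (rule E_indep[OF tw tH', where A="?X \<union> ?J A"])
      fix x y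
      have "hit ?X (mix (?X \<union> ?J A) x y) = hit ?X x" by (rule hit_cong) (auto simp: mix_def)
      moreover have "hit (A \<union> ?J A) (mix (?X \<union> ?J A) x y) = hit (A \<union> ?J A) x"
        using A by (intro hit_cong) (auto simp: mix_def)
      ultimately show "?w A (mix (?X \<union> ?J A) x y) = ?w A x" by simp
      show "Dl ?X' {2*k+?j A..<2*k+?j A+m} (mix (?X \<union> ?J A) x y) = Dl ?X' {2*k+?j A..<2*k+?j A+m} y" for m
        by (rule Dl_cong) (auto simp: mix_def)
    qed
    show ?thesis unfolding 1 2 ..
  qed
  have term_bound: "cf A * (E (p A) - E (q A)) \<le> 2 ^ (2 * k) * real k * L" if A: "A \<in> ?\<A>" for A
  proof (cases "A = ?X")
    \<comment> \<open>For \<open>A = X\<close> the block is empty, so there is nothing for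
      \<open>Dl X'\<close> to see.\<close>
    case True
    then have "p A = q A" by (simp add: p_def[abs_def] q_def[abs_def])
    then show ?thesis using L0 by simp
  next
    case False
    define j where "j = ?j A"
    have "card A < k" using A False psubset_card_mono[of ?X A] by auto
    moreover have "card A > 0" using A finite_subset[of A ?X] by (auto simp: card_gt_0_iff)
    ultimately have j: "1 \<le> j" "j \<le> k - 1" by (auto simp: j_def)
    have t1: "tame (p A)" unfolding p_def[abs_def] by (rule tame_mult[OF tw tH'J])
    have t2: "tame (q A)" unfolding q_def[abs_def] by (rule tame_mult[OF tw tH'])
    define u where "u i m y = of_bool (loc {..<2*k+j} y) * nl i {2*k+j..<2*k+j+m} y" for i m y
    have tl: "tame (u i)" for i
      unfolding u_def[abs_def] by (intro tame_mult tame_of_bool_loc tame_nl) simp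
    have Eu: "E (u i) \<le> \<nu> ^ i * \<beta> ^ (2 * k + j + i - 1)" for i
      unfolding u_def[abs_def] using k2 by (intro E_loc_count) auto
    have pq: "p A m y - q A m y \<le> 2 ^ (k + j) * (\<Sum>i\<le>k-2. u i m y)" for m y
      using Dl_cross[of A y j m] A unfolding p_def q_def u_def j_def right_diff_distrib[symmetric] by blast
    have "E (p A) - E (q A) = E (\<lambda>m y. p A m y - q A m y)"
      by (rule E_diff[OF t1 t2, symmetric])
    also have "\<dots> \<le> E (\<lambda>m y. 2 ^ (k + j) * (\<Sum>i\<le>k-2. u i m y))"
      by (rule E_mono[OF tame_diff[OF t1 t2] tame_cmult[OF tame_sum[OF tl]]]) (rule pq)
    also have "\<dots> = 2 ^ (k + j) * (\<Sum>i\<le>k-2. E (u i))"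
      by (simp only: E_cmult E_sum[OF tl])
    also have "\<dots> \<le> 2 ^ (2 * k) * (\<Sum>i\<le>k-2. \<nu> ^ i * \<beta> ^ (2 * k + j + i - 1))"
    proof (rule mult_mono)
      show "(2::real) ^ (k + j) \<le> 2 ^ (2 * k)" using j by (intro power_increasing) auto
      show "(\<Sum>i\<le>k-2. E (u i)) \<le> (\<Sum>i\<le>k-2. \<nu> ^ i * \<beta> ^ (2 * k + j + i - 1))"
        by (intro sum_mono Eu)
      show "0 \<le> (\<Sum>i\<le>k-2. E (u i))"
        by (intro sum_nonneg E_nonneg) (simp add: u_def nl_nonneg)
    qed simp
    finally have "cf A * (E (p A) - E (q A))
      \<le> \<nu> ^ j / fact j * (2 ^ (2 * k) * (\<Sum>i\<le>k-2. \<nu> ^ i * \<beta> ^ (2 * k + j + i - 1)))"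
      unfolding cf_def j_def using \<nu>_pos by (intro mult_left_mono) auto
    also have "\<dots> \<le> \<nu> ^ j / 1 * (2 ^ (2 * k) * (\<Sum>i\<le>k-2. \<nu> ^ i * \<beta> ^ (2 * k + j + i - 1)))"
      using \<nu>_pos \<beta>_nonneg
      by (intro mult_right_mono divide_left_mono mult_nonneg_nonneg sum_nonneg) (auto simp: fact_ge_1)
    also have "\<dots> = 2 ^ (2 * k) * (\<Sum>i\<le>k-2. \<nu> ^ j * (\<nu> ^ i * \<beta> ^ (2 * k + j + i - 1)))"
      by (simp add: sum_distrib_left mult.left_commute)
    also have "\<dots> \<le> 2 ^ (2 * k) * (\<Sum>i\<le>k-2. L)"
    proof (intro mult_left_mono sum_mono)
      fix i assume i: "i \<in> {..k-2}"
      have e: "2 * k + j + i - 1 = (2 * k - 1) + (i + j)" using k2 by simp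
      have "\<nu> ^ j * (\<nu> ^ i * \<beta> ^ (2 * k + j + i - 1)) = \<beta> ^ (2 * k - 1) * (\<nu> * \<beta>) ^ (i + j)"
        unfolding e power_add power_mult_distrib by (simp only: mult_ac)
      also have "\<dots> \<le> L"
        unfolding L_def
        using power_le_add_power[of "\<nu> * \<beta>" 1 "i + j" "2 * k - 3"] i j k2 \<nu>_pos \<beta>_nonneg
        by (intro mult_left_mono) auto
      finally show "\<nu> ^ j * (\<nu> ^ i * \<beta> ^ (2 * k + j + i - 1)) \<le> L" .
    qed simp
    also have "\<dots> = 2 ^ (2 * k) * (real (k - 1) * L)" using k2 by (simp add: Suc_diff_Suc numeral_2_eq_2)
    also have "\<dots> \<le> 2 ^ (2 * k) * (real k * L)"
      using L0 by (intro mult_left_mono mult_right_mono) auto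
    finally show ?thesis by (simp only: mult.assoc)
  qed
  have "E H * E H' = (\<Sum>A\<in>?\<A>. cf A * E (q A))"
    unfolding EH sum_distrib_right mult.assoc using indep by (auto intro!: sum.cong)
  then have "E (\<lambda>m y. H m y * H' m y) - E H * E H' = (\<Sum>A\<in>?\<A>. cf A * (E (p A) - E (q A)))"
    unfolding EHH' by (simp only: sum_subtractf right_diff_distrib)
  also have "\<dots> \<le> (\<Sum>A\<in>?\<A>. 2 ^ (2 * k) * real k * L)"
    by (rule sum_mono) (rule term_bound)
  also have "\<dots> = real (card ?\<A>) * (2 ^ (2 * k) * real k * L)" by (rule sum_constant)
  also have "\<dots> \<le> 2 ^ k * (2 ^ (2 * k) * real k * L)"
  proof (rule mult_right_mono)
    have "card ?\<A> \<le> card (Pow ?X)" by (intro card_mono) auto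
    then have "card ?\<A> \<le> 2 ^ k" by (simp only: card_Pow[OF finite_lessThan] card_lessThan)
    then show "real (card ?\<A>) \<le> 2 ^ k" by (metis of_nat_le_iff of_nat_numeral of_nat_power)
  qed (use L0 in auto)
  also have "\<dots> = 2 ^ (3 * k) * real k * L"
    by (simp add: power_add[symmetric] mult.assoc[symmetric])
  finally show ?thesis unfolding L_def .
qed

end

section \<open>Normal approximation of local counts\<close>

text \<open>\<open>P\<close> is the scale of the variance and \<open>r\<close> the rate: the first
  error needs a conditional variance of order \<open>(P * r)\<^sup>2\<close>, the second a remainder
  of order \<open>P * sqrt P * r\<close>.\<close>

lemma rate_arith:
  fixes P r A K1 K2 L L' C V W v :: real
  assumes "P > 0" "r \<ge> 0" "A > 0" "L \<ge> 0" "L' \<ge> 0" "C \<ge> 0" "V \<ge> 0" "W \<ge> 0" and v: "v \<ge> A * P"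
    and V: "C\<^sup>2 * V \<le> K1 * (P\<^sup>2 * r\<^sup>2)" and W: "C * W \<le> K2 * (P * sqrt P * r)" and K: "K1 \<ge> 0" "K2 \<ge> 0"
  shows "L * (C / v * sqrt V) + L' * (C / (v * sqrt v) * W) \<le> (L * (sqrt K1 / A) + L' * (K2 / (A * sqrt A))) * r"
proof -
  have AP: "A * P > 0" using assms by simp
  then have v0: "v > 0" using v by linarith
  have "C / v * sqrt V \<le> sqrt K1 / A * r"
  proof -
    have "C * sqrt V = sqrt (C\<^sup>2 * V)" using \<open>C \<ge> 0\<close> by (simp add: real_sqrt_mult)
    also have "\<dots> \<le> sqrt (K1 * (P\<^sup>2 * r\<^sup>2))" using V by (rule real_sqrt_le_mono)
    also have "\<dots> = sqrt K1 * (P * r)" using assms by (simp add: real_sqrt_mult)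
    finally have 1: "C * sqrt V \<le> sqrt K1 * (P * r)" .
    have "C / v * sqrt V = C * sqrt V / v" by simp
    also have "\<dots> \<le> sqrt K1 * (P * r) / (A * P)"
      using 1 v AP assms by (intro frac_le) auto
    also have "\<dots> = sqrt K1 / A * r" using \<open>P > 0\<close> by simp
    finally show ?thesis .
  qed
  moreover have "C / (v * sqrt v) * W \<le> K2 / (A * sqrt A) * r"
  proof -
    have "C / (v * sqrt v) * W = C * W / (v * sqrt v)" by simp
    also have "\<dots> \<le> K2 * (P * sqrt P * r) / ((A * P) * sqrt (A * P))"
    proof (rule frac_le)
      show "(A * P) * sqrt (A * P) \<le> v * sqrt v" using v AP v0 by (intro mult_mono) auto
    qed (use W AP assms in auto)
    also have "\<dots> = K2 / (A * sqrt A) * r" using \<open>P > 0\<close> \<open>A > 0\<close> by (simp add: real_sqrt_mult)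
    finally show ?thesis .
  qed
  ultimately show ?thesis
    unfolding distrib_right mult.assoc using \<open>L \<ge> 0\<close> \<open>L' \<ge> 0\<close>
    by (intro add_mono mult_left_mono) auto
qed

section \<open>Wasserstein bound and lower bounds for the variance\<close>

context local_ustat
begin

definition Z :: "nat \<times> (nat \<Rightarrow> 'b) \<Rightarrow> real" where
  "Z p = (F {..<fst p} (snd p) - \<mu>) / sqrt v"

lemma measurable_Z[measurable]: "Z \<in> borel_measurable R"
proof -
  have "(\<lambda>p. (\<lambda>m. F {..<m}) (fst p) (snd p)) \<in> borel_measurable R"
    by (rule measurable_R) (rule tame_measurable[OF tame_F(1)])
  then show ?thesis unfolding Z_def[abs_def] by measurable
qed

lemma real_distribution_Z: "real_distribution (distr R borel Z)"
proof -
  interpret RR: prob_space R unfolding R_def by (rule R.prob_space_axioms)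
  have "prob_space (distr R borel Z)" by (rule RR.prob_space_distr) measurable
  then show ?thesis by (simp add: real_distribution_def real_distribution_axioms_def)
qed

lemma wasserstein_le:
  assumes v: "v > 0"
  shows "wasserstein_distance (distr R borel Z) std_normal_distribution
    \<le> ereal (78 * (c0 / v * sqrt (2 ^ (3 * k) * real k * (\<beta> ^ (2 * k - 1) * (\<nu> * \<beta> + (\<nu> * \<beta>) ^ (2 * k - 3)))))
      + 26 * (c0 / (v * sqrt v) * (4 ^ (3 * k) * (2 * real k) * (\<beta> ^ (k - 1) * (1 + (\<nu> * \<beta>) ^ (2 * k - 2))))))"
proof (rule wasserstein_distance_le_stein[OF real_distribution_Z])
  show "integrable (distr R borel Z) (\<lambda>x. x)"
  proof (subst integrable_distr_eq)
    have "tame (\<lambda>m y. (1 / sqrt v) * (F {..<m} y - \<mu>))"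
      by (intro tame_cmult tame_diff tame_F tame_const)
    from tame_integrable[OF this] show "integrable R (\<lambda>p. Z p)" by (simp add: Z_def[abs_def])
  qed auto
  fix g g' :: "real \<Rightarrow> real"
  assume g: "\<And>x. (g has_real_derivative g' x) (at x)" "\<And>x. \<bar>g' x\<bar> \<le> 78"
    "\<And>x y. \<bar>g' x - g' y\<bar> \<le> 26 * \<bar>x - y\<bar>"
  have "continuous_on UNIV g'"
    by (rule lipschitz_on_continuous_on[of 26], rule lipschitz_onI) (use g(3) in \<open>auto simp: dist_real_def\<close>)
  moreover have "continuous_on UNIV g"
    using g(1) by (intro continuous_at_imp_continuous_on ballI DERIV_isCont)
  ultimately have [measurable]: "g \<in> borel_measurable borel" "g' \<in> borel_measurable borel"
    by (auto intro: borel_measurable_continuous_onI)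
  let ?f = "\<lambda>B y. (F B y - \<mu>) / sqrt v"
  have "(\<integral>x. g' x - x * g x \<partial>distr R borel Z) = (\<integral>p. g' (Z p) - Z p * g (Z p) \<partial>R)"
    by (rule integral_distr) measurable
  also have "\<dots> = E (\<lambda>m y. g' (?f {..<m} y) - ?f {..<m} y * g (?f {..<m} y))"
    by (simp add: E_def Z_def)
  finally have eq: "(\<integral>x. g' x - x * g x \<partial>distr R borel Z) = E (\<lambda>m y. g' (?f {..<m} y) - ?f {..<m} y * g (?f {..<m} y))" .
  show "\<bar>\<integral>x. g' x - x * g x \<partial>distr R borel Z\<bar>
    \<le> 78 * (c0 / v * sqrt (2 ^ (3 * k) * real k * (\<beta> ^ (2 * k - 1) * (\<nu> * \<beta> + (\<nu> * \<beta>) ^ (2 * k - 3)))))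
      + 26 * (c0 / (v * sqrt v) * (4 ^ (3 * k) * (2 * real k) * (\<beta> ^ (k - 1) * (1 + (\<nu> * \<beta>) ^ (2 * k - 2)))))"
    unfolding eq
  proof (rule order_trans[OF stein_error[OF v g]])
    have 1: "0 \<le> c0 / v" "0 \<le> c0 / (v * sqrt v)" using c0_pos v by auto
    show "78 * (c0 / v * sqrt (E (\<lambda>m y. Dl {..<k} {2*k..<2*k+m} y * Dl {k..<2*k} {2*k..<2*k+m} y)
          - E (\<lambda>m. Dl {..<k} {2*k..<2*k+m}) * E (\<lambda>m. Dl {k..<2*k} {2*k..<2*k+m})))
        + 26 * (c0 / (v * sqrt v) * E (\<lambda>m y. ht {..<k} y * (F {..<k+m} y - F {k..<k+m} y)\<^sup>2))
      \<le> 78 * (c0 / v * sqrt (2 ^ (3 * k) * real k * (\<beta> ^ (2 * k - 1) * (\<nu> * \<beta> + (\<nu> * \<beta>) ^ (2 * k - 3)))))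
      + 26 * (c0 / (v * sqrt v) * (4 ^ (3 * k) * (2 * real k) * (\<beta> ^ (k - 1) * (1 + (\<nu> * \<beta>) ^ (2 * k - 2)))))"
      by (rule add_mono; rule mult_left_mono; (rule mult_left_mono)?)
         (rule real_sqrt_le_mono cov_bound second_bound 1 | simp)+
  qed
qed

definition \<theta> :: real where "\<theta> = (\<integral>y. ht {..<k} y \<partial>Q)"

lemma E_ht: "E (\<lambda>m y. ht {..<k} y) = \<theta>"
  by (subst E_eq) (simp_all add: \<theta>_def)

lemma variance_eq_Dl: "v = c0 * E (\<lambda>m. Dl {..<k} {k..<k+m})"
proof -
  have "(\<lambda>m. Dl {..<k} {k..<k+m}) = (\<lambda>m y. ht {..<k} y * (F {..<k+m} y - F {k..<k+m} y))"
    by (intro ext) (simp only: Dl_def ivl_disj_un_one(2) le_add1)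
  then show ?thesis using variance_eq by simp
qed

lemma tame_Dl_k: "tame (\<lambda>m. Dl {..<k} {k..<k+m})"
  by (rule tame_Dl[where B="\<lambda>m. {k..<k+m}" and s=0]) auto

text \<open>Among the hits gained by adding the points \<open>X\<close> is \<open>X\<close> itself,
  so \<open>Dl\<close> is at least \<open>ht\<close>. The left-hand side is the mean of
  \<open>F\<close>.\<close>

lemma variance_ge_linear: "c0 * \<theta> \<le> v"
proof -
  have "E (\<lambda>m y. ht {..<k} y) \<le> E (\<lambda>m. Dl {..<k} {k..<k+m})"
  proof (rule E_mono[OF tame_ht tame_Dl_k])
    fix m y
    show "ht {..<k} y \<le> Dl {..<k} {k..<k+m} y"
    proof (cases "hit {..<k} y")
      case True
      let ?S = "{I. I \<subseteq> {..<k} \<union> {k..<k+m} \<and> hit I y \<and> \<not> I \<subseteq> {k..<k+m}}"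
      have "0 \<in> {..<k}" "0 \<notin> {k..<k+m}" using k2 by auto
      then have "{..<k} \<in> ?S" using True by blast
      moreover have "finite ?S" by (rule finite_subset[of _ "Pow ({..<k} \<union> {k..<k+m})"]) auto
      ultimately have "card ?S > 0" by (auto simp: card_gt_0_iff)
      then show ?thesis unfolding Dl_def F_diff[OF finite_lessThan finite_atLeastLessThan] using True by simp
    qed (simp add: Dl_def)
  qed
  then show ?thesis unfolding variance_eq_Dl E_ht using c0_pos by simp
qed

text \<open>Of the gained hits only those that meet \<open>X\<close> in point 0 alone are kept.
  Given point 0, such a hit and the hit \<open>X\<close> are conditionally independent with equal
  conditional probabilities, so both occur with probability at least
  \<open>\<theta>\<^sup>2\<close>.\<close>

lemma variance_ge_quadratic: "c0 * (\<nu> ^ (k - 1) / fact (k - 1) * \<theta>\<^sup>2) \<le> v"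
proof -
  let ?X = "{..<k}" and ?J = "{k..<k+(k-1)}"
  let ?\<Psi> = "\<lambda>J (B :: nat set) y. ht ?X y * ht ({0} \<union> J) y"
  have k0: "0 < k" using k2 by simp
  have 1: "?\<Psi> J B \<in> borel_measurable Q" for J B
    by (intro borel_measurable_times measurable_ht)
  have 2: "\<bar>?\<Psi> J B y\<bar> \<le> 1 * (1 + real (card B)) ^ 0" for J B :: "nat set" and y by simp
  have 3: "?\<Psi> (\<pi> ` J) (\<pi> ` B) y = ?\<Psi> J B (y \<circ> \<pi>)" if \<pi>: "bij \<pi>" "\<And>i. i < k \<Longrightarrow> \<pi> i = i" for \<pi> J B y
  proof -
    have i: "inj \<pi>" using \<pi>(1) by (rule bij_is_inj)
    have "\<pi> ` ?X = id ` ?X" using \<pi>(2) by (intro image_cong) auto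
    then have "\<pi> ` ?X = ?X" by simp
    moreover have "\<pi> ` ({0} \<union> J) = {0} \<union> \<pi> ` J" using \<pi>(2)[OF k0] by auto
    ultimately show ?thesis using hit_equi[OF i, of ?X y] hit_equi[OF i, of "{0} \<union> J" y] by simp
  qed
  define S where "S m y = (\<Sum>J | J \<subseteq> {k..<k+m} \<and> card J = k - 1. ?\<Psi> J {k..<k+m} y)" for m y
  have S: "E S = \<nu> ^ (k - 1) / fact (k - 1) * E (\<lambda>m y. ht ?X y * ht ({0} \<union> ?J) y)" "tame S"
    unfolding S_def[abs_def]
    using mecke[where K=k and j="k-1" and \<Psi>="?\<Psi>", OF 1 2 3]
      tame_mecke[where K=k and j="k-1" and \<Psi>="?\<Psi>", OF 1 2 3] by blast+
  have "E S \<le> E (\<lambda>m. Dl ?X {k..<k+m})"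
  proof (rule E_mono[OF S(2) tame_Dl_k])
    fix m y
    have "S m y = (\<Sum>A\<in>{{0}}. \<Sum>J | J \<subseteq> {k..<k+m} \<and> card J = k - card A. ht ?X y * ht (A \<union> J) y)"
      by (simp add: S_def)
    also have "\<dots> \<le> (\<Sum>A\<in>Pow ?X - {{}}. \<Sum>J | J \<subseteq> {k..<k+m} \<and> card J = k - card A. ht ?X y * ht (A \<union> J) y)"
      using k0 by (intro sum_mono2 sum_nonneg) auto
    also have "\<dots> = Dl ?X {k..<k+m} y" by (rule Dl_expand[symmetric]) auto
    finally show "S m y \<le> Dl ?X {k..<k+m} y" .
  qed
  moreover have "\<theta>\<^sup>2 \<le> E (\<lambda>m y. ht ?X y * ht ({0} \<union> ?J) y)"
  proof -
    \<comment> \<open>This exchanges \<open>{1..<k}\<close> with \<open>{k..<k+(k-1)}\<close> and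
      fixes 0.\<close>
    define \<pi> where "\<pi> i = (if 1 \<le> i \<and> i < k then i + (k - 1) else if k \<le> i \<and> i < k + (k - 1) then i - (k - 1) else i)" for i :: nat
    have \<pi>: "inj \<pi>" by (auto simp: \<pi>_def inj_def split: if_splits)
    have \<pi>X: "\<pi> ` ?X = {0} \<union> ?J"
    proof
      show "\<pi> ` ?X \<subseteq> {0} \<union> ?J" using k0 by (auto simp: \<pi>_def)
      show "{0} \<union> ?J \<subseteq> \<pi> ` ?X"
      proof
        fix i assume "i \<in> {0} \<union> ?J"
        then show "i \<in> \<pi> ` ?X"
          using k0 by (intro image_eqI[where x="if i = 0 then 0 else i - (k - 1)"]) (auto simp: \<pi>_def)
      qed
    qed
    \<comment> \<open>With the constant 1 as \<open>\<phi>\<close>, \<open>cond_variance\<close> is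
      the Cauchy-Schwarz inequality for the conditional probability given point 0.\<close>
    have "\<bar>E (\<lambda>m y. 1 * ht ?X y)\<bar> \<le> 1 * sqrt (E (\<lambda>m y. ht ?X y * ht ({0} \<union> ?J) y))"
    proof (rule cond_variance[where X="{1..<k}" and X'="?J"])
      show "ht ({0} \<union> ?J) (mix {1..<k} x y) = ht ({0} \<union> ?J) y" for x y
      proof -
        have "hit ({0} \<union> ?J) (mix {1..<k} x y) = hit ({0} \<union> ?J) y"
          by (rule hit_cong) (auto simp: mix_def)
        then show ?thesis by simp
      qed
      show "ht ?X (mix ?J x y) = ht ?X y" for x y
      proof -
        have "hit ?X (mix ?J x y) = hit ?X y" by (rule hit_cong) (auto simp: mix_def)
        then show ?thesis by simp
      qed
      show "(\<integral>x. ht ?X (mix {1..<k} x y) \<partial>Q) = (\<integral>x. ht ({0} \<union> ?J) (mix ?J x y) \<partial>Q)" for y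
      proof -
        have "hit ({0} \<union> ?J) (mix ?J x y) = hit ?X (mix {1..<k} (x \<circ> \<pi>) y)" for x
        proof -
          have "hit ({0} \<union> ?J) (mix ?J x y) = hit ?X (mix ?J x y \<circ> \<pi>)"
            using hit_equi[OF \<pi>, of ?X] by (simp only: \<pi>X)
          also have "\<dots> = hit ?X (mix {1..<k} (x \<circ> \<pi>) y)"
            by (rule hit_cong) (auto simp: mix_def \<pi>_def)
          finally show ?thesis .
        qed
        then have "(\<integral>x. ht ({0} \<union> ?J) (mix ?J x y) \<partial>Q) = (\<integral>x. ht ?X (mix {1..<k} (x \<circ> \<pi>) y) \<partial>Q)" by simp
        also have "\<dots> = (\<integral>x. ht ?X (mix {1..<k} x y) \<partial>Q)"
        proof (rule integral_relabel[OF \<pi>])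
          have "(\<lambda>x. mix {1..<k} x y) \<in> measurable Q Q" by (rule measurable_mix'[of "\<lambda>x. x" _ "\<lambda>_. y"]) auto
          from measurable_compose[OF this measurable_ht]
          show "(\<lambda>x. ht ?X (mix {1..<k} x y)) \<in> borel_measurable Q" .
        qed
        finally show ?thesis ..
      qed
    qed (auto simp: tame_ht)
    then have "\<bar>\<theta>\<bar> \<le> sqrt (E (\<lambda>m y. ht ?X y * ht ({0} \<union> ?J) y))" by (simp add: E_ht)
    then have "\<bar>\<theta>\<bar>\<^sup>2 \<le> (sqrt (E (\<lambda>m y. ht ?X y * ht ({0} \<union> ?J) y)))\<^sup>2" by (rule power_mono) simp
    also have "\<dots> = E (\<lambda>m y. ht ?X y * ht ({0} \<union> ?J) y)" by (rule real_sqrt_pow2) (intro E_nonneg, simp)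
    finally show ?thesis by simp
  qed
  ultimately have "\<nu> ^ (k - 1) / fact (k - 1) * \<theta>\<^sup>2 \<le> E (\<lambda>m. Dl ?X {k..<k+m})"
    unfolding S(1) using \<nu>_pos by (smt (verit) divide_nonneg_pos fact_gt_zero mult_left_mono zero_le_power)
  then show ?thesis unfolding variance_eq_Dl using c0_pos by (intro mult_left_mono) auto
qed

end

definition rate_const :: "nat \<Rightarrow> real \<Rightarrow> real \<Rightarrow> real" where
  "rate_const k \<eta> \<Lambda> =
    (let A = min (\<eta> / fact k) (\<eta>\<^sup>2 / (fact k * fact (k - 1))) in
      78 * (sqrt (2 ^ (3 * k) * real k * (2 * \<Lambda> ^ (3 * k))) / A)
      + 26 * (4 ^ (3 * k) * (2 * real k) * (2 * \<Lambda> ^ (3 * k)) / (A * sqrt A)))"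

lemma power_le_large:
  fixes x \<Lambda> :: real
  assumes "0 \<le> x" "x \<le> \<Lambda>" "1 \<le> \<Lambda>" "a \<le> b" shows "x ^ a \<le> \<Lambda> ^ b"
  using power_mono[OF assms(2,1), of a] power_increasing[OF assms(4,3)] by linarith

text \<open>As \<open>1 \<le> x * \<Lambda>\<close>, further factors \<open>x\<close> can be
  inserted at the price of one \<open>\<Lambda>\<close> each.\<close>

lemma power_le_shift:
  fixes x \<Lambda> :: real
  assumes x: "0 < x" "1 \<le> x * \<Lambda>" "1 \<le> \<Lambda>" and "b \<le> c"
  shows "x ^ a \<le> \<Lambda> ^ c * x ^ (a + b)"
proof -
  have "1 \<le> (x * \<Lambda>) ^ b" using x(2) by (rule one_le_power)
  then have "x ^ a * 1 \<le> x ^ a * (x * \<Lambda>) ^ b" using x(1) by (intro mult_left_mono) auto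
  also have "\<dots> = \<Lambda> ^ b * x ^ (a + b)" by (simp add: power_mult_distrib power_add mult_ac)
  also have "\<dots> \<le> \<Lambda> ^ c * x ^ (a + b)"
    using x assms(4) by (intro mult_right_mono power_increasing) auto
  finally show ?thesis by simp
qed

section \<open>Rates in the sparse and in the dense regime\<close>

context local_ustat
begin

lemma c0_le: "c0 \<le> \<nu> ^ k" and c0_sq_le: "c0\<^sup>2 \<le> \<nu> ^ (2 * k)"
proof -
  have "\<nu> ^ k / fact k \<le> \<nu> ^ k / 1" using \<nu>_pos by (intro divide_left_mono) (auto simp: fact_ge_1)
  then show 1: "c0 \<le> \<nu> ^ k" by (simp add: c0_def)
  have "c0\<^sup>2 \<le> (\<nu> ^ k)\<^sup>2" using 1 c0_pos by (intro power_mono) auto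
  then show "c0\<^sup>2 \<le> \<nu> ^ (2 * k)" by (simp add: power_mult[symmetric] mult.commute)
qed

context
  fixes \<eta> \<Lambda> :: real
  assumes \<eta>: "\<eta> > 0" and \<theta>_ge: "\<eta> * \<beta> ^ (k - 1) \<le> \<theta>" and \<beta>_pos: "\<beta> > 0" and \<Lambda>: "\<Lambda> \<ge> 1"
begin

lemma variance_ge:
  defines "A \<equiv> min (\<eta> / fact k) (\<eta>\<^sup>2 / (fact k * fact (k - 1)))"
  shows "A * (\<nu> * (\<nu> * \<beta>) ^ (k - 1)) \<le> v" "A * (\<nu> * (\<nu> * \<beta>) ^ (2 * k - 2)) \<le> v" "A > 0"
proof -
  have pk: "\<nu> ^ k = \<nu> * \<nu> ^ (k - 1)" using k2 by (cases k) auto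
  have two: "2 * k - 2 = 2 * (k - 1)" by simp
  show "A > 0" using \<eta> by (auto simp: A_def)
  have "A * (\<nu> * (\<nu> * \<beta>) ^ (k - 1)) \<le> \<eta> / fact k * (\<nu> * (\<nu> * \<beta>) ^ (k - 1))"
    using \<nu>_pos \<beta>_pos by (intro mult_right_mono) (auto simp: A_def)
  also have "\<dots> = c0 * (\<eta> * \<beta> ^ (k - 1))" by (simp add: c0_def pk power_mult_distrib)
  also have "\<dots> \<le> c0 * \<theta>" using \<theta>_ge c0_pos by (intro mult_left_mono) auto
  also have "\<dots> \<le> v" by (rule variance_ge_linear)
  finally show "A * (\<nu> * (\<nu> * \<beta>) ^ (k - 1)) \<le> v" .
  have "A * (\<nu> * (\<nu> * \<beta>) ^ (2 * k - 2)) \<le> \<eta>\<^sup>2 / (fact k * fact (k - 1)) * (\<nu> * (\<nu> * \<beta>) ^ (2 * k - 2))"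
    using \<nu>_pos \<beta>_pos by (intro mult_right_mono) (auto simp: A_def)
  also have "\<dots> = c0 * (\<nu> ^ (k - 1) / fact (k - 1) * (\<eta> * \<beta> ^ (k - 1))\<^sup>2)"
    unfolding two by (simp add: c0_def pk power_mult_distrib power_mult power2_eq_square mult_ac)
  also have "\<dots> \<le> c0 * (\<nu> ^ (k - 1) / fact (k - 1) * \<theta>\<^sup>2)"
    using \<theta>_ge c0_pos \<nu>_pos \<eta> \<beta>_pos by (intro mult_left_mono power_mono) auto
  also have "\<dots> \<le> v" by (rule variance_ge_quadratic)
  finally show "A * (\<nu> * (\<nu> * \<beta>) ^ (2 * k - 2)) \<le> v" .
qed

lemma wasserstein_le_rate:
  assumes P: "P > 0" and r: "r \<ge> 0"
    and v: "min (\<eta> / fact k) (\<eta>\<^sup>2 / (fact k * fact (k - 1))) * P \<le> v"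
    and V: "\<nu> * (\<nu> * \<beta>) ^ (2 * k - 1) * (\<nu> * \<beta> + (\<nu> * \<beta>) ^ (2 * k - 3)) \<le> 2 * \<Lambda> ^ (3 * k) * (P\<^sup>2 * r\<^sup>2)"
    and W: "\<nu> * (\<nu> * \<beta>) ^ (k - 1) * (1 + (\<nu> * \<beta>) ^ (2 * k - 2)) \<le> 2 * \<Lambda> ^ (3 * k) * (P * sqrt P * r)"
  shows "wasserstein_distance (distr R borel Z) std_normal_distribution \<le> ereal (rate_const k \<eta> \<Lambda> * r)"
proof -
  let ?A = "min (\<eta> / fact k) (\<eta>\<^sup>2 / (fact k * fact (k - 1)))"
  let ?V = "\<nu> * \<beta> + (\<nu> * \<beta>) ^ (2 * k - 3)" and ?W = "1 + (\<nu> * \<beta>) ^ (2 * k - 2)"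
  have A: "?A > 0" by (rule variance_ge(3))
  then have "0 < ?A * P" using P by simp
  then have v0: "v > 0" using v by linarith
  have V0: "0 \<le> ?V" and W0: "0 \<le> ?W" using \<nu>_pos \<beta>_pos by auto
  have p1: "\<nu> ^ (2 * k) * \<beta> ^ (2 * k - 1) = \<nu> * (\<nu> * \<beta>) ^ (2 * k - 1)"
    using k2 power_Suc[of \<nu> "2 * k - 1"] by (simp add: power_mult_distrib)
  have p2: "\<nu> ^ k * \<beta> ^ (k - 1) = \<nu> * (\<nu> * \<beta>) ^ (k - 1)"
    using k2 power_Suc[of \<nu> "k - 1"] by (simp add: power_mult_distrib)
  note wasserstein_le[OF v0]
  also have "ereal (78 * (c0 / v * sqrt (2 ^ (3 * k) * real k * (\<beta> ^ (2 * k - 1) * ?V)))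
      + 26 * (c0 / (v * sqrt v) * (4 ^ (3 * k) * (2 * real k) * (\<beta> ^ (k - 1) * ?W))))
    \<le> ereal (rate_const k \<eta> \<Lambda> * r)"
    unfolding rate_const_def Let_def ereal_less_eq
  proof (rule rate_arith[OF P r A])
    have "c0\<^sup>2 * (2 ^ (3 * k) * real k * (\<beta> ^ (2 * k - 1) * ?V))
        \<le> \<nu> ^ (2 * k) * (2 ^ (3 * k) * real k * (\<beta> ^ (2 * k - 1) * ?V))"
      using c0_sq_le V0 \<beta>_pos by (intro mult_right_mono) auto
    also have "\<dots> = 2 ^ (3 * k) * real k * (\<nu> * (\<nu> * \<beta>) ^ (2 * k - 1) * ?V)"
      unfolding p1[symmetric] by (simp only: mult_ac)
    also have "\<dots> \<le> 2 ^ (3 * k) * real k * (2 * \<Lambda> ^ (3 * k) * (P\<^sup>2 * r\<^sup>2))"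
      using V by (intro mult_left_mono) auto
    finally show "c0\<^sup>2 * (2 ^ (3 * k) * real k * (\<beta> ^ (2 * k - 1) * ?V))
        \<le> 2 ^ (3 * k) * real k * (2 * \<Lambda> ^ (3 * k)) * (P\<^sup>2 * r\<^sup>2)" by (simp only: mult.assoc)
    have "c0 * (4 ^ (3 * k) * (2 * real k) * (\<beta> ^ (k - 1) * ?W))
        \<le> \<nu> ^ k * (4 ^ (3 * k) * (2 * real k) * (\<beta> ^ (k - 1) * ?W))"
      using c0_le W0 \<beta>_pos by (intro mult_right_mono) auto
    also have "\<dots> = 4 ^ (3 * k) * (2 * real k) * (\<nu> * (\<nu> * \<beta>) ^ (k - 1) * ?W)"
      unfolding p2[symmetric] by (simp only: mult_ac)
    also have "\<dots> \<le> 4 ^ (3 * k) * (2 * real k) * (2 * \<Lambda> ^ (3 * k) * (P * sqrt P * r))"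
      using W by (intro mult_left_mono) auto
    finally show "c0 * (4 ^ (3 * k) * (2 * real k) * (\<beta> ^ (k - 1) * ?W))
        \<le> 4 ^ (3 * k) * (2 * real k) * (2 * \<Lambda> ^ (3 * k)) * (P * sqrt P * r)" by (simp only: mult.assoc)
  qed (use c0_pos v V0 W0 \<beta>_pos \<Lambda> in \<open>auto intro!: mult_nonneg_nonneg\<close>)
  finally show ?thesis .
qed

text \<open>\<open>P\<close> comes from the linear variance bound and \<open>r = 1 / sqrt P\<close>,
  so that both targets of \<open>wasserstein_le_rate\<close> reduce to \<open>P\<close>; the
  remaining powers of \<open>\<nu> * \<beta>\<close> are bounded by powers of
  \<open>\<Lambda>\<close>.\<close>

lemma wasserstein_rate_sparse:
  assumes "\<nu> * \<beta> \<le> \<Lambda>"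
  shows "wasserstein_distance (distr R borel Z) std_normal_distribution
    \<le> ereal (rate_const k \<eta> \<Lambda> * (1 / sqrt (\<nu> * (\<nu> * \<beta>) ^ (k - 1))))"
proof -
  let ?l = "\<nu> * \<beta>"
  let ?P = "\<nu> * ?l ^ (k - 1)"
  have l: "?l > 0" using \<nu>_pos \<beta>_pos by simp
  have P: "?P > 0" using \<nu>_pos l by simp
  have pr: "?P\<^sup>2 * (1 / sqrt ?P)\<^sup>2 = ?P" "?P * sqrt ?P * (1 / sqrt ?P) = ?P"
    using P by (auto simp: power_divide power2_eq_square)
  show ?thesis
  proof (rule wasserstein_le_rate[OF P _ variance_ge(1)])
    have "?l ^ k * ?l \<le> \<Lambda> ^ (3 * k)" "?l ^ k * ?l ^ (2 * k - 3) \<le> \<Lambda> ^ (3 * k)"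
      unfolding power_Suc2[symmetric] power_add[symmetric]
      using l assms \<Lambda> k2 by (auto simp del: power_Suc intro!: power_le_large)
    then have "?l ^ k * (?l + ?l ^ (2 * k - 3)) \<le> 2 * \<Lambda> ^ (3 * k)" by (simp add: distrib_left)
    then have "?P * (?l ^ k * (?l + ?l ^ (2 * k - 3))) \<le> ?P * (2 * \<Lambda> ^ (3 * k))"
      using P by (intro mult_left_mono) auto
    moreover have "?l ^ (2 * k - 1) = ?l ^ (k - 1) * ?l ^ k"
    proof -
      have "2 * k - 1 = (k - 1) + k" using k2 by simp
      then show ?thesis by (simp only: power_add)
    qed
    ultimately show "\<nu> * ?l ^ (2 * k - 1) * (?l + ?l ^ (2 * k - 3)) \<le> 2 * \<Lambda> ^ (3 * k) * (?P\<^sup>2 * (1 / sqrt ?P)\<^sup>2)"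
      unfolding pr by (simp only: mult_ac)
    have "1 \<le> \<Lambda> ^ (3 * k)" using \<Lambda> by (rule one_le_power)
    moreover have "?l ^ (2 * k - 2) \<le> \<Lambda> ^ (3 * k)"
      using l assms \<Lambda> by (intro power_le_large) auto
    ultimately have "1 + ?l ^ (2 * k - 2) \<le> 2 * \<Lambda> ^ (3 * k)" by simp
    then have "?P * (1 + ?l ^ (2 * k - 2)) \<le> ?P * (2 * \<Lambda> ^ (3 * k))"
      using P by (intro mult_left_mono) auto
    then show "?P * (1 + ?l ^ (2 * k - 2)) \<le> 2 * \<Lambda> ^ (3 * k) * (?P * sqrt ?P * (1 / sqrt ?P))"
      unfolding pr by (simp only: mult_ac)
  qed (use P in simp)
qed

text \<open>\<open>P\<close> comes from the quadratic variance bound and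
  \<open>r = 1 / sqrt \<nu>\<close>. With \<open>l = \<nu> * \<beta>\<close> the targets become
  \<open>\<nu> * l ^ (4 * k - 4)\<close> and \<open>\<nu> * l ^ (3 * k - 3)\<close>, the top powers
  of the two errors; \<open>power_le_shift\<close> raises the lower powers to them.\<close>

lemma wasserstein_rate_dense:
  assumes "1 \<le> \<nu> * \<beta> * \<Lambda>"
  shows "wasserstein_distance (distr R borel Z) std_normal_distribution
    \<le> ereal (rate_const k \<eta> \<Lambda> * (1 / sqrt \<nu>))"
proof -
  let ?l = "\<nu> * \<beta>"
  let ?P = "\<nu> * ?l ^ (2 * k - 2)"
  have l: "?l > 0" using \<nu>_pos \<beta>_pos by simp
  have P: "?P > 0" using \<nu>_pos l by simp
  have two: "2 * k - 2 = (k - 1) + (k - 1)" using k2 by simp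
  have sP: "sqrt ?P = sqrt \<nu> * ?l ^ (k - 1)"
    unfolding two power_add using \<nu>_pos l by (simp add: real_sqrt_mult)
  have pr: "?P\<^sup>2 * (1 / sqrt \<nu>)\<^sup>2 = \<nu> * (?l ^ (2 * k - 2))\<^sup>2"
    using \<nu>_pos by (simp add: power_divide power2_eq_square)
  have pr2: "?P * sqrt ?P * (1 / sqrt \<nu>) = \<nu> * (?l ^ (2 * k - 2) * ?l ^ (k - 1))"
    using \<nu>_pos unfolding sP by simp
  show ?thesis
  proof (rule wasserstein_le_rate[OF P _ variance_ge(2)])
    have four: "(?l ^ (2 * k - 2))\<^sup>2 = ?l ^ (4 * k - 4)"
      by (simp add: power_mult[symmetric] diff_mult_distrib)
    have "?l ^ (2 * k) \<le> \<Lambda> ^ (3 * k) * ?l ^ (2 * k + (2 * k - 4))"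
      using l assms \<Lambda> by (intro power_le_shift) auto
    also have "2 * k + (2 * k - 4) = 4 * k - 4" using k2 by simp
    finally have 1: "?l ^ (2 * k) \<le> \<Lambda> ^ (3 * k) * ?l ^ (4 * k - 4)" .
    have 2: "?l ^ (4 * k - 4) \<le> \<Lambda> ^ (3 * k) * ?l ^ (4 * k - 4)"
      using mult_right_mono[OF one_le_power[OF \<Lambda>, of "3 * k"], of "?l ^ (4 * k - 4)"] l by simp
    have "?l ^ (2 * k - 1) * (?l + ?l ^ (2 * k - 3)) = ?l ^ (2 * k) + ?l ^ (4 * k - 4)"
    proof -
      have "2 * k = Suc (2 * k - 1)" "4 * k - 4 = (2 * k - 1) + (2 * k - 3)" using k2 by simp_all
      then show ?thesis by (metis distrib_left power_Suc2 power_add)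
    qed
    also have "\<dots> \<le> 2 * \<Lambda> ^ (3 * k) * ?l ^ (4 * k - 4)" using 1 2 by simp
    finally have "\<nu> * (?l ^ (2 * k - 1) * (?l + ?l ^ (2 * k - 3))) \<le> \<nu> * (2 * \<Lambda> ^ (3 * k) * ?l ^ (4 * k - 4))"
      using \<nu>_pos by (intro mult_left_mono) auto
    then show "\<nu> * ?l ^ (2 * k - 1) * (?l + ?l ^ (2 * k - 3)) \<le> 2 * \<Lambda> ^ (3 * k) * (?P\<^sup>2 * (1 / sqrt \<nu>)\<^sup>2)"
      unfolding pr four by (simp only: mult_ac)
    have "?l ^ (k - 1) \<le> \<Lambda> ^ (3 * k) * ?l ^ ((k - 1) + (2 * k - 2))"
      using l assms \<Lambda> by (intro power_le_shift) auto
    moreover have "?l ^ (2 * k - 2) * ?l ^ (k - 1) \<le> \<Lambda> ^ (3 * k) * (?l ^ (2 * k - 2) * ?l ^ (k - 1))"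
      using mult_right_mono[OF one_le_power[OF \<Lambda>, of "3 * k"], of "?l ^ (2 * k - 2) * ?l ^ (k - 1)"] l by simp
    ultimately have "?l ^ (k - 1) * (1 + ?l ^ (2 * k - 2)) \<le> 2 * \<Lambda> ^ (3 * k) * (?l ^ (2 * k - 2) * ?l ^ (k - 1))"
      by (simp add: distrib_left power_add mult_ac)
    then have "\<nu> * (?l ^ (k - 1) * (1 + ?l ^ (2 * k - 2))) \<le> \<nu> * (2 * \<Lambda> ^ (3 * k) * (?l ^ (2 * k - 2) * ?l ^ (k - 1)))"
      using \<nu>_pos by (intro mult_left_mono) auto
    then show "\<nu> * ?l ^ (k - 1) * (1 + ?l ^ (2 * k - 2)) \<le> 2 * \<Lambda> ^ (3 * k) * (?P * sqrt ?P * (1 / sqrt \<nu>))"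
      unfolding pr2 by (simp only: mult_ac)
  qed (use \<nu>_pos in simp)
qed

end

end

section \<open>Induced subgraphs of the disk graph\<close>

definition disk_iso :: "'v pair_pre_digraph \<Rightarrow> real \<Rightarrow> 'b::real_normed_vector set \<Rightarrow> bool" where
  "disk_iso \<Gamma> r V \<longleftrightarrow> digraph_iso (with_proj (disk_graph r V)) (with_proj \<Gamma>)"

lemma disk_graph_restrict:
  "V \<subseteq> W \<Longrightarrow> with_proj (disk_graph r W) \<restriction> V = with_proj (disk_graph r V)"
  by (auto simp: with_proj_def induce_subgraph_def disk_graph_def)

text \<open>A digraph isomorphism also carries an arc map. As the arcs of both graphs are pairs of
  vertices, the vertex map forces it to act as \<open>map_prod \<sigma> \<sigma>\<close> on the
  arcs.\<close>

lemma disk_iso_iff: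
  assumes "pair_wf_digraph \<Gamma>"
  shows "disk_iso \<Gamma> r V \<longleftrightarrow> (\<exists>\<sigma>. bij_betw \<sigma> V (pverts \<Gamma>) \<and>
    (\<forall>x\<in>V. \<forall>z\<in>V. norm (x - z) \<in> {0<..<r} \<longleftrightarrow> (\<sigma> x, \<sigma> z) \<in> parcs \<Gamma>))"
proof
  interpret \<Gamma>: pair_wf_digraph \<Gamma> by fact
  let ?G = "with_proj (disk_graph r V)"
  assume "disk_iso \<Gamma> r V"
  then obtain f where f: "pre_digraph.digraph_isomorphism ?G f" "with_proj \<Gamma> = app_iso f ?G"
    by (auto simp: disk_iso_def digraph_iso_def)
  let ?\<sigma> = "iso_verts f"
  have verts: "pverts \<Gamma> = ?\<sigma> ` V" and arcs: "parcs \<Gamma> = iso_arcs f ` parcs (disk_graph r V)"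
    and tail: "iso_tail f = fst" and head: "iso_head f = snd"
    using f(2) by (auto simp: with_proj_def app_iso_def disk_graph_def)
  have inj: "inj_on ?\<sigma> V" and arc: "\<And>a. a \<in> parcs (disk_graph r V) \<Longrightarrow> iso_arcs f a = (?\<sigma> (fst a), ?\<sigma> (snd a))"
    using f(1) tail head by (auto simp: pre_digraph.digraph_isomorphism_def disk_graph_def prod_eq_iff)
  have "norm (x - z) \<in> {0<..<r} \<longleftrightarrow> (?\<sigma> x, ?\<sigma> z) \<in> parcs \<Gamma>" if xz: "x \<in> V" "z \<in> V" for x z
  proof
    assume "norm (x - z) \<in> {0<..<r}"
    then have "(x, z) \<in> parcs (disk_graph r V)" using xz by (simp add: disk_graph_def)
    then have "iso_arcs f (x, z) \<in> parcs \<Gamma>" unfolding arcs by (rule imageI)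
    then show "(?\<sigma> x, ?\<sigma> z) \<in> parcs \<Gamma>" using arc[of "(x, z)"] \<open>(x, z) \<in> parcs (disk_graph r V)\<close> by simp
  next
    assume "(?\<sigma> x, ?\<sigma> z) \<in> parcs \<Gamma>"
    then obtain a where a: "a \<in> parcs (disk_graph r V)" "(?\<sigma> x, ?\<sigma> z) = iso_arcs f a"
      unfolding arcs by auto
    then have "?\<sigma> x = ?\<sigma> (fst a)" "?\<sigma> z = ?\<sigma> (snd a)" using arc by auto
    moreover have "fst a \<in> V" "snd a \<in> V" using a(1) by (auto simp: disk_graph_def)
    ultimately have "x = fst a" "z = snd a" using inj xz by (auto dest: inj_onD)
    then show "norm (x - z) \<in> {0<..<r}" using a(1) by (auto simp: disk_graph_def)
  qed
  then show "\<exists>\<sigma>. bij_betw \<sigma> V (pverts \<Gamma>) \<and>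
    (\<forall>x\<in>V. \<forall>z\<in>V. norm (x - z) \<in> {0<..<r} \<longleftrightarrow> (\<sigma> x, \<sigma> z) \<in> parcs \<Gamma>)"
    using inj verts by (intro exI[of _ ?\<sigma>]) (auto simp: bij_betw_def)
next
  interpret \<Gamma>: pair_wf_digraph \<Gamma> by fact
  let ?G = "with_proj (disk_graph r V)"
  assume "\<exists>\<sigma>. bij_betw \<sigma> V (pverts \<Gamma>) \<and>
    (\<forall>x\<in>V. \<forall>z\<in>V. norm (x - z) \<in> {0<..<r} \<longleftrightarrow> (\<sigma> x, \<sigma> z) \<in> parcs \<Gamma>)"
  then obtain \<sigma> where inj: "inj_on \<sigma> V" and verts: "\<sigma> ` V = pverts \<Gamma>"
    and arc: "\<And>x z. x \<in> V \<Longrightarrow> z \<in> V \<Longrightarrow> norm (x - z) \<in> {0<..<r} \<longleftrightarrow> (\<sigma> x, \<sigma> z) \<in> parcs \<Gamma>"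
    by (auto simp: bij_betw_def)
  define f where "f = \<lparr>iso_verts = \<sigma>, iso_arcs = map_prod \<sigma> \<sigma>, iso_head = snd, iso_tail = fst\<rparr>"
  have "wf_digraph ?G" by unfold_locales (auto simp: disk_graph_def)
  moreover have "inj_on (map_prod \<sigma> \<sigma>) (parcs (disk_graph r V))"
    by (rule inj_on_subset[OF map_prod_inj_on[OF inj inj]]) (auto simp: disk_graph_def)
  ultimately have "pre_digraph.digraph_isomorphism ?G f"
    using inj by (auto simp: pre_digraph.digraph_isomorphism_def f_def disk_graph_def)
  moreover have "map_prod \<sigma> \<sigma> ` parcs (disk_graph r V) = parcs \<Gamma>"
  proof
    show "map_prod \<sigma> \<sigma> ` parcs (disk_graph r V) \<subseteq> parcs \<Gamma>"
    proof
      fix e assume "e \<in> map_prod \<sigma> \<sigma> ` parcs (disk_graph r V)"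
      then obtain x z where "e = (\<sigma> x, \<sigma> z)" "x \<in> V" "z \<in> V" "norm (x - z) \<in> {0<..<r}"
        by (auto simp: disk_graph_def)
      then show "e \<in> parcs \<Gamma>" using arc by blast
    qed
    show "parcs \<Gamma> \<subseteq> map_prod \<sigma> \<sigma> ` parcs (disk_graph r V)"
    proof
      fix e assume e: "e \<in> parcs \<Gamma>"
      then have "fst e \<in> \<sigma> ` V" "snd e \<in> \<sigma> ` V"
        unfolding verts by (auto intro: \<Gamma>.arc_fst_in_verts \<Gamma>.arc_snd_in_verts)
      then obtain x z where xz: "x \<in> V" "z \<in> V" "e = (\<sigma> x, \<sigma> z)" by (metis imageE prod.collapse)
      then have "(x, z) \<in> parcs (disk_graph r V)" using arc[of x z] e by (auto simp: disk_graph_def)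
      then show "e \<in> map_prod \<sigma> \<sigma> ` parcs (disk_graph r V)"
        using xz(3) by (intro image_eqI[of _ _ "(x, z)"]) auto
    qed
  qed
  then have "with_proj \<Gamma> = app_iso f ?G"
    using verts by (simp add: with_proj_def app_iso_def f_def) (simp add: disk_graph_def)
  ultimately show "disk_iso \<Gamma> r V" by (auto simp: disk_iso_def digraph_iso_def)
qed

lemma disk_iso_card: "pair_wf_digraph \<Gamma> \<Longrightarrow> disk_iso \<Gamma> r V \<Longrightarrow> card V = card (pverts \<Gamma>)"
  by (auto simp: disk_iso_iff bij_betw_same_card)

lemma disk_iso_scale:
  assumes wf: "pair_wf_digraph \<Gamma>" and c: "c > 0"
  shows "disk_iso \<Gamma> (c * r) ((\<lambda>x. a + c *\<^sub>R x) ` V) \<longleftrightarrow> disk_iso \<Gamma> r V"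
proof -
  let ?s = "\<lambda>x. a + c *\<^sub>R x"
  have inj: "inj_on ?s V" using c by (auto simp: inj_on_def)
  have n: "norm (?s x - ?s z) \<in> {0<..<c * r} \<longleftrightarrow> norm (x - z) \<in> {0<..<r}" for x z
  proof -
    have "?s x - ?s z = c *\<^sub>R (x - z)" by (simp add: scaleR_diff_right)
    then show ?thesis using c by (simp add: zero_less_mult_iff)
  qed
  show ?thesis
  proof
    assume "disk_iso \<Gamma> (c * r) (?s ` V)"
    then obtain \<sigma> where \<sigma>: "bij_betw \<sigma> (?s ` V) (pverts \<Gamma>)"
      "\<And>x z. x \<in> ?s ` V \<Longrightarrow> z \<in> ?s ` V \<Longrightarrow> norm (x - z) \<in> {0<..<c * r} \<longleftrightarrow> (\<sigma> x, \<sigma> z) \<in> parcs \<Gamma>"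
      unfolding disk_iso_iff[OF wf] by blast
    have "bij_betw (\<sigma> \<circ> ?s) V (pverts \<Gamma>)"
      by (rule bij_betw_trans[OF inj_on_imp_bij_betw[OF inj] \<sigma>(1)])
    moreover have "norm (x - z) \<in> {0<..<r} \<longleftrightarrow> ((\<sigma> \<circ> ?s) x, (\<sigma> \<circ> ?s) z) \<in> parcs \<Gamma>" if "x \<in> V" "z \<in> V" for x z
    proof -
      have "norm (?s x - ?s z) \<in> {0<..<c * r} \<longleftrightarrow> (\<sigma> (?s x), \<sigma> (?s z)) \<in> parcs \<Gamma>"
        using that by (intro \<sigma>(2)) auto
      then show ?thesis unfolding n by (simp only: comp_apply)
    qed
    ultimately show "disk_iso \<Gamma> r V" unfolding disk_iso_iff[OF wf] by blast
  next
    assume "disk_iso \<Gamma> r V"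
    then obtain \<sigma> where \<sigma>: "bij_betw \<sigma> V (pverts \<Gamma>)"
      "\<And>x z. x \<in> V \<Longrightarrow> z \<in> V \<Longrightarrow> norm (x - z) \<in> {0<..<r} \<longleftrightarrow> (\<sigma> x, \<sigma> z) \<in> parcs \<Gamma>"
      unfolding disk_iso_iff[OF wf] by blast
    let ?i = "inv_into V ?s"
    have i: "?i (?s x) = x" if "x \<in> V" for x using inv_into_f_f[OF inj that] .
    have "bij_betw (\<sigma> \<circ> ?i) (?s ` V) (pverts \<Gamma>)"
      by (rule bij_betw_trans[OF bij_betw_inv_into[OF inj_on_imp_bij_betw[OF inj]] \<sigma>(1)])
    moreover have "norm (x - z) \<in> {0<..<c * r} \<longleftrightarrow> ((\<sigma> \<circ> ?i) x, (\<sigma> \<circ> ?i) z) \<in> parcs \<Gamma>"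
      if xz: "x \<in> ?s ` V" "z \<in> ?s ` V" for x z
    proof -
      obtain x' z' where x': "x = ?s x'" "x' \<in> V" "z = ?s z'" "z' \<in> V" using xz by blast
      have "norm (?s x' - ?s z') \<in> {0<..<c * r} \<longleftrightarrow> (\<sigma> (?i (?s x')), \<sigma> (?i (?s z'))) \<in> parcs \<Gamma>"
        unfolding n i[OF x'(2)] i[OF x'(4)] using x' by (intro \<sigma>(2))
      then show ?thesis unfolding x'(1,3) by (simp only: comp_apply)
    qed
    ultimately show "disk_iso \<Gamma> (c * r) (?s ` V)" unfolding disk_iso_iff[OF wf] by blast
  qed
qed

text \<open>A path in \<open>\<Gamma>\<close> has fewer than \<open>card (pverts \<Gamma>)\<close>
  arcs, and each spans a distance less than \<open>r\<close>. Connectedness refers to the symmetric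
  closure, which adds no reachability to a \<open>pair_graph\<close>.\<close>

lemma disk_iso_dist_le:
  assumes \<Gamma>: "pair_graph \<Gamma>" and conn: "connected (with_proj \<Gamma>)"
    and iso: "disk_iso \<Gamma> r V" and x: "x \<in> V" "z \<in> V" and r: "r > 0"
  shows "norm (x - z) \<le> real (card (pverts \<Gamma>)) * r"
proof -
  interpret \<Gamma>: pair_graph \<Gamma> by fact
  obtain \<sigma> where \<sigma>: "bij_betw \<sigma> V (pverts \<Gamma>)"
    and arc: "\<And>x z. x \<in> V \<Longrightarrow> z \<in> V \<Longrightarrow> norm (x - z) \<in> {0<..<r} \<longleftrightarrow> (\<sigma> x, \<sigma> z) \<in> parcs \<Gamma>"
    using iso unfolding disk_iso_iff[OF \<Gamma>.pair_wf_digraph_axioms] by blast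
  let ?\<psi> = "inv_into V \<sigma>"
  have \<psi>: "?\<psi> u \<in> V" "\<sigma> (?\<psi> u) = u" if "u \<in> pverts \<Gamma>" for u
    using that \<sigma> by (auto simp: bij_betw_def inv_into_into f_inv_into_f)
  have step: "norm (?\<psi> (fst e) - ?\<psi> (snd e)) \<le> r" if "e \<in> parcs \<Gamma>" for e
  proof -
    have "fst e \<in> pverts \<Gamma>" "snd e \<in> pverts \<Gamma>" using that by (auto intro: \<Gamma>.arc_fst_in_verts \<Gamma>.arc_snd_in_verts)
    then show ?thesis using arc[of "?\<psi> (fst e)" "?\<psi> (snd e)"] \<psi> that by simp
  qed
  have walk: "norm (?\<psi> u - ?\<psi> v) \<le> real (length p) * r" if "\<Gamma>.awalk u p v" for u p v
    using that
  proof (induction p arbitrary: u)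
    case Nil
    then show ?case by (simp add: \<Gamma>.awalk_Nil_iff)
  next
    case (Cons e p)
    then have e: "e \<in> parcs \<Gamma>" "u = fst e" "\<Gamma>.awalk (snd e) p v" by (auto simp: \<Gamma>.awalk_Cons_iff)
    have "norm (?\<psi> u - ?\<psi> v) \<le> norm (?\<psi> (fst e) - ?\<psi> (snd e)) + norm (?\<psi> (snd e) - ?\<psi> v)"
      unfolding e(2) using norm_triangle_ineq[of "?\<psi> (fst e) - ?\<psi> (snd e)" "?\<psi> (snd e) - ?\<psi> v"] by simp
    also have "\<dots> \<le> r + real (length p) * r" using step[OF e(1)] Cons.IH[OF e(3)] by (rule add_mono)
    finally show ?case by (simp add: algebra_simps)
  qed
  have uv: "\<sigma> x \<in> pverts \<Gamma>" "\<sigma> z \<in> pverts \<Gamma>" using \<sigma> x by (auto simp: bij_betw_def)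
  have "\<sigma> x \<rightarrow>\<^sup>*\<^bsub>mk_symmetric (with_proj \<Gamma>)\<^esub> \<sigma> z"
    using conn uv by (auto simp: connected_def strongly_connected_def)
  then have "\<sigma> x \<rightarrow>\<^sup>*\<^bsub>with_proj \<Gamma>\<^esub> \<sigma> z"
    using \<Gamma>.reachable_mk_symmetric_eq[OF \<Gamma>.sym_arcs] by simp
  then obtain p where p: "\<Gamma>.apath (\<sigma> x) p (\<sigma> z)" using \<Gamma>.reachable_apath by blast
  then have "norm (?\<psi> (\<sigma> x) - ?\<psi> (\<sigma> z)) \<le> real (length p) * r" by (intro walk \<Gamma>.awalkI_apath)
  moreover have "?\<psi> (\<sigma> x) = x" "?\<psi> (\<sigma> z) = z" using \<sigma> x by (auto simp: bij_betw_def)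
  moreover have "real (length p) * r \<le> real (card (pverts \<Gamma>)) * r"
    using \<Gamma>.length_apath_less[OF p] r by (intro mult_right_mono) auto
  ultimately show ?thesis by simp
qed

text \<open>The vertex set, and with it the domain of an isomorphism, depends on the sample point.
  Pulled back to the fixed index set \<open>I\<close>, isomorphisms range over finitely many
  bijections \<open>\<tau>\<close>; the cardinality condition forces the points with index in
  \<open>I\<close> to be distinct.\<close>

lemma measurable_disk_iso:
  fixes Y :: "nat \<Rightarrow> 'a \<Rightarrow> 'b::euclidean_space"
  assumes \<Gamma>: "pair_graph \<Gamma>" and I: "finite I" "card I = card (pverts \<Gamma>)"
    and Y: "\<And>i. i \<in> I \<Longrightarrow> Y i \<in> borel_measurable M"
  shows "Measurable.pred M (\<lambda>\<omega>. disk_iso \<Gamma> r ((\<lambda>i. Y i \<omega>) ` I))"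
proof -
  interpret \<Gamma>: pair_graph \<Gamma> by fact
  let ?W = "{\<tau> \<in> I \<rightarrow>\<^sub>E pverts \<Gamma>. bij_betw \<tau> I (pverts \<Gamma>)}"
  have "finite (I \<rightarrow>\<^sub>E pverts \<Gamma>)" using I(1) \<Gamma>.pair_finite_verts by (intro finite_PiE)
  then have fin: "finite ?W" by (rule finite_subset[rotated]) auto
  have "disk_iso \<Gamma> r (y ` I) \<longleftrightarrow> (\<forall>i\<in>I. \<forall>j\<in>I. i \<noteq> j \<longrightarrow> 0 < norm (y i - y j)) \<and>
      (\<exists>\<tau>\<in>?W. \<forall>i\<in>I. \<forall>j\<in>I. (0 < norm (y i - y j) \<and> norm (y i - y j) < r) = ((\<tau> i, \<tau> j) \<in> parcs \<Gamma>))"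
    (is "?L \<longleftrightarrow> ?R") for y :: "nat \<Rightarrow> 'b"
  proof
    assume L: ?L
    then obtain \<sigma> where \<sigma>: "bij_betw \<sigma> (y ` I) (pverts \<Gamma>)"
      "\<And>x z. x \<in> y ` I \<Longrightarrow> z \<in> y ` I \<Longrightarrow> norm (x - z) \<in> {0<..<r} \<longleftrightarrow> (\<sigma> x, \<sigma> z) \<in> parcs \<Gamma>"
      unfolding disk_iso_iff[OF \<Gamma>.pair_wf_digraph_axioms] by blast
    have inj: "inj_on y I"
      using disk_iso_card[OF \<Gamma>.pair_wf_digraph_axioms L] I by (intro eq_card_imp_inj_on) auto
    have b: "bij_betw (\<sigma> \<circ> y) I (pverts \<Gamma>)"
      by (rule bij_betw_trans[OF inj_on_imp_bij_betw[OF inj] \<sigma>(1)])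
    let ?\<tau> = "restrict (\<sigma> \<circ> y) I"
    have "bij_betw ?\<tau> I (pverts \<Gamma>)" using b by (subst bij_betw_cong[of _ _ "\<sigma> \<circ> y"]) auto
    then have "?\<tau> \<in> ?W" by (auto simp: bij_betw_def)
    moreover have "\<forall>i\<in>I. \<forall>j\<in>I. (0 < norm (y i - y j) \<and> norm (y i - y j) < r) = ((?\<tau> i, ?\<tau> j) \<in> parcs \<Gamma>)"
      using \<sigma>(2) by auto
    moreover have "\<forall>i\<in>I. \<forall>j\<in>I. i \<noteq> j \<longrightarrow> 0 < norm (y i - y j)"
      using inj by (auto dest: inj_onD)
    ultimately show ?R by blast
  next
    assume R: ?R
    then obtain \<tau> where \<tau>: "bij_betw \<tau> I (pverts \<Gamma>)"
      "\<And>i j. i \<in> I \<Longrightarrow> j \<in> I \<Longrightarrow> (0 < norm (y i - y j) \<and> norm (y i - y j) < r) = ((\<tau> i, \<tau> j) \<in> parcs \<Gamma>)"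
      by blast
    have "inj_on y I" using R by (auto simp: inj_on_def)
    then have i: "inv_into I y (y i) = i" if "i \<in> I" for i using that by simp
    have "bij_betw (\<tau> \<circ> inv_into I y) (y ` I) (pverts \<Gamma>)"
      by (rule bij_betw_trans[OF bij_betw_inv_into[OF inj_on_imp_bij_betw[OF \<open>inj_on y I\<close>]] \<tau>(1)])
    moreover have "\<forall>x\<in>y ` I. \<forall>z\<in>y ` I. norm (x - z) \<in> {0<..<r} \<longleftrightarrow>
        ((\<tau> \<circ> inv_into I y) x, (\<tau> \<circ> inv_into I y) z) \<in> parcs \<Gamma>"
      using \<tau>(2) by (simp add: i)
    ultimately show ?L unfolding disk_iso_iff[OF \<Gamma>.pair_wf_digraph_axioms] by blast
  qed
  moreover have "Measurable.pred M (\<lambda>\<omega>. (\<forall>i\<in>I. \<forall>j\<in>I. i \<noteq> j \<longrightarrow> 0 < norm (Y i \<omega> - Y j \<omega>)) \<and>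
      (\<exists>\<tau>\<in>?W. \<forall>i\<in>I. \<forall>j\<in>I. (0 < norm (Y i \<omega> - Y j \<omega>) \<and> norm (Y i \<omega> - Y j \<omega>) < r) = ((\<tau> i, \<tau> j) \<in> parcs \<Gamma>)))"
  proof -
    have n: "(\<lambda>\<omega>. norm (Y i \<omega> - Y j \<omega>)) \<in> borel_measurable M" if "i \<in> I" "j \<in> I" for i j
      using Y that by measurable
    have p: "Measurable.pred M (\<lambda>\<omega>. 0 < norm (Y i \<omega> - Y j \<omega>))" "Measurable.pred M (\<lambda>\<omega>. norm (Y i \<omega> - Y j \<omega>) < r)"
      if "i \<in> I" "j \<in> I" for i j
      using n[OF that] by measurable
    show ?thesis
      by (intro pred_intros_logic pred_intros_finite fin I(1) p) auto
  qed
  ultimately show ?thesis by (simp only:)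
qed

text \<open>The one-point comparison \<open>base\<close> is iterated over the coordinates by
  Tonelli's theorem. It serves in both directions between Lebesgue measure and the law with density
  \<open>f\<close>: with an upper bound of \<open>f\<close> that holds everywhere, and with a lower
  bound that holds only near a point, whence the set \<open>S\<close>.\<close>

lemma product_nn_integral_le:
  fixes N N' :: "'b measure" and T :: "'b \<Rightarrow> 'b" and c :: ennreal
  assumes N: "sigma_finite_measure N" and N': "sigma_finite_measure N'"
    and T[measurable]: "T \<in> measurable N N'" and S[measurable]: "S \<in> sets N'"
    and base: "\<And>\<phi>. \<phi> \<in> borel_measurable N' \<Longrightarrow> (\<integral>\<^sup>+z. \<phi> z * indicator S z \<partial>N') \<le> c * (\<integral>\<^sup>+y. \<phi> (T y) \<partial>N)"
    and I: "finite I" and \<Phi>: "\<Phi> \<in> borel_measurable (PiM I (\<lambda>_. N'))"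
  shows "(\<integral>\<^sup>+z. \<Phi> z * of_bool (\<forall>i\<in>I. z i \<in> S) \<partial>PiM I (\<lambda>_. N'))
    \<le> c ^ card I * (\<integral>\<^sup>+y. \<Phi> (\<lambda>i\<in>I. T (y i)) \<partial>PiM I (\<lambda>_. N))"
  using I \<Phi>
proof (induction I arbitrary: \<Phi> rule: finite_induct)
  case empty
  show ?case by (simp add: PiM_empty nn_integral_count_space_finite restrict_def)
next
  case (insert i I)
  interpret N: product_sigma_finite "\<lambda>_. N" using N by (simp add: product_sigma_finite_def)
  interpret N': product_sigma_finite "\<lambda>_. N'" using N' by (simp add: product_sigma_finite_def)
  note [measurable] = insert.prems
  have m_upd[measurable]: "(\<lambda>(z, w). \<Phi> (z(i := w))) \<in> borel_measurable (PiM I (\<lambda>_. N') \<Otimes>\<^sub>M N')"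
    using measurable_compose[OF measurable_add_dim[of i I "\<lambda>_. N'"] insert.prems]
    by (simp add: case_prod_beta')
  define \<Phi>' where "\<Phi>' z = c * (\<integral>\<^sup>+w. \<Phi> (z(i := T w)) \<partial>N)" for z
  have mT: "(\<lambda>(z, w). \<Phi> (z(i := T w))) \<in> borel_measurable (PiM I (\<lambda>_. N') \<Otimes>\<^sub>M N)"
  proof -
    have "(\<lambda>p. (fst p, T (snd p))) \<in> measurable (PiM I (\<lambda>_. N') \<Otimes>\<^sub>M N) (PiM I (\<lambda>_. N') \<Otimes>\<^sub>M N')"
      by measurable
    from measurable_compose[OF this m_upd] show ?thesis by (simp add: case_prod_beta')
  qed
  have m': "\<Phi>' \<in> borel_measurable (PiM I (\<lambda>_. N'))"
  proof -
    have "(\<lambda>z. \<integral>\<^sup>+w. \<Phi> (z(i := T w)) \<partial>N) \<in> borel_measurable (PiM I (\<lambda>_. N'))"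
      using sigma_finite_measure.borel_measurable_nn_integral_fst[OF N mT] by simp
    then show ?thesis unfolding \<Phi>'_def[abs_def] by measurable
  qed
  have mS: "(\<lambda>z. of_bool (\<forall>j\<in>J. z j \<in> S) :: ennreal) \<in> borel_measurable (PiM J (\<lambda>_. N'))"
    if "finite J" for J
  proof -
    have "Measurable.pred (PiM J (\<lambda>_. N')) (\<lambda>z. \<forall>j\<in>J. z j \<in> S)"
      by (intro pred_intros_finite that pred_sets2[OF S] measurable_component_singleton)
    then have "(\<lambda>z. if \<forall>j\<in>J. z j \<in> S then 1 else 0 :: ennreal) \<in> borel_measurable (PiM J (\<lambda>_. N'))"
      by measurable
    then show ?thesis by (simp add: of_bool_def)
  qed
  have "(\<integral>\<^sup>+z. \<Phi> z * of_bool (\<forall>j\<in>insert i I. z j \<in> S) \<partial>PiM (insert i I) (\<lambda>_. N'))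
      = (\<integral>\<^sup>+z. (\<integral>\<^sup>+w. \<Phi> (z(i := w)) * of_bool (\<forall>j\<in>insert i I. (z(i := w)) j \<in> S) \<partial>N') \<partial>PiM I (\<lambda>_. N'))"
    using insert.hyps
    by (intro N'.product_nn_integral_insert borel_measurable_times_ennreal insert.prems mS) auto
  also have "\<dots> = (\<integral>\<^sup>+z. (\<integral>\<^sup>+w. \<Phi> (z(i := w)) * indicator S w \<partial>N') * of_bool (\<forall>j\<in>I. z j \<in> S) \<partial>PiM I (\<lambda>_. N'))"
  proof (rule nn_integral_cong)
    fix z assume z: "z \<in> space (PiM I (\<lambda>_. N'))"
    have "(\<forall>j\<in>insert i I. (z(i := w)) j \<in> S) \<longleftrightarrow> w \<in> S \<and> (\<forall>j\<in>I. z j \<in> S)" for w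
      using insert.hyps(2) by auto
    then have "\<Phi> (z(i := w)) * of_bool (\<forall>j\<in>insert i I. (z(i := w)) j \<in> S)
        = (\<Phi> (z(i := w)) * indicator S w) * of_bool (\<forall>j\<in>I. z j \<in> S)" for w
      by (auto simp: indicator_def)
    moreover have "(\<lambda>w. \<Phi> (z(i := w)) * indicator S w) \<in> borel_measurable N'"
      using measurable_compose[OF measurable_Pair1'[OF z] m_upd]
      by (intro borel_measurable_times_ennreal) auto
    ultimately show "(\<integral>\<^sup>+w. \<Phi> (z(i := w)) * of_bool (\<forall>j\<in>insert i I. (z(i := w)) j \<in> S) \<partial>N')
        = (\<integral>\<^sup>+w. \<Phi> (z(i := w)) * indicator S w \<partial>N') * of_bool (\<forall>j\<in>I. z j \<in> S)"
      by (simp only: nn_integral_multc)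
  qed
  also have "\<dots> \<le> (\<integral>\<^sup>+z. \<Phi>' z * of_bool (\<forall>j\<in>I. z j \<in> S) \<partial>PiM I (\<lambda>_. N'))"
  proof (rule nn_integral_mono)
    fix z assume z: "z \<in> space (PiM I (\<lambda>_. N'))"
    have "(\<lambda>w. \<Phi> (z(i := w))) \<in> borel_measurable N'"
      using measurable_compose[OF measurable_Pair1'[OF z] m_upd] by simp
    from base[OF this]
    show "(\<integral>\<^sup>+w. \<Phi> (z(i := w)) * indicator S w \<partial>N') * of_bool (\<forall>j\<in>I. z j \<in> S)
        \<le> \<Phi>' z * of_bool (\<forall>j\<in>I. z j \<in> S)"
      unfolding \<Phi>'_def by (intro mult_right_mono) auto
  qed
  also have "\<dots> \<le> c ^ card I * (\<integral>\<^sup>+y. \<Phi>' (\<lambda>j\<in>I. T (y j)) \<partial>PiM I (\<lambda>_. N))"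
    by (rule insert.IH[OF m'])
  also have "(\<integral>\<^sup>+y. \<Phi>' (\<lambda>j\<in>I. T (y j)) \<partial>PiM I (\<lambda>_. N))
      = (\<integral>\<^sup>+y. c * (\<integral>\<^sup>+w. \<Phi> (\<lambda>j\<in>insert i I. T ((y(i := w)) j)) \<partial>N) \<partial>PiM I (\<lambda>_. N))"
  proof (rule nn_integral_cong)
    fix y
    have "(\<lambda>j\<in>I. T (y j))(i := T w) = (\<lambda>j\<in>insert i I. T ((y(i := w)) j))" for w
      using insert.hyps(2) by (auto simp: fun_eq_iff)
    then show "\<Phi>' (\<lambda>j\<in>I. T (y j)) = c * (\<integral>\<^sup>+w. \<Phi> (\<lambda>j\<in>insert i I. T ((y(i := w)) j)) \<partial>N)"
      by (simp only: \<Phi>'_def)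
  qed
  also have "\<dots> = c * (\<integral>\<^sup>+y. \<Phi> (\<lambda>j\<in>insert i I. T (y j)) \<partial>PiM (insert i I) (\<lambda>_. N))"
  proof -
    have "(\<lambda>y. \<lambda>j\<in>insert i I. T (y j)) \<in> measurable (PiM (insert i I) (\<lambda>_. N)) (PiM (insert i I) (\<lambda>_. N'))"
    proof (rule measurable_restrict)
      fix j assume "j \<in> insert i I"
      then have "(\<lambda>y. y j) \<in> measurable (PiM (insert i I) (\<lambda>_. N)) N" by (rule measurable_component_singleton)
      then show "(\<lambda>y. T (y j)) \<in> measurable (PiM (insert i I) (\<lambda>_. N)) N'" by (rule measurable_compose[OF _ T])
    qed
    from measurable_compose[OF this insert.prems]
    have m: "(\<lambda>y. \<Phi> (\<lambda>j\<in>insert i I. T (y j))) \<in> borel_measurable (PiM (insert i I) (\<lambda>_. N))" .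
    have "(\<lambda>(y, w). \<Phi> (\<lambda>j\<in>insert i I. T ((y(i := w)) j))) \<in> borel_measurable (PiM I (\<lambda>_. N) \<Otimes>\<^sub>M N)"
      using measurable_compose[OF measurable_add_dim[of i I "\<lambda>_. N"] m] by (simp add: case_prod_beta')
    from sigma_finite_measure.borel_measurable_nn_integral_fst[OF N this]
    show ?thesis
      by (simp only: N.product_nn_integral_insert[OF insert.hyps m]) (rule nn_integral_cmult, simp)
  qed
  finally show ?case by (simp only: card_insert_disjoint[OF insert.hyps] power_Suc mult_ac)
qed

lemma nn_integral_lborel_affine:
  fixes t :: "'b::euclidean_space"
  assumes [measurable]: "\<phi> \<in> borel_measurable borel" and c: "c \<noteq> 0"
  shows "(\<integral>\<^sup>+x. \<phi> x \<partial>lborel) = ennreal (\<bar>c\<bar> ^ DIM('b)) * (\<integral>\<^sup>+x. \<phi> (t + c *\<^sub>R x) \<partial>lborel)"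
  by (subst lborel_affine[OF c, of t])
     (simp add: nn_integral_density nn_integral_distr nn_integral_cmult)

section \<open>The probability that k points form the graph, by scaling\<close>

context
  fixes f :: "'b::euclidean_space \<Rightarrow> real" and \<Gamma> :: "'v pair_pre_digraph" and k :: nat and b :: real
  assumes f_meas[measurable]: "f \<in> borel_measurable borel" and f_nonneg: "\<And>x. 0 \<le> f x"
    and f_le: "\<And>x. f x \<le> b" and b: "b > 0"
    and prob: "prob_space (density lborel (\<lambda>x. ennreal (f x)))"
    and \<Gamma>: "pair_graph \<Gamma>" "connected (with_proj \<Gamma>)" "card (pverts \<Gamma>) = k" and k2: "k \<ge> 2"
begin

definition "Df = density lborel (\<lambda>x. ennreal (f x))"

lemma sets_Df[measurable_cong, simp]: "sets Df = sets borel" and space_Df[simp]: "space Df = UNIV"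
  by (simp_all add: Df_def)

lemma prob_Df: "prob_space Df" using prob by (simp add: Df_def)

lemma wf_\<Gamma>: "pair_wf_digraph \<Gamma>"
proof -
  interpret pair_graph \<Gamma> by (rule \<Gamma>(1))
  show ?thesis by unfold_locales
qed

abbreviation "vertices \<equiv> {1..<k}"

definition iso_ind :: "real \<Rightarrow> 'b \<Rightarrow> (nat \<Rightarrow> 'b) \<Rightarrow> ennreal" where
  "iso_ind r x y = of_bool (disk_iso \<Gamma> r (insert x (y ` vertices)))"

lemma measurable_iso:
  assumes "sets N = sets borel"
  shows "iso_ind r x \<in> borel_measurable (PiM vertices (\<lambda>_. N))"
    and "(\<lambda>y. of_bool (disk_iso \<Gamma> r (y ` {..<k})) :: ennreal) \<in> borel_measurable (PiM {..<k} (\<lambda>_. N))"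
proof -
  have k0: "{..<k} = insert 0 vertices" using k2 by auto
  have Y: "(\<lambda>y. (y(0 := x)) i) \<in> borel_measurable (PiM vertices (\<lambda>_. N))" if "i \<in> {..<k}" for i
  proof (cases "i = 0")
    case False
    then have "i \<in> vertices" using that by auto
    then have "(\<lambda>y. y i) \<in> measurable (PiM vertices (\<lambda>_. N)) N" by (rule measurable_component_singleton)
    then show ?thesis using False assms by (simp cong: measurable_cong_sets)
  qed simp
  have eq: "(\<lambda>i. (y(0 := x)) i) ` {..<k} = insert x (y ` vertices)" for y
    unfolding k0 by (auto simp: image_iff)
  have "Measurable.pred (PiM vertices (\<lambda>_. N)) (\<lambda>y. disk_iso \<Gamma> r ((\<lambda>i. (y(0 := x)) i) ` {..<k}))"
    using \<Gamma>(3) by (intro measurable_disk_iso[OF \<Gamma>(1)] Y) auto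
  then have p: "Measurable.pred (PiM vertices (\<lambda>_. N)) (\<lambda>y. disk_iso \<Gamma> r (insert x (y ` vertices)))"
    by (simp only: eq)
  then have "(\<lambda>y. if disk_iso \<Gamma> r (insert x (y ` vertices)) then 1 else 0 :: ennreal) \<in> borel_measurable (PiM vertices (\<lambda>_. N))"
    by measurable
  then show "iso_ind r x \<in> borel_measurable (PiM vertices (\<lambda>_. N))"
    by (simp add: iso_ind_def[abs_def] of_bool_def)
  have Y': "(\<lambda>y. y i) \<in> borel_measurable (PiM {..<k} (\<lambda>_. N))" if "i \<in> {..<k}" for i
    using measurable_component_singleton[of i "{..<k}" "\<lambda>_. N"] that assms by (simp cong: measurable_cong_sets)
  have "Measurable.pred (PiM {..<k} (\<lambda>_. N)) (\<lambda>y. disk_iso \<Gamma> r ((\<lambda>i. y i) ` {..<k}))"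
    using \<Gamma>(3) by (intro measurable_disk_iso[OF \<Gamma>(1)] Y') auto
  then have "(\<lambda>y. if disk_iso \<Gamma> r (y ` {..<k}) then 1 else 0 :: ennreal) \<in> borel_measurable (PiM {..<k} (\<lambda>_. N))"
    by measurable
  then show "(\<lambda>y. of_bool (disk_iso \<Gamma> r (y ` {..<k})) :: ennreal) \<in> borel_measurable (PiM {..<k} (\<lambda>_. N))"
    by (simp add: of_bool_def)
qed

lemma emeasure_disk_iso:
  "emeasure (PiM UNIV (\<lambda>_. Df)) {y. disk_iso \<Gamma> r (y ` {..<k})}
    = (\<integral>\<^sup>+x. (\<integral>\<^sup>+y. iso_ind r x y \<partial>PiM vertices (\<lambda>_. Df)) \<partial>Df)"
proof -
  interpret D: prob_space Df by (rule prob_Df)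
  interpret P: product_prob_space "\<lambda>_. Df" "UNIV :: nat set" by unfold_locales
  have k0: "{..<k} = insert 0 vertices" "0 \<notin> vertices" using k2 by auto
  let ?A = "{y \<in> space (PiM {..<k} (\<lambda>_. Df)). disk_iso \<Gamma> r (y ` {..<k})}"
  have m: "(\<lambda>y. of_bool (disk_iso \<Gamma> r (y ` {..<k})) :: ennreal) \<in> borel_measurable (PiM {..<k} (\<lambda>_. Df))"
    by (rule measurable_iso) simp
  have "?A = (\<lambda>y. of_bool (disk_iso \<Gamma> r (y ` {..<k})) :: ennreal) -` {1} \<inter> space (PiM {..<k} (\<lambda>_. Df))"
    by auto
  also have "\<dots> \<in> sets (PiM {..<k} (\<lambda>_. Df))" using m by (rule measurable_sets) simp
  finally have A: "?A \<in> sets (PiM {..<k} (\<lambda>_. Df))" .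
  have "emeasure (PiM UNIV (\<lambda>_. Df)) {y. disk_iso \<Gamma> r (y ` {..<k})}
      = emeasure (distr (PiM UNIV (\<lambda>_. Df)) (PiM {..<k} (\<lambda>_. Df)) (\<lambda>y. restrict y {..<k})) ?A"
  proof (subst emeasure_distr[OF _ A])
    show "(\<lambda>y. restrict y {..<k}) \<in> measurable (PiM UNIV (\<lambda>_. Df)) (PiM {..<k} (\<lambda>_. Df))"
      by (rule measurable_restrict_subset) simp
    have "(\<lambda>y. restrict y {..<k}) -` ?A \<inter> space (PiM UNIV (\<lambda>_. Df)) = {y. disk_iso \<Gamma> r (y ` {..<k})}"
      by (auto simp: space_PiM PiE_iff image_restrict_eq extensional_def)
    then show "emeasure (PiM UNIV (\<lambda>_. Df)) {y. disk_iso \<Gamma> r (y ` {..<k})}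
      = emeasure (PiM UNIV (\<lambda>_. Df)) ((\<lambda>y. restrict y {..<k}) -` ?A \<inter> space (PiM UNIV (\<lambda>_. Df)))" by simp
  qed
  also have "\<dots> = emeasure (PiM {..<k} (\<lambda>_. Df)) ?A"
    by (subst P.distr_PiM_restrict_finite) auto
  also have "\<dots> = (\<integral>\<^sup>+y. of_bool (disk_iso \<Gamma> r (y ` {..<k})) \<partial>PiM {..<k} (\<lambda>_. Df))"
    unfolding nn_integral_indicator[OF A, symmetric]
    by (intro nn_integral_cong) (auto simp: indicator_def)
  also have "\<dots> = (\<integral>\<^sup>+x. (\<integral>\<^sup>+y. of_bool (disk_iso \<Gamma> r ((y(0 := x)) ` {..<k})) \<partial>PiM vertices (\<lambda>_. Df)) \<partial>Df)"
    using m k0(2) unfolding k0(1) by (intro P.product_nn_integral_insert_rev) auto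
  also have "\<dots> = (\<integral>\<^sup>+x. (\<integral>\<^sup>+y. iso_ind r x y \<partial>PiM vertices (\<lambda>_. Df)) \<partial>Df)"
  proof -
    have "(y(0 := x)) ` {..<k} = insert x (y ` vertices)" for x and y :: "nat \<Rightarrow> 'b"
      unfolding k0(1) by (auto simp: image_iff)
    then show ?thesis by (simp only: iso_ind_def)
  qed
  finally show ?thesis .
qed

text \<open>The volume of the \<open>(k - 1)\<close>-tuples that complete the origin to a copy of
  \<open>\<Gamma>\<close> at radius 1. By scaling it enters the upper and the lower bound at every
  radius.\<close>

definition "unit_volume = (\<integral>\<^sup>+z. iso_ind 1 0 z \<partial>PiM vertices (\<lambda>_. lborel))"

lemma iso_ind_scale:
  assumes "r > 0"
  shows "iso_ind r x (\<lambda>i\<in>vertices. x + r *\<^sub>R z i) = iso_ind 1 0 z"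
proof -
  have "insert x ((\<lambda>i\<in>vertices. x + r *\<^sub>R z i) ` vertices) = (\<lambda>u. x + r *\<^sub>R u) ` insert 0 (z ` vertices)"
    by (auto simp: image_iff)
  then show ?thesis
    using disk_iso_scale[OF wf_\<Gamma> assms, of 1 x "insert 0 (z ` vertices)"] by (simp add: iso_ind_def)
qed

text \<open>The bound \<open>f \<le> b\<close> replaces the law by Lebesgue measure, and the
  substitution \<open>x + r *\<^sub>R z\<close> produces the power of \<open>r\<close>. The purpose
  is to show that \<open>unit_volume\<close> is positive.\<close>

lemma iso_integral_le:
  assumes r: "r > 0"
  shows "(\<integral>\<^sup>+y. iso_ind r x y \<partial>PiM vertices (\<lambda>_. Df)) \<le> ennreal (b * r ^ DIM('b)) ^ (k - 1) * unit_volume"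
proof -
  have "(\<integral>\<^sup>+y. iso_ind r x y * of_bool (\<forall>i\<in>vertices. y i \<in> UNIV) \<partial>PiM vertices (\<lambda>_. Df))
    \<le> ennreal (b * r ^ DIM('b)) ^ card vertices
      * (\<integral>\<^sup>+z. iso_ind r x (\<lambda>i\<in>vertices. x + r *\<^sub>R z i) \<partial>PiM vertices (\<lambda>_. lborel))"
  proof (rule product_nn_integral_le[where T="\<lambda>u. x + r *\<^sub>R u" and S=UNIV])
    interpret D: prob_space Df by (rule prob_Df)
    show "sigma_finite_measure Df" ..
    show "sigma_finite_measure (lborel :: 'b measure)" by (rule sigma_finite_lborel)
    fix \<phi> :: "'b \<Rightarrow> ennreal" assume "\<phi> \<in> borel_measurable Df"
    then have [measurable]: "\<phi> \<in> borel_measurable borel" by (simp cong: measurable_cong_sets)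
    have "(\<integral>\<^sup>+z. \<phi> z * indicator UNIV z \<partial>Df) = (\<integral>\<^sup>+z. ennreal (f z) * \<phi> z \<partial>lborel)"
      unfolding Df_def by (subst nn_integral_density) auto
    also have "\<dots> \<le> (\<integral>\<^sup>+z. ennreal b * \<phi> z \<partial>lborel)"
      using f_le by (intro nn_integral_mono mult_right_mono ennreal_leI) auto
    also have "\<dots> = ennreal b * (\<integral>\<^sup>+z. \<phi> z \<partial>lborel)" by (rule nn_integral_cmult) simp
    also have "(\<integral>\<^sup>+z. \<phi> z \<partial>lborel) = ennreal (\<bar>r\<bar> ^ DIM('b)) * (\<integral>\<^sup>+u. \<phi> (x + r *\<^sub>R u) \<partial>lborel)"
      using r by (intro nn_integral_lborel_affine) auto
    finally show "(\<integral>\<^sup>+z. \<phi> z * indicator UNIV z \<partial>Df) \<le> ennreal (b * r ^ DIM('b)) * (\<integral>\<^sup>+u. \<phi> (x + r *\<^sub>R u) \<partial>lborel)"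
      using r b by (simp add: ennreal_mult mult.assoc)
  qed (use measurable_iso[of Df] in \<open>auto intro!: measurable_iso\<close>)
  then show ?thesis using iso_ind_scale[OF r] by (simp add: unit_volume_def)
qed

text \<open>A copy of the connected graph \<open>\<Gamma>\<close> that contains \<open>x\<close>
  lies in the ball of radius \<open>k * r\<close> around \<open>x\<close>, where \<open>f\<close> is
  at least \<open>a\<close>. After rescaling this is the ball \<open>?S\<close>, so restricting the
  integral to it loses nothing.\<close>

lemma iso_integral_ge:
  assumes r: "r > 0" and a: "a > 0" and f: "\<And>y. norm (y - x) \<le> real k * r \<Longrightarrow> a \<le> f y"
  shows "ennreal (a * r ^ DIM('b)) ^ (k - 1) * unit_volume \<le> (\<integral>\<^sup>+y. iso_ind r x y \<partial>PiM vertices (\<lambda>_. Df))"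
proof -
  let ?S = "cball (0::'b) (real k)" and ?T = "\<lambda>u. - (1 / r) *\<^sub>R x + (1 / r) *\<^sub>R u" and ?c = "1 / (a * r ^ DIM('b))"
  have "(\<integral>\<^sup>+z. iso_ind 1 0 z * of_bool (\<forall>i\<in>vertices. z i \<in> ?S) \<partial>PiM vertices (\<lambda>_. lborel))
    \<le> ennreal ?c ^ card vertices * (\<integral>\<^sup>+y. iso_ind 1 0 (\<lambda>i\<in>vertices. ?T (y i)) \<partial>PiM vertices (\<lambda>_. Df))"
  proof (rule product_nn_integral_le)
    interpret D: prob_space Df by (rule prob_Df)
    show "sigma_finite_measure Df" ..
    show "sigma_finite_measure (lborel :: 'b measure)" by (rule sigma_finite_lborel)
    show "?T \<in> measurable Df lborel" by (simp cong: measurable_cong_sets)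
    fix \<phi> :: "'b \<Rightarrow> ennreal" assume "\<phi> \<in> borel_measurable lborel"
    then have [measurable]: "\<phi> \<in> borel_measurable borel" by simp
    have m: "(\<lambda>u. \<phi> (?T u)) \<in> borel_measurable borel" by measurable
    have "(\<integral>\<^sup>+z. \<phi> z * indicator ?S z \<partial>lborel)
        = ennreal (\<bar>1 / r\<bar> ^ DIM('b)) * (\<integral>\<^sup>+u. \<phi> (?T u) * indicator ?S (?T u) \<partial>lborel)"
      using r by (intro nn_integral_lborel_affine borel_measurable_times_ennreal borel_measurable_indicator) auto
    also have "\<dots> \<le> ennreal (\<bar>1 / r\<bar> ^ DIM('b)) * (\<integral>\<^sup>+u. ennreal (1 / a) * (ennreal (f u) * \<phi> (?T u)) \<partial>lborel)"
    proof (intro mult_left_mono nn_integral_mono)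
      fix u
      show "\<phi> (?T u) * indicator ?S (?T u) \<le> ennreal (1 / a) * (ennreal (f u) * \<phi> (?T u))"
      proof (cases "?T u \<in> ?S")
        case True
        have "?T u = (1 / r) *\<^sub>R (u - x)" by (simp add: algebra_simps)
        then have "norm (u - x) \<le> real k * r" using True r by (simp add: divide_le_eq)
        from f[OF this] have "1 \<le> 1 / a * f u" using a by simp
        then have le: "ennreal 1 \<le> ennreal (1 / a * f u)" by (rule ennreal_leI)
        have eq: "ennreal (1 / a * f u) = ennreal (1 / a) * ennreal (f u)"
          using a f_nonneg[of u] by (intro ennreal_mult) auto
        have "1 \<le> ennreal (1 / a) * ennreal (f u)" using le unfolding eq ennreal_1 .
        from mult_right_mono[OF this, of "\<phi> (?T u)"] True show ?thesis by (simp add: mult.assoc)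
      qed simp
    qed simp
    also have "\<dots> = ennreal (\<bar>1 / r\<bar> ^ DIM('b)) * (ennreal (1 / a) * (\<integral>\<^sup>+u. \<phi> (?T u) \<partial>Df))"
      unfolding Df_def using m by (subst nn_integral_cmult) (auto simp: nn_integral_density)
    also have "\<dots> = ennreal ?c * (\<integral>\<^sup>+u. \<phi> (?T u) \<partial>Df)"
      using r a by (simp add: mult.assoc[symmetric] ennreal_mult[symmetric] power_divide mult.commute)
    finally show "(\<integral>\<^sup>+z. \<phi> z * indicator ?S z \<partial>lborel) \<le> ennreal ?c * (\<integral>\<^sup>+u. \<phi> (?T u) \<partial>Df)" .
  qed (rule measurable_iso(1) | simp)+
  moreover have "iso_ind 1 0 z * of_bool (\<forall>i\<in>vertices. z i \<in> ?S) = iso_ind 1 0 z" for z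
  proof (cases "disk_iso \<Gamma> 1 (insert 0 (z ` vertices))")
    case True
    have "norm (z i - 0) \<le> real (card (pverts \<Gamma>)) * 1" if "i \<in> vertices" for i
      using that by (intro disk_iso_dist_le[OF \<Gamma>(1,2) True]) auto
    then show ?thesis using \<Gamma>(3) by (auto simp: iso_ind_def)
  qed (simp add: iso_ind_def)
  moreover have "iso_ind 1 0 (\<lambda>i\<in>vertices. ?T (y i)) = iso_ind r x y" for y
  proof -
    have "iso_ind r x (\<lambda>i\<in>vertices. x + r *\<^sub>R (\<lambda>i\<in>vertices. ?T (y i)) i) = iso_ind 1 0 (\<lambda>i\<in>vertices. ?T (y i))"
      by (rule iso_ind_scale[OF r])
    moreover have "(\<lambda>i\<in>vertices. x + r *\<^sub>R (\<lambda>i\<in>vertices. ?T (y i)) i) ` vertices = y ` vertices"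
      using r by (intro image_cong) (auto simp: scaleR_add_right scaleR_diff_right)
    ultimately show ?thesis by (simp add: iso_ind_def)
  qed
  ultimately have le: "unit_volume \<le> ennreal ?c ^ (k - 1) * (\<integral>\<^sup>+y. iso_ind r x y \<partial>PiM vertices (\<lambda>_. Df))"
    by (simp only: unit_volume_def card_atLeastLessThan)
  have "ennreal (a * r ^ DIM('b)) ^ (k - 1) * ennreal ?c ^ (k - 1) = 1"
    using a r by (simp add: power_mult_distrib[symmetric] ennreal_mult[symmetric])
  then show ?thesis
    using mult_left_mono[OF le, of "ennreal (a * r ^ DIM('b)) ^ (k - 1)"] by (simp add: mult.assoc[symmetric])
qed

text \<open>If the volume were 0, the upper bound would make the probability vanish at every radius;
  a positive probability at a single radius is therefore enough.\<close>

lemma unit_volume_pos: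
  assumes "r > 0" "emeasure (PiM UNIV (\<lambda>_. Df)) {y. disk_iso \<Gamma> r (y ` {..<k})} > 0"
  shows "unit_volume > 0"
proof (rule ccontr)
  assume "\<not> unit_volume > 0"
  then have "(\<integral>\<^sup>+y. iso_ind r x y \<partial>PiM vertices (\<lambda>_. Df)) = 0" for x
    using iso_integral_le[OF assms(1), of x] by (simp add: not_gr_zero)
  then show False using assms(2) unfolding emeasure_disk_iso by simp
qed

lemma prob_disk_iso_ge:
  assumes cont: "isCont f p" "f p > 0" and V: "unit_volume > 0"
  shows "\<exists>c>0. \<exists>r0>0. \<forall>r. 0 < r \<longrightarrow> r < r0 \<longrightarrow>
    ennreal (c * (r ^ DIM('b)) ^ (k - 1)) \<le> emeasure (PiM UNIV (\<lambda>_. Df)) {y. disk_iso \<Gamma> r (y ` {..<k})}"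
proof -
  \<comment> \<open>\<open>f\<close> is at least \<open>a\<close> within some
    \<open>\<delta>\<close> of \<open>p\<close>. The first point is kept within
    \<open>\<delta> / 2\<close> of \<open>p\<close>, and \<open>k * r < \<delta> / 2\<close> leaves
    the same margin for the others.\<close>
  define a where "a = f p / 2"
  have a: "a > 0" using cont by (simp add: a_def)
  obtain \<delta> where \<delta>: "\<delta> > 0" "\<And>y. dist y p < \<delta> \<Longrightarrow> dist (f y) (f p) < a"
    using cont(1) a unfolding continuous_at_eps_delta by blast
  have fa: "a \<le> f y" if "dist y p < \<delta>" for y
    using \<delta>(2)[OF that] by (simp add: dist_real_def a_def abs_if split: if_splits)
  let ?B = "ball p (\<delta> / 2)"
  define m where "m = measure Df ?B"
  interpret D: prob_space Df by (rule prob_Df)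
  have m: "m > 0"
  proof -
    have "0 < measure lborel ?B" using \<delta>(1) by (intro content_ball_pos) simp
    then have "0 < emeasure lborel ?B" by (auto simp: measure_def zero_less_iff_neq_zero)
    then have "0 < ennreal a * emeasure lborel ?B"
      using a by (simp add: ennreal_zero_less_mult_iff)
    also have "\<dots> = (\<integral>\<^sup>+x. ennreal a * indicator ?B x \<partial>lborel)" by (simp add: nn_integral_cmult_indicator)
    also have "\<dots> \<le> (\<integral>\<^sup>+x. ennreal (f x) * indicator ?B x \<partial>lborel)"
      using fa \<delta>(1) by (intro nn_integral_mono) (auto simp: indicator_def dist_commute intro!: ennreal_leI)
    also have "\<dots> = emeasure Df ?B" unfolding Df_def by (subst emeasure_density) auto
    finally show ?thesis by (simp add: m_def D.emeasure_eq_measure)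
  qed
  \<comment> \<open>The truncation at 1 yields a real number without a finiteness argument.\<close>
  define V' where "V' = enn2real (min unit_volume 1)"
  have V': "V' > 0" "ennreal V' \<le> unit_volume"
  proof -
    have fin: "min unit_volume 1 < \<top>" by (simp add: min_less_iff_disj)
    then have e: "ennreal V' = min unit_volume 1" by (simp add: V'_def)
    show "ennreal V' \<le> unit_volume" unfolding e by simp
    have "0 < ennreal V'" unfolding e using V by simp
    then show "V' > 0" by simp
  qed
  let ?c = "m * (a ^ (k - 1) * V')"
  have "ennreal (?c * (r ^ DIM('b)) ^ (k - 1)) \<le> emeasure (PiM UNIV (\<lambda>_. Df)) {y. disk_iso \<Gamma> r (y ` {..<k})}"
    if r: "0 < r" "r < \<delta> / (2 * real k)" for r
  proof -
    have kr: "real k * r < \<delta> / 2" using r k2 by (simp add: field_simps)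
    have "ennreal (?c * (r ^ DIM('b)) ^ (k - 1)) = emeasure Df ?B * (ennreal (a * r ^ DIM('b)) ^ (k - 1) * ennreal V')"
      using a r V' m by (simp add: D.emeasure_eq_measure m_def[symmetric] ennreal_power ennreal_mult[symmetric] power_mult_distrib mult_ac)
    also have "\<dots> \<le> emeasure Df ?B * (ennreal (a * r ^ DIM('b)) ^ (k - 1) * unit_volume)"
      using V' by (intro mult_left_mono) auto
    also have "\<dots> = (\<integral>\<^sup>+x. (ennreal (a * r ^ DIM('b)) ^ (k - 1) * unit_volume) * indicator ?B x \<partial>Df)"
      by (subst nn_integral_cmult_indicator) (auto simp: mult.commute)
    also have "\<dots> \<le> (\<integral>\<^sup>+x. (\<integral>\<^sup>+y. iso_ind r x y \<partial>PiM vertices (\<lambda>_. Df)) \<partial>Df)"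
    proof (rule nn_integral_mono)
      fix x
      show "(ennreal (a * r ^ DIM('b)) ^ (k - 1) * unit_volume) * indicator ?B x
          \<le> (\<integral>\<^sup>+y. iso_ind r x y \<partial>PiM vertices (\<lambda>_. Df))"
      proof (cases "x \<in> ?B")
        case True
        have "a \<le> f y" if "norm (y - x) \<le> real k * r" for y
        proof (rule fa)
          have "dist y p \<le> dist y x + dist x p" by (rule dist_triangle)
          then show "dist y p < \<delta>" using that True kr by (simp add: dist_norm norm_minus_commute)
        qed
        then show ?thesis using iso_integral_ge[OF r(1) a, of x] True by simp
      qed simp
    qed
    finally show ?thesis by (simp only: emeasure_disk_iso)
  qed
  moreover have "?c > 0" using m a V' by simp
  moreover have "\<delta> / (2 * real k) > 0" using \<delta>(1) k2 by simp
  ultimately show ?thesis by blast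
qed

end

section \<open>The Poissonized disk graph\<close>

lemma uniform_lower_bound:
  fixes a :: "nat \<Rightarrow> real"
  assumes pos: "\<And>n. n \<ge> 1 \<Longrightarrow> a n > 0" and c: "c > 0" "eventually (\<lambda>n. c \<le> a n) sequentially"
  shows "\<exists>c'>0. \<forall>n\<ge>1. c' \<le> a n"
proof -
  obtain m where m: "\<And>n. n \<ge> m \<Longrightarrow> c \<le> a n" using c(2) by (auto simp: eventually_sequentially)
  let ?c = "Min (insert c (a ` {1..<m}))"
  have "?c > 0" using pos c(1) by (subst Min_gr_iff) auto
  moreover have "?c \<le> a n" if "n \<ge> 1" for n
  proof (cases "n < m")
    case True
    then show ?thesis using that by (intro Min_le) auto
  next
    case False
    have "?c \<le> c" by (intro Min_le) auto
    moreover have "c \<le> a n" using m[of n] False by simp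
    ultimately show ?thesis by (rule order_trans)
  qed
  ultimately show ?thesis by blast
qed

locale poisson_disk_graph = prob_space M for M :: "'a measure" +
  fixes Y :: "nat \<Rightarrow> 'a \<Rightarrow> 'b::euclidean_space"
    and f :: "'b \<Rightarrow> real"
    and N :: "nat \<Rightarrow> 'a \<Rightarrow> nat"
    and t :: "nat \<Rightarrow> real"
    and k :: nat
    and \<Gamma> :: "'v pair_pre_digraph"
  assumes f_nonneg: "\<forall>x. 0 \<le> f x"
    and f_bounded: "bounded (range f)"
    and f_cont: "AE x in lborel. isCont f x"
    and Y_density: "\<forall>i\<ge>1. distributed M lborel (Y i) (\<lambda>x. ennreal (f x))"
    and Y_indep: "indep_vars (\<lambda>_. borel) Y {1..}"
    and N_measurable: "\<forall>n\<ge>1. N n \<in> measurable M (count_space UNIV)"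
    and N_poisson: "\<forall>n\<ge>1. distr M (count_space UNIV) (N n) = measure_pmf (poisson_pmf (real n))"
    and N_indep: "\<forall>n\<ge>1. indep_of_sequence M (N n) Y"
    and t_pos: "\<forall>n\<ge>1. 0 < t n"
    and t_lim: "t \<longlonglongrightarrow> 0"
    and k2: "k \<ge> 2"
    and graph: "pair_graph \<Gamma>" "connected (with_proj \<Gamma>)" "card (pverts \<Gamma>) = k"
    and feasible: "\<forall>n\<ge>1. feasible M Y (t n) \<Gamma>"
begin

abbreviation "D \<equiv> density lborel (\<lambda>x. ennreal (f x))"

lemma f_measurable[measurable]: "f \<in> borel_measurable borel"
proof -
  have "(\<lambda>x. ennreal (f x)) \<in> borel_measurable lborel"
    using Y_density by (auto simp: distributed_def)
  then have "(\<lambda>x. enn2real (ennreal (f x))) \<in> borel_measurable lborel" by measurable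
  then show ?thesis using f_nonneg by simp
qed

lemma Y_measurable: "i \<ge> 1 \<Longrightarrow> Y i \<in> borel_measurable M"
  and distr_Y: "i \<ge> 1 \<Longrightarrow> distr M borel (Y i) = D"
proof -
  assume i: "i \<ge> 1"
  then have Y: "Y i \<in> measurable M lborel" "distr M lborel (Y i) = D"
    using Y_density by (auto simp: distributed_def)
  then show m: "Y i \<in> borel_measurable M" by simp
  have "distr M borel (Y i) = distr M lborel (Y i)" by (rule distr_cong) auto
  then show "distr M borel (Y i) = D" using Y(2) by simp
qed

lemma prob_space_D: "prob_space D"
  using prob_space_distr[OF Y_measurable[of 1]] distr_Y[of 1] by simp

text \<open>The summand 1 makes the bound positive, as the quotients and powers below
  require.\<close>

definition "fmax = (SUP x. f x) + 1"

lemma f_le_fmax: "f x \<le> fmax" and fmax_pos: "fmax > 0"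
proof -
  have "f x \<le> (SUP x. f x)" for x using f_bounded by (intro cSUP_upper) (auto simp: bounded_imp_bdd_above)
  then have "f x < fmax" for x using le_less_trans[of "f x" "SUP x. f x" fmax] by (simp add: fmax_def)
  then show "f x \<le> fmax" "fmax > 0"
    using f_nonneg by (auto intro: less_imp_le le_less_trans)
qed

text \<open>With \<open>\<rho> = k * r\<close>, the diameter bound of
  \<open>disk_iso_dist_le\<close>, the balls in \<open>ball_D\<close> have radius
  \<open>4 * k * r\<close>; this is the resulting factor in front of
  \<open>r ^ DIM('b)\<close>.\<close>

definition "ball_const = fmax * unit_ball_vol (real DIM('b)) * (4 * real k) ^ DIM('b)"

lemma ball_const_pos: "ball_const > 0"
  using fmax_pos k2 by (simp add: ball_const_def)

lemma measure_D_cball: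
  assumes "r > 0"
  shows "measure D (cball x (4 * (real k * r))) \<le> ball_const * r ^ DIM('b)"
proof -
  let ?C = "cball x (4 * (real k * r))"
  interpret D: prob_space D by (rule prob_space_D)
  have "emeasure D ?C = (\<integral>\<^sup>+x. ennreal (f x) * indicator ?C x \<partial>lborel)"
    by (subst emeasure_density) auto
  also have "\<dots> \<le> (\<integral>\<^sup>+x. ennreal fmax * indicator ?C x \<partial>lborel)"
    using f_le_fmax by (intro nn_integral_mono mult_right_mono ennreal_leI) auto
  also have "\<dots> = ennreal fmax * emeasure lborel ?C" by (simp add: nn_integral_cmult_indicator)
  also have "emeasure lborel ?C = ennreal (unit_ball_vol (real DIM('b)) * (4 * (real k * r)) ^ DIM('b))"
    using assms k2 by (subst emeasure_cball) auto
  also have "ennreal fmax * \<dots> = ennreal (ball_const * r ^ DIM('b))"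
    using fmax_pos assms by (subst ennreal_mult[symmetric]) (auto simp: ball_const_def power_mult_distrib mult_ac)
  finally show ?thesis using ball_const_pos assms by (simp add: D.emeasure_eq_measure)
qed

lemma poisson_iid_D: "n \<ge> 1 \<Longrightarrow> poisson_iid D (real n)"
  using prob_space_D by (simp add: poisson_iid_def poisson_iid_axioms_def)

lemma local_ustat_D:
  assumes n: "n \<ge> 1"
  shows "local_ustat D (real n) (disk_iso \<Gamma> (t n)) k (real k * t n) (ball_const * t n ^ DIM('b))"
proof -
  interpret P: poisson_iid D "real n" using n by (rule poisson_iid_D)
  have tn: "t n > 0" using t_pos n by simp
  show ?thesis
  proof unfold_locales
    show "2 \<le> k" by (rule k2)
    show "{y. disk_iso \<Gamma> (t n) (y ` I)} \<in> sets P.Q" if "finite I" "card I = k" for I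
    proof -
      have "(\<lambda>y. y i) \<in> borel_measurable P.Q" for i
        using P.measurable_component_Q[of i] by (simp cong: measurable_cong_sets)
      then have "Measurable.pred P.Q (\<lambda>y. disk_iso \<Gamma> (t n) ((\<lambda>i. y i) ` I))"
        using that graph(3) by (intro measurable_disk_iso[OF graph(1)]) auto
      then show ?thesis by (simp add: pred_def)
    qed
    show "sets D = sets borel" by simp
    show "dist x y \<le> real k * t n" if "disk_iso \<Gamma> (t n) V" "x \<in> V" "y \<in> V" for V x y
      using disk_iso_dist_le[OF graph(1,2) that tn] graph(3) by (simp add: dist_norm)
    show "measure D (cball x (4 * (real k * t n))) \<le> ball_const * t n ^ DIM('b)" for x
      using measure_D_cball[OF tn] .
  qed
qed

text \<open>The points are indexed from 1 and the coordinates of \<open>Q\<close> from 0, hence the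
  \<open>Suc\<close>. The third claim puts the events of the shifted sequence into the sigma-algebra
  to which \<open>indep_of_sequence\<close> refers.\<close>

lemma distr_sequence:
  shows "distr M (poisson_iid.Q D) (\<lambda>\<omega> i. Y (Suc i) \<omega>) = poisson_iid.Q D"
    and "(\<lambda>\<omega> i. Y (Suc i) \<omega>) \<in> measurable M (poisson_iid.Q D)"
    and "B \<in> sets (poisson_iid.Q D) \<Longrightarrow> (\<lambda>\<omega> i. Y (Suc i) \<omega>) -` B \<inter> space M
      \<in> sets (vimage_algebra (space M) (\<lambda>\<omega>. \<lambda>i\<in>{1..}. Y i \<omega>) (PiM {1..} (\<lambda>_. borel)))"
proof -
  interpret P: poisson_iid D "real 1" by (rule poisson_iid_D) simp
  let ?Y = "\<lambda>\<omega>. \<lambda>i\<in>{1..}. Y i \<omega>" and ?S = "\<lambda>y i. y (Suc i) :: 'b" and ?B = "PiM {1..} (\<lambda>_::nat. borel :: 'b measure)"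
  have mY: "?Y \<in> measurable M ?B"
    by (intro measurable_restrict Y_measurable) auto
  have mS: "?S \<in> measurable ?B P.Q"
  proof (rule P.measurable_into_Q)
    fix i
    have "(\<lambda>y. y (Suc i)) \<in> measurable ?B borel" by (rule measurable_component_singleton) simp
    then show "(\<lambda>y. y (Suc i)) \<in> measurable ?B D" by (simp cong: measurable_cong_sets)
  qed
  have comp: "(\<lambda>\<omega> i. Y (Suc i) \<omega>) = (\<lambda>\<omega>. ?S (?Y \<omega>))" by (auto simp: fun_eq_iff)
  show "(\<lambda>\<omega> i. Y (Suc i) \<omega>) \<in> measurable M P.Q"
    unfolding comp by (rule measurable_compose[OF mY mS])
  have "distr M ?B ?Y = PiM {1..} (\<lambda>i. distr M borel (Y i))"
    using Y_indep by (subst (asm) indep_vars_iff_distr_eq_PiM') (auto intro: Y_measurable)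
  also have "\<dots> = PiM {1..} (\<lambda>_. D)" by (intro PiM_cong distr_Y) auto
  finally have law: "distr M ?B ?Y = PiM {1..} (\<lambda>_. D)" .
  have "distr M P.Q (\<lambda>\<omega> i. Y (Suc i) \<omega>) = distr (distr M ?B ?Y) P.Q ?S"
    unfolding comp by (subst distr_distr[OF mS mY]) (simp add: comp_def)
  also have "\<dots> = P.Q"
    unfolding law using distr_PiM_reindex[of "{1..}" "\<lambda>_. D" Suc UNIV] prob_space_D
    by (simp add: P.Q_def restrict_def)
  finally show "distr M P.Q (\<lambda>\<omega> i. Y (Suc i) \<omega>) = P.Q" .
  assume "B \<in> sets P.Q"
  then have B: "?S -` B \<inter> space ?B \<in> sets ?B" using mS by (rule measurable_sets[rotated])
  have "(\<lambda>\<omega> i. Y (Suc i) \<omega>) -` B \<inter> space M = ?Y -` (?S -` B \<inter> space ?B) \<inter> space M"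
    using measurable_space[OF mY] by (auto simp: fun_eq_iff)
  then show "(\<lambda>\<omega> i. Y (Suc i) \<omega>) -` B \<inter> space M \<in> sets (vimage_algebra (space M) ?Y ?B)"
    using in_vimage_algebra[OF B] by simp
qed

lemma distr_joint:
  assumes n: "n \<ge> 1"
  shows "distr M (poisson_iid.R D (real n)) (\<lambda>\<omega>. (N n \<omega>, \<lambda>i. Y (Suc i) \<omega>)) = poisson_iid.R D (real n)"
    and "(\<lambda>\<omega>. (N n \<omega>, \<lambda>i. Y (Suc i) \<omega>)) \<in> measurable M (poisson_iid.R D (real n))"
proof -
  interpret P: poisson_iid D "real n" using n by (rule poisson_iid_D)
  let ?W = "\<lambda>\<omega>. (N n \<omega>, \<lambda>i. Y (Suc i) \<omega>)" and ?Y' = "\<lambda>\<omega> i. Y (Suc i) \<omega>"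
  have mN: "N n \<in> measurable M (measure_pmf (poisson_pmf (real n)))"
    using N_measurable n by simp
  show W: "?W \<in> measurable M P.R"
    unfolding P.R_def by (rule measurable_Pair[OF mN distr_sequence(2)])
  have "measure_pmf (poisson_pmf (real n)) \<Otimes>\<^sub>M P.Q = distr M P.R ?W"
  proof (rule pair_measure_eqI)
    show "sigma_finite_measure (measure_pmf (poisson_pmf (real n)))" "sigma_finite_measure P.Q"
      by (rule prob_space_imp_sigma_finite[OF measure_pmf.prob_space_axioms],
        rule prob_space_imp_sigma_finite[OF P.Q.prob_space_axioms])
    show "sets (measure_pmf (poisson_pmf (real n)) \<Otimes>\<^sub>M P.Q) = sets (distr M P.R ?W)"
      by (simp add: P.R_def)
    fix A B assume A: "A \<in> sets (measure_pmf (poisson_pmf (real n)))" and B: "B \<in> sets P.Q"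
    have "A \<times> B \<in> sets P.R" unfolding P.R_def using A B by simp
    then have "emeasure (distr M P.R ?W) (A \<times> B) = emeasure M (?W -` (A \<times> B) \<inter> space M)"
      by (rule emeasure_distr[OF W])
    also have "?W -` (A \<times> B) \<inter> space M = (N n -` A \<inter> space M) \<inter> (?Y' -` B \<inter> space M)" by auto
    also have "emeasure M \<dots> = ennreal (prob (N n -` A \<inter> space M) * prob (?Y' -` B \<inter> space M))"
      unfolding emeasure_eq_measure
    proof (rule arg_cong[where f=ennreal], rule indep_setD)
      show "indep_set (sets (vimage_algebra (space M) (N n) (count_space UNIV)))
          (sets (vimage_algebra (space M) (\<lambda>\<omega>. \<lambda>i\<in>{1..}. Y i \<omega>) (PiM {1..} (\<lambda>_. borel))))"
        using N_indep n by (simp add: indep_of_sequence_def)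
      show "N n -` A \<inter> space M \<in> sets (vimage_algebra (space M) (N n) (count_space UNIV))"
        by (rule in_vimage_algebra) simp
      show "?Y' -` B \<inter> space M \<in> sets (vimage_algebra (space M) (\<lambda>\<omega>. \<lambda>i\<in>{1..}. Y i \<omega>) (PiM {1..} (\<lambda>_. borel)))"
        by (rule distr_sequence(3)[OF B])
    qed
    also have "\<dots> = emeasure M (N n -` A \<inter> space M) * emeasure M (?Y' -` B \<inter> space M)"
      by (simp add: emeasure_eq_measure ennreal_mult)
    also have "emeasure M (N n -` A \<inter> space M) = emeasure (distr M (count_space UNIV) (N n)) A"
      using N_measurable n by (subst emeasure_distr) auto
    also have "\<dots> = emeasure (measure_pmf (poisson_pmf (real n))) A" using N_poisson n by simp
    also have "emeasure M (?Y' -` B \<inter> space M) = emeasure (distr M P.Q ?Y') B"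
      using distr_sequence(2) B by (subst emeasure_distr) auto
    also have "\<dots> = emeasure P.Q B" by (simp only: distr_sequence(1))
    finally show "emeasure (measure_pmf (poisson_pmf (real n))) A * emeasure P.Q B = emeasure (distr M P.R ?W) (A \<times> B)" ..
  qed
  then show "distr M P.R ?W = P.R" by (simp add: P.R_def)
qed

text \<open>The number of points and the shifted sequence have the joint law \<open>R\<close>, so
  the mean and the variance in the standardization are \<open>U.\<mu>\<close> and
  \<open>U.v\<close>; equivariance of \<open>F\<close> undoes the shift of the indices.\<close>

lemma standardized_law:
  assumes n: "n \<ge> 1"
  shows "distr M borel (standardized M (poissonized_count t Y N \<Gamma> n))
    = distr (poisson_iid.R D (real n)) borel (local_ustat.Z D (real n) (disk_iso \<Gamma> (t n)) k)"
proof -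
  interpret U: local_ustat D "real n" "disk_iso \<Gamma> (t n)" k "real k * t n" "ball_const * t n ^ DIM('b)"
    using n by (rule local_ustat_D)
  let ?W = "\<lambda>\<omega>. (N n \<omega>, \<lambda>i. Y (Suc i) \<omega>)" and ?X = "poissonized_count t Y N \<Gamma> n"
  note W = distr_joint(2)[OF n] and law = distr_joint(1)[OF n]
  have X: "?X \<omega> = (\<lambda>p. U.F {..<fst p} (snd p)) (?W \<omega>)" for \<omega>
  proof -
    let ?y = "\<lambda>i. Y i \<omega>" and ?m = "N n \<omega>"
    have "U.F {..<?m} (\<lambda>i. Y (Suc i) \<omega>) = U.F (Suc ` {..<?m}) ?y"
      using U.functional_equi[OF U.functional_F inj_Suc, of "{..<?m}" ?y] by (simp add: comp_def)
    also have "Suc ` {..<?m} = {1..?m}" by (simp add: image_Suc_lessThan)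
    also have "U.F {1..?m} ?y = real (induced_count (t n) \<Gamma> ?y ?m)"
    proof -
      have iso: "digraph_iso (with_proj (disk_graph (t n) (?y ` {1..?m})) \<restriction> (?y ` I)) (with_proj \<Gamma>)
          \<longleftrightarrow> disk_iso \<Gamma> (t n) (?y ` I)" if "I \<subseteq> {1..?m}" for I
        using disk_graph_restrict[of "?y ` I" "?y ` {1..?m}" "t n"] that by (simp add: disk_iso_def image_mono)
      have "{I. I \<subseteq> {1..?m} \<and> card I = card (pverts \<Gamma>) \<and>
          digraph_iso (with_proj (disk_graph (t n) (?y ` {1..?m})) \<restriction> (?y ` I)) (with_proj \<Gamma>)}
        = {I. I \<subseteq> {1..?m} \<and> U.hit I ?y}"
        by (intro Collect_cong conj_cong refl) (simp only: U.hit_def graph(3) iso)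
      then show ?thesis by (simp only: U.F_def induced_count_def)
    qed
    finally show ?thesis by (simp add: poissonized_count_def)
  qed
  have mF: "(\<lambda>p. U.F {..<fst p} (snd p)) \<in> borel_measurable U.R"
    using U.measurable_R[of "\<lambda>m. U.F {..<m}"] U.tame_measurable[OF U.tame_F(1)] by simp
  have transfer: "(\<integral>\<omega>. h (?W \<omega>) \<partial>M) = (\<integral>p. h p \<partial>U.R)" if "h \<in> borel_measurable U.R" for h :: "_ \<Rightarrow> real"
    using integral_distr[OF W that] by (simp only: law)
  have mean: "(\<integral>\<omega>. ?X \<omega> \<partial>M) = U.\<mu>"
    unfolding X transfer[OF mF] by (simp add: U.\<mu>_def U.E_def)
  have "(\<integral>\<omega>. (?X \<omega> - U.\<mu>)\<^sup>2 \<partial>M) = (\<integral>p. (U.F {..<fst p} (snd p) - U.\<mu>)\<^sup>2 \<partial>U.R)"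
    unfolding X by (rule transfer[of "\<lambda>p. (U.F {..<fst p} (snd p) - U.\<mu>)\<^sup>2"]) (use mF in measurable)
  then have var: "(\<integral>\<omega>. (?X \<omega> - U.\<mu>)\<^sup>2 \<partial>M) = U.v" by (simp add: U.v_def U.E_def)
  have "standardized M ?X = (\<lambda>\<omega>. U.Z (?W \<omega>))"
    unfolding standardized_def[abs_def] mean var by (intro ext) (simp add: X U.Z_def)
  then have "distr M borel (standardized M ?X) = distr (distr M U.R ?W) borel U.Z"
    by (subst distr_distr[OF U.measurable_Z W]) (simp add: comp_def)
  then show ?thesis by (simp only: law)
qed

end

lemma powr_minus_half: "x > 0 \<Longrightarrow> x powr (-1/2) = 1 / sqrt x" for x :: real
  using powr_minus_divide[of x "1/2"] by (simp add: powr_half_sqrt)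

text \<open>The bounds concern \<open>n \<ge> 1\<close> only, and the law at \<open>n = 0\<close>
  does not affect the limit.\<close>

lemma weak_conv_m_Suc:
  assumes "weak_conv_m (\<lambda>n. \<mu> (Suc n)) \<nu>" shows "weak_conv_m \<mu> \<nu>"
  using assms unfolding weak_conv_m_def weak_conv_def by (auto intro: LIMSEQ_imp_Suc)

section \<open>Uniform lower bound for the probability of a copy, and the two rates\<close>

context poisson_disk_graph
begin

abbreviation "iso_event n \<equiv> {y. disk_iso \<Gamma> (t n) (y ` {..<k})}"

lemma iso_event_sets: "n \<ge> 1 \<Longrightarrow> iso_event n \<in> sets (poisson_iid.Q D)"
proof -
  assume "n \<ge> 1"
  then interpret U: local_ustat D "real n" "disk_iso \<Gamma> (t n)" k "real k * t n" "ball_const * t n ^ DIM('b)"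
    by (rule local_ustat_D)
  show "iso_event n \<in> sets U.Q" by (rule U.\<kappa>_meas) auto
qed

lemma iso_event_pos:
  assumes n: "n \<ge> 1" shows "measure (poisson_iid.Q D) (iso_event n) > 0"
proof -
  have eq: "(\<lambda>i. Y i \<omega>) ` {1..card (pverts \<Gamma>)} = (\<lambda>i. Y (Suc i) \<omega>) ` {..<k}" for \<omega>
    unfolding graph(3) image_Suc_lessThan[symmetric] image_image ..
  have "0 < measure M {\<omega> \<in> space M. disk_iso \<Gamma> (t n) ((\<lambda>i. Y (Suc i) \<omega>) ` {..<k})}"
    using feasible n unfolding feasible_def eq disk_iso_def by blast
  also have "{\<omega> \<in> space M. disk_iso \<Gamma> (t n) ((\<lambda>i. Y (Suc i) \<omega>) ` {..<k})}
      = (\<lambda>\<omega> i. Y (Suc i) \<omega>) -` iso_event n \<inter> space M" by auto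
  also have "measure M \<dots> = measure (distr M (poisson_iid.Q D) (\<lambda>\<omega> i. Y (Suc i) \<omega>)) (iso_event n)"
    by (rule measure_distr[OF distr_sequence(2) iso_event_sets[OF n], symmetric])
  finally show ?thesis by (simp only: distr_sequence(1))
qed

text \<open>Otherwise \<open>f\<close> would vanish at almost every point, although it integrates to
  1.\<close>

lemma continuity_point: "\<exists>p. isCont f p \<and> f p > 0"
proof (rule ccontr)
  assume none: "\<not> ?thesis"
  have "AE x in lborel. ennreal (f x) = 0"
    using f_cont
  proof eventually_elim
    case (elim x)
    then show ?case using none f_nonneg by (auto simp: not_less intro: antisym)
  qed
  then have "(\<integral>\<^sup>+x. ennreal (f x) \<partial>lborel) = 0" by (subst nn_integral_0_iff_AE) auto
  moreover have "(\<integral>\<^sup>+x. ennreal (f x) \<partial>lborel) = emeasure D (space D)"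
    by (subst emeasure_density) auto
  ultimately show False using prob_space.emeasure_space_1[OF prob_space_D] by simp
qed

text \<open>The scaling bound covers all \<open>n\<close> for which \<open>t n\<close> is small. At
  the finitely many other \<open>n\<close>, feasibility makes the probability positive, and a
  minimum over them can be taken. Feasibility at \<open>n = 1\<close> also makes
  \<open>unit_volume\<close> positive.\<close>

lemma iso_event_lower_bound:
  "\<exists>\<eta>>0. \<forall>n\<ge>1. \<eta> * (ball_const * t n ^ DIM('b)) ^ (k - 1) \<le> measure (poisson_iid.Q D) (iso_event n)"
proof -
  interpret P: poisson_iid D "real 1" by (rule poisson_iid_D) simp
  note ctx = f_measurable f_nonneg[rule_format] f_le_fmax fmax_pos prob_space_D graph k2
  have Df: "Df f = D" by (simp add: Df_def[OF ctx])
  have Q: "PiM UNIV (\<lambda>_. Df f) = P.Q" by (simp add: Df P.Q_def)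
  obtain p where p: "isCont f p" "f p > 0" using continuity_point by blast
  have "emeasure (PiM UNIV (\<lambda>_. Df f)) (iso_event 1) > 0"
    unfolding Q P.Q.emeasure_eq_measure using iso_event_pos[of 1] by simp
  from unit_volume_pos[OF ctx _ this] have V: "unit_volume TYPE('b) \<Gamma> k > 0"
    using t_pos by simp
  obtain c r0 where c: "c > 0" "r0 > 0" and ge: "\<And>r. 0 < r \<Longrightarrow> r < r0 \<Longrightarrow>
      ennreal (c * (r ^ DIM('b)) ^ (k - 1)) \<le> emeasure P.Q {y. disk_iso \<Gamma> r (y ` {..<k})}"
    using prob_disk_iso_ge[OF ctx p V] unfolding Q by blast
  define a where "a n = measure P.Q (iso_event n) / (ball_const * t n ^ DIM('b)) ^ (k - 1)" for n
  have pos: "(ball_const * t n ^ DIM('b)) ^ (k - 1) > 0" if "n \<ge> 1" for n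
    using that t_pos ball_const_pos by simp
  have "a n > 0" if "n \<ge> 1" for n
    unfolding a_def using iso_event_pos[OF that] pos[OF that] by simp
  moreover have "c / ball_const ^ (k - 1) > 0" using c ball_const_pos by simp
  moreover have "eventually (\<lambda>n. c / ball_const ^ (k - 1) \<le> a n) sequentially"
    using order_tendstoD(2)[OF t_lim c(2)] eventually_ge_at_top[of 1]
  proof eventually_elim
    case (elim n)
    have tn: "t n > 0" using t_pos elim by simp
    have "ennreal (c * (t n ^ DIM('b)) ^ (k - 1)) \<le> ennreal (measure P.Q (iso_event n))"
      using ge[OF tn elim(1)] by (simp only: P.Q.emeasure_eq_measure)
    then have "c * (t n ^ DIM('b)) ^ (k - 1) \<le> measure P.Q (iso_event n)" by simp
    then have "c * (t n ^ DIM('b)) ^ (k - 1) / (ball_const * t n ^ DIM('b)) ^ (k - 1) \<le> a n"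
      unfolding a_def using pos[OF elim(2)] by (intro divide_right_mono) auto
    then show ?case using tn by (simp add: power_mult_distrib)
  qed
  ultimately obtain \<eta> where \<eta>: "\<eta> > 0" "\<And>n. n \<ge> 1 \<Longrightarrow> \<eta> \<le> a n"
    using uniform_lower_bound[of a "c / ball_const ^ (k - 1)"] by blast
  have "\<eta> * (ball_const * t n ^ DIM('b)) ^ (k - 1) \<le> measure P.Q (iso_event n)" if "n \<ge> 1" for n
    using \<eta>(2)[OF that] pos[OF that] by (simp add: a_def le_divide_eq)
  then show ?thesis using \<eta>(1) by blast
qed

abbreviation "std_law n \<equiv> distr M borel (standardized M (poissonized_count t Y N \<Gamma> n))"

lemma rate:
  assumes n: "n \<ge> 1" and \<eta>: "\<eta> > 0"
    "\<eta> * (ball_const * t n ^ DIM('b)) ^ (k - 1) \<le> measure (poisson_iid.Q D) (iso_event n)" and \<Lambda>: "\<Lambda> \<ge> 1"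
  shows "real n * (ball_const * t n ^ DIM('b)) \<le> \<Lambda> \<Longrightarrow>
      wasserstein_distance (std_law n) std_normal_distribution
        \<le> ereal (rate_const k \<eta> \<Lambda> * (1 / sqrt (real n * (real n * (ball_const * t n ^ DIM('b))) ^ (k - 1))))"
    and "1 \<le> real n * (ball_const * t n ^ DIM('b)) * \<Lambda> \<Longrightarrow>
      wasserstein_distance (std_law n) std_normal_distribution \<le> ereal (rate_const k \<eta> \<Lambda> * (1 / sqrt (real n)))"
proof -
  interpret U: local_ustat D "real n" "disk_iso \<Gamma> (t n)" k "real k * t n" "ball_const * t n ^ DIM('b)"
    using n by (rule local_ustat_D)
  have "U.\<theta> = (\<integral>y. indicator (iso_event n) y \<partial>U.Q)"
    unfolding U.\<theta>_def U.hit_def by (intro Bochner_Integration.integral_cong) (auto simp: indicator_def)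
  also have "\<dots> = measure U.Q (iso_event n)" by simp
  finally have \<theta>: "\<eta> * (ball_const * t n ^ DIM('b)) ^ (k - 1) \<le> U.\<theta>" using \<eta>(2) by simp
  have \<beta>: "ball_const * t n ^ DIM('b) > 0" using n t_pos ball_const_pos by simp
  show "real n * (ball_const * t n ^ DIM('b)) \<le> \<Lambda> \<Longrightarrow>
      wasserstein_distance (std_law n) std_normal_distribution
        \<le> ereal (rate_const k \<eta> \<Lambda> * (1 / sqrt (real n * (real n * (ball_const * t n ^ DIM('b))) ^ (k - 1))))"
    "1 \<le> real n * (ball_const * t n ^ DIM('b)) * \<Lambda> \<Longrightarrow>
      wasserstein_distance (std_law n) std_normal_distribution \<le> ereal (rate_const k \<eta> \<Lambda> * (1 / sqrt (real n)))"
    unfolding standardized_law[OF n]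
    by (rule U.wasserstein_rate_sparse[OF \<eta>(1) \<theta> \<beta> \<Lambda>] U.wasserstein_rate_dense[OF \<eta>(1) \<theta> \<beta> \<Lambda>]; assumption)+
qed

lemma sparse_rate:
  assumes lim: "(\<lambda>m. real m * t m ^ DIM('b)) \<longlonglongrightarrow> 0"
  shows "\<exists>C>0. \<forall>n\<ge>1. wasserstein_distance (std_law n) std_normal_distribution
    \<le> ereal (C * (real n ^ k * (t n ^ DIM('b)) ^ (k - 1)) powr (-1/2))"
proof -
  obtain \<eta> where \<eta>: "\<eta> > 0" "\<And>n. n \<ge> 1 \<Longrightarrow>
      \<eta> * (ball_const * t n ^ DIM('b)) ^ (k - 1) \<le> measure (poisson_iid.Q D) (iso_event n)"
    using iso_event_lower_bound by blast
  \<comment> \<open>A convergent sequence is bounded over all indices, so that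
    \<open>\<Lambda>\<close> can bound \<open>\<nu> * \<beta>\<close> at every
    \<open>n \<ge> 1\<close> and not only eventually.\<close>
  have "Bseq (\<lambda>m. real m * t m ^ DIM('b))"
    using lim by (intro convergent_imp_Bseq) (auto simp: convergent_def)
  then obtain T where T: "T > 0" "\<And>n. norm (real n * t n ^ DIM('b)) \<le> T" by (rule BseqE) blast
  define \<Lambda> where "\<Lambda> = max 1 (ball_const * T)"
  let ?b = "ball_const ^ (k - 1)"
  define C where "C = max 1 (rate_const k \<eta> \<Lambda> * (1 / sqrt ?b))"
  have "wasserstein_distance (std_law n) std_normal_distribution
    \<le> ereal (C * (real n ^ k * (t n ^ DIM('b)) ^ (k - 1)) powr (-1/2))" if n: "n \<ge> 1" for n
  proof -
    let ?s = "real n ^ k * (t n ^ DIM('b)) ^ (k - 1)"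
    have s: "?s > 0" using n t_pos by simp
    have "real n * t n ^ DIM('b) \<le> T" using T(2)[of n] by (simp add: abs_le_iff)
    then have "ball_const * (real n * t n ^ DIM('b)) \<le> ball_const * T"
      using ball_const_pos by (intro mult_left_mono) auto
    then have cond: "real n * (ball_const * t n ^ DIM('b)) \<le> \<Lambda>"
      by (simp add: \<Lambda>_def mult.left_commute)
    have "real n * (real n * (ball_const * t n ^ DIM('b))) ^ (k - 1) = ?b * ?s"
      using k2 power_Suc[of "real n" "k - 1"] by (simp add: power_mult_distrib mult_ac)
    then have e: "1 / sqrt (real n * (real n * (ball_const * t n ^ DIM('b))) ^ (k - 1)) = 1 / sqrt ?b * ?s powr (-1/2)"
      unfolding powr_minus_half[OF s] by (simp add: real_sqrt_mult)
    have "wasserstein_distance (std_law n) std_normal_distribution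
        \<le> ereal (rate_const k \<eta> \<Lambda> * (1 / sqrt ?b * ?s powr (-1/2)))"
      using rate(1)[OF n \<eta>(1) \<eta>(2)[OF n] _ cond] unfolding e \<Lambda>_def by simp
    also have "\<dots> \<le> ereal (C * ?s powr (-1/2))"
      unfolding ereal_less_eq mult.assoc[symmetric] C_def by (intro mult_right_mono) auto
    finally show ?thesis .
  qed
  moreover have "C > 0" by (simp add: C_def)
  ultimately show ?thesis by blast
qed

lemma dense_rate:
  assumes lim: "filterlim (\<lambda>m. real m * t m ^ DIM('b)) at_top sequentially \<or>
    (\<exists>c>0. (\<lambda>m. real m * t m ^ DIM('b)) \<longlonglongrightarrow> c)"
  shows "\<exists>C>0. \<forall>n\<ge>1. wasserstein_distance (std_law n) std_normal_distribution \<le> ereal (C * real n powr (-1/2))"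
proof -
  obtain \<eta> where \<eta>: "\<eta> > 0" "\<And>n. n \<ge> 1 \<Longrightarrow>
      \<eta> * (ball_const * t n ^ DIM('b)) ^ (k - 1) \<le> measure (poisson_iid.Q D) (iso_event n)"
    using iso_event_lower_bound by blast
  \<comment> \<open>In both regimes \<open>n * t n ^ d\<close> is eventually bounded below; as every
    term with \<open>n \<ge> 1\<close> is positive, a single \<open>l\<close> bounds them
    all.\<close>
  have "\<exists>c>0. eventually (\<lambda>n. c \<le> real n * t n ^ DIM('b)) sequentially"
    using lim
  proof
    assume "filterlim (\<lambda>m. real m * t m ^ DIM('b)) at_top sequentially"
    then show ?thesis unfolding filterlim_at_top by (intro exI[of _ 1]) auto
  next
    assume "\<exists>c>0. (\<lambda>m. real m * t m ^ DIM('b)) \<longlonglongrightarrow> c"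
    then obtain c where c: "c > 0" "(\<lambda>m. real m * t m ^ DIM('b)) \<longlonglongrightarrow> c" by blast
    have "eventually (\<lambda>n. c / 2 < real n * t n ^ DIM('b)) sequentially"
      using c by (intro order_tendstoD(1)[OF c(2)]) simp
    then show ?thesis using c(1) by (intro exI[of _ "c / 2"]) (auto elim: eventually_mono)
  qed
  then obtain c where "c > 0" "eventually (\<lambda>n. c \<le> real n * t n ^ DIM('b)) sequentially" by blast
  then obtain l where l: "l > 0" "\<And>n. n \<ge> 1 \<Longrightarrow> l \<le> real n * t n ^ DIM('b)"
    using uniform_lower_bound[of "\<lambda>n. real n * t n ^ DIM('b)" c] t_pos by auto
  define \<Lambda> where "\<Lambda> = max 1 (1 / (ball_const * l))"
  define C where "C = max 1 (rate_const k \<eta> \<Lambda>)"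
  have "wasserstein_distance (std_law n) std_normal_distribution \<le> ereal (C * real n powr (-1/2))" if n: "n \<ge> 1" for n
  proof -
    have bl: "ball_const * l > 0" using ball_const_pos l by simp
    have "1 = ball_const * l * (1 / (ball_const * l))" using ball_const_pos l by simp
    also have "\<dots> \<le> real n * (ball_const * t n ^ DIM('b)) * \<Lambda>"
    proof (rule mult_mono)
      have "ball_const * l \<le> ball_const * (real n * t n ^ DIM('b))"
        using ball_const_pos l(2)[OF n] by (intro mult_left_mono) auto
      then show "ball_const * l \<le> real n * (ball_const * t n ^ DIM('b))" by (simp only: mult.left_commute)
      show "1 / (ball_const * l) \<le> \<Lambda>" by (simp add: \<Lambda>_def)
      show "0 \<le> real n * (ball_const * t n ^ DIM('b))" using n t_pos ball_const_pos by (simp add: less_imp_le)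
      show "0 \<le> 1 / (ball_const * l)" using bl by simp
    qed
    finally have "wasserstein_distance (std_law n) std_normal_distribution \<le> ereal (rate_const k \<eta> \<Lambda> * (1 / sqrt (real n)))"
      by (intro rate(2)[OF n \<eta>(1) \<eta>(2)[OF n]]) (simp_all add: \<Lambda>_def)
    also have "1 / sqrt (real n) = real n powr (-1/2)" using n by (intro powr_minus_half[symmetric]) simp
    also have "ereal (rate_const k \<eta> \<Lambda> * real n powr (-1/2)) \<le> ereal (C * real n powr (-1/2))"
      unfolding ereal_less_eq C_def by (intro mult_right_mono) auto
    finally show ?thesis .
  qed
  moreover have "C > 0" by (simp add: C_def)
  ultimately show ?thesis by blast
qed

lemma weak_convergence:
  assumes W: "\<And>n. n \<ge> 1 \<Longrightarrow> wasserstein_distance (std_law n) std_normal_distribution \<le> ereal (b n)"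
    and b: "b \<longlonglongrightarrow> 0"
  shows "weak_conv_m std_law std_normal_distribution"
proof (rule weak_conv_m_Suc, rule weak_conv_m_wasserstein)
  show "real_distribution (std_law (Suc n))" for n
  proof -
    interpret U: local_ustat D "real (Suc n)" "disk_iso \<Gamma> (t (Suc n))" k "real k * t (Suc n)" "ball_const * t (Suc n) ^ DIM('b)"
      by (rule local_ustat_D) simp
    show ?thesis using U.real_distribution_Z standardized_law[of "Suc n"] by simp
  qed
  show "wasserstein_distance (std_law (Suc n)) std_normal_distribution \<le> ereal (b (Suc n))" for n
    by (rule W) simp
  show "(\<lambda>n. b (Suc n)) \<longlonglongrightarrow> 0" using b by (rule LIMSEQ_Suc)
qed

end

theorem theorem3p3:
  fixes M :: "'a measure"
    and Y :: "nat \<Rightarrow> 'a \<Rightarrow> real ^ 'd"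
    and f :: "real ^ 'd \<Rightarrow> real"
    and N :: "nat \<Rightarrow> 'a \<Rightarrow> nat"
    and t :: "nat \<Rightarrow> real"
    and k :: nat
    and \<Gamma> :: "'v pair_pre_digraph"
  assumes "prob_space M"
    and f_nonneg: "\<forall>x. 0 \<le> f x"
    and f_bounded: "bounded (range f)"
    and f_cont: "AE x in lborel. isCont f x"
    and Y_density: "\<forall>i\<ge>1. distributed M lborel (Y i) (\<lambda>x. ennreal (f x))"
    and Y_indep: "prob_space.indep_vars M (\<lambda>_. borel) Y {1..}"
    and N_measurable: "\<forall>n\<ge>1. N n \<in> measurable M (count_space UNIV)"
    and N_poisson: "\<forall>n\<ge>1. distr M (count_space UNIV) (N n) = measure_pmf (poisson_pmf (real n))"
    and N_indep: "\<forall>n\<ge>1. indep_of_sequence M (N n) Y"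
    and t_pos: "\<forall>n\<ge>1. 0 < t n"
    and t_decreasing: "strict_antimono_on {1..} t"
    and t_lim: "t \<longlonglongrightarrow> 0"
    and k: "k \<ge> 2"
    and graph: "pair_graph \<Gamma>" "connected (with_proj \<Gamma>)" "card (pverts \<Gamma>) = k"
    and feasible: "\<forall>n\<ge>1. feasible M Y (t n) \<Gamma>"
  shows "(\<exists>C>0. \<forall>n\<ge>1.
           ((\<lambda>m. real m * t m ^ CARD('d)) \<longlonglongrightarrow> 0 \<and>
            filterlim (\<lambda>m. real m ^ k * (t m ^ CARD('d)) ^ (k - 1)) at_top sequentially \<longrightarrow>
              wasserstein_distance
                  (distr M borel (standardized M (poissonized_count t Y N \<Gamma> n))) std_normal_distribution
                \<le> ereal (C * (real n ^ k * (t n ^ CARD('d)) ^ (k - 1)) powr (-1/2))) \<and>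
           (filterlim (\<lambda>m. real m * t m ^ CARD('d)) at_top sequentially \<or>
            (\<exists>c>0. (\<lambda>m. real m * t m ^ CARD('d)) \<longlonglongrightarrow> c) \<longrightarrow>
              wasserstein_distance
                  (distr M borel (standardized M (poissonized_count t Y N \<Gamma> n))) std_normal_distribution
                \<le> ereal (C * real n powr (-1/2)))) \<and>
         (((\<lambda>m. real m * t m ^ CARD('d)) \<longlonglongrightarrow> 0 \<and>
            filterlim (\<lambda>m. real m ^ k * (t m ^ CARD('d)) ^ (k - 1)) at_top sequentially) \<or>
         filterlim (\<lambda>m. real m * t m ^ CARD('d)) at_top sequentially \<or>
         (\<exists>c>0. (\<lambda>m. real m * t m ^ CARD('d)) \<longlonglongrightarrow> c) \<longrightarrow>
           weak_conv_m (\<lambda>n. distr M borel (standardized M (poissonized_count t Y N \<Gamma> n)))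
             std_normal_distribution)"
proof -
  interpret poisson_disk_graph M Y f N t k \<Gamma>
    using assms by (intro poisson_disk_graph.intro poisson_disk_graph_axioms.intro)
  have dim: "DIM(real ^ 'd) = CARD('d)" by simp
  define S where "S \<longleftrightarrow> (\<lambda>m. real m * t m ^ CARD('d)) \<longlonglongrightarrow> 0 \<and>
    filterlim (\<lambda>m. real m ^ k * (t m ^ CARD('d)) ^ (k - 1)) at_top sequentially"
  define T where "T \<longleftrightarrow> filterlim (\<lambda>m. real m * t m ^ CARD('d)) at_top sequentially \<or>
    (\<exists>c>0. (\<lambda>m. real m * t m ^ CARD('d)) \<longlonglongrightarrow> c)"
  let ?s = "\<lambda>n. (real n ^ k * (t n ^ CARD('d)) ^ (k - 1)) powr (-1/2)"
  \<comment> \<open>The constant precedes the implications in the claim, so each regime's constant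
    is chosen by cases; where the regime fails its claim is void, and 1 will do.\<close>
  obtain C1 where C1: "C1 > 0" "S \<Longrightarrow> n \<ge> 1 \<Longrightarrow>
      wasserstein_distance (std_law n) std_normal_distribution \<le> ereal (C1 * ?s n)" for n
  proof (cases S)
    case True
    then show ?thesis using sparse_rate that unfolding dim S_def by blast
  next
    case False
    then show ?thesis using that[of 1] by simp
  qed
  obtain C2 where C2: "C2 > 0" "T \<Longrightarrow> n \<ge> 1 \<Longrightarrow>
      wasserstein_distance (std_law n) std_normal_distribution \<le> ereal (C2 * real n powr (-1/2))" for n
  proof (cases T)
    case True
    then show ?thesis using dense_rate that unfolding dim T_def by blast
  next
    case False
    then show ?thesis using that[of 1] by simp
  qed
  define C where "C = max C1 C2"
  have 1: "wasserstein_distance (std_law n) std_normal_distribution \<le> ereal (C * ?s n)" if S "n \<ge> 1" for n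
  proof -
    have "ereal (C1 * ?s n) \<le> ereal (C * ?s n)"
      unfolding ereal_less_eq C_def by (intro mult_right_mono) auto
    then show ?thesis using C1(2)[OF that] by (rule order_trans[rotated])
  qed
  have 2: "wasserstein_distance (std_law n) std_normal_distribution \<le> ereal (C * real n powr (-1/2))" if T "n \<ge> 1" for n
  proof -
    have "ereal (C2 * real n powr (-1/2)) \<le> ereal (C * real n powr (-1/2))"
      unfolding ereal_less_eq C_def by (intro mult_right_mono) auto
    then show ?thesis using C2(2)[OF that] by (rule order_trans[rotated])
  qed
  have "C > 0" using C1(1) by (simp add: C_def)
  moreover have "weak_conv_m std_law std_normal_distribution" if S
  proof (rule weak_convergence[OF 1[OF that]])
    have "?s \<longlonglongrightarrow> 0" using that unfolding S_def by (intro tendsto_neg_powr) auto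
    from tendsto_mult_left[OF this, of C] show "(\<lambda>n. C * ?s n) \<longlonglongrightarrow> 0" by simp
  qed
  moreover have "weak_conv_m std_law std_normal_distribution" if T
  proof (rule weak_convergence[OF 2[OF that]])
    have "(\<lambda>n. real n powr (-1/2)) \<longlonglongrightarrow> 0"
      by (intro tendsto_neg_powr filterlim_real_sequentially) auto
    from tendsto_mult_left[OF this, of C] show "(\<lambda>n. C * real n powr (-1/2)) \<longlonglongrightarrow> 0" by simp
  qed
  ultimately show ?thesis using 1 2 unfolding S_def T_def by blast
qed

end
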